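(* Let $(X,d,f,[\cdot,\cdot])$ be a mixing Smale space and let $G:X\to\mathbb{R}$ be a Hölder continuous potential, with equilibrium state $\mu_G$. Then for $\mu_G$-almost every $x\in X$ and all sufficiently small $\delta>0$ the following holds, where $\mu^u_{x,G}$ denotes the conditional Gibbs measure for $G$ supported on the local unstable manifold $W^u_\delta(x)$. For every closed set $K\subset\mathcal{M}(X)$, $$\limsup_{n\to\infty}\frac1n\log \mu^u_{x,G}\big(\{y:\zeta^n_y\in K\}\big)\le -\inf\{I(\nu):\nu\in K\},$$ and for every open set $J\subset\mathcal{M}(X)$, $$\liminf_{n\to\infty}\frac1n\log \mu^u_{x,G}\big(\{y:\zeta^n_y\in J\}\big)\ge -\inf\{I(\nu):\nu\in J\},$$ where $I:\mathcal{M}(X)\to[0,\infty]$ is given by $$I(\nu)=\begin{cases}P(G)-\int G\,d\nu-h_\nu(f), & \nu\in\mathcal{M}_f(X),\\ \infty, & \nu\notin\mathcal{M}_f(X).\end{cases}$$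
   Context: A Smale space $(X,d,f,[\cdot,\cdot])$ consists of a nonempty compact metric space $(X,d)$, a homeomorphism $f:X\to X$, and, for some $\epsilon>0$, a continuous map $[\cdot,\cdot]:\{(x,y)\in X\times X: d(x,y)<\epsilon\}\to X$ with $[x,x]=x$ and, whenever both sides are defined, $[[x,y],z]=[x,z]$, $[x,[y,z]]=[x,z]$, $f([x,y])=[f(x),f(y)]$; moreover there is $0<\lambda<1$ such that for every $x\in X$: if $d(x,y),d(x,z)<\epsilon$ and $[y,x]=x=[z,x]$ then $d(f(y),f(z))\le\lambda d(y,z)$; and if $d(x,y),d(x,z)<\epsilon$ and $[x,y]=x=[x,z]$ then $d(f^{-1}(y),f^{-1}(z))\le\lambda d(y,z)$. It is mixing if $f$ is topologically mixing. For small $\delta>0$ the local unstable manifold is $W^u_\delta(x)=\{y\in X: y=[y,x],\ d(x,y)<\delta\}$; let $d_u$ denote the induced metric on the unstable manifold $W^u(x)$. For $y\in W^u_\delta(x)$, $0<\epsilon<\delta$, $n\in\mathbb{N}$, the unstable Bowen ball is $B_{d_u}(y,n,\epsilon)=\{z\in W^u(x): d_u(f^iz,f^iy)<\epsilon \text{ for } 0\le i\le n-1\}$. A measure $\mu^u$ supported on $W^u_\delta(x)$ has the conditional Gibbs property for $G$ (and is then written $\mu^u_{x,G}$, the conditional Gibbs measure) if for every small $\epsilon>0$ there is $K(\epsilon)>0$ with $K^{-1}\le \mu^u(B_{d_u}(y,n,\epsilon))/e^{S_nG(y)-nP(G)}\le K$ for all $y\in W^u_\delta(x)$, $n\in\mathbb{N}$;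 here $S_nG=\sum_{i=0}^{n-1}G\circ f^i$ and $P(G)$ is the topological pressure of $G$. $\mathcal{M}(X)$ is the space of Borel probability measures on $X$ with the weak* topology, $\mathcal{M}_f(X)$ the $f$-invariant ones, $h_\nu(f)$ the measure-theoretic entropy. For $y\in X$, $n\in\mathbb{N}$, the orbital measure is $\zeta^n_y=\frac1n\sum_{i=0}^{n-1}\delta_{f^iy}$. *)

theory Defs
  imports "HOL-Probability.Probability"
begin

definition smale_space :: "('a::metric_space \<Rightarrow> 'a) \<Rightarrow> ('a \<Rightarrow> 'a \<Rightarrow> 'a) \<Rightarrow> bool" where
  "smale_space f br \<longleftrightarrow>
     compact (UNIV :: 'a set) \<and> bij f \<and> continuous_on UNIV f \<and> continuous_on UNIV (inv f) \<and>
     (\<exists>\<epsilon>>0.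
        continuous_on {p :: 'a \<times> 'a. dist (fst p) (snd p) < \<epsilon>} (\<lambda>p. br (fst p) (snd p)) \<and>
        (\<forall>x. br x x = x) \<and>
        (\<forall>x y z. dist x y < \<epsilon> \<and> dist (br x y) z < \<epsilon> \<and> dist x z < \<epsilon>
                   \<longrightarrow> br (br x y) z = br x z) \<and>
        (\<forall>x y z. dist y z < \<epsilon> \<and> dist x (br y z) < \<epsilon> \<and> dist x z < \<epsilon>
                   \<longrightarrow> br x (br y z) = br x z) \<and>
        (\<forall>x y. dist x y < \<epsilon> \<and> dist (f x) (f y) < \<epsilon> \<longrightarrow> f (br x y) = br (f x) (f y)) \<and>
        (\<exists>lam. 0 < lam \<and> lam < 1 \<and>
           (\<forall>x y z. dist x y < \<epsilon> \<and> dist x z < \<epsilon> \<and> br y x = x \<and> br z x = x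
                     \<longrightarrow> dist (f y) (f z) \<le> lam * dist y z) \<and>
           (\<forall>x y z. dist x y < \<epsilon> \<and> dist x z < \<epsilon> \<and> br x y = x \<and> br x z = x
                     \<longrightarrow> dist (inv f y) (inv f z) \<le> lam * dist y z)))"

definition topologically_mixing :: "('a::topological_space \<Rightarrow> 'a) \<Rightarrow> bool" where
  "topologically_mixing f \<longleftrightarrow>
     (\<forall>U V. open U \<and> open V \<and> U \<noteq> {} \<and> V \<noteq> {} \<longrightarrow>
        (\<exists>N. \<forall>n\<ge>N. (f ^^ n) ` U \<inter> V \<noteq> {}))"

definition holder_continuous :: "('a::metric_space \<Rightarrow> real) \<Rightarrow> bool" where
  "holder_continuous G \<longleftrightarrow> (\<exists>C \<alpha>. 0 < \<alpha> \<and> (\<forall>x y. \<bar>G x - G y\<bar> \<le> C * dist x y powr \<alpha>))"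

definition birkhoff_sum :: "('a \<Rightarrow> 'a) \<Rightarrow> ('a \<Rightarrow> real) \<Rightarrow> nat \<Rightarrow> 'a \<Rightarrow> real" where
  "birkhoff_sum f G n y = (\<Sum>i<n. G ((f ^^ i) y))"

definition separated_set :: "('a::metric_space \<Rightarrow> 'a) \<Rightarrow> nat \<Rightarrow> real \<Rightarrow> 'a set \<Rightarrow> bool" where
  "separated_set f n \<epsilon> E \<longleftrightarrow>
     (\<forall>y\<in>E. \<forall>z\<in>E. y \<noteq> z \<longrightarrow> (\<exists>i<n. dist ((f ^^ i) y) ((f ^^ i) z) > \<epsilon>))"

definition partition_sum :: "('a::metric_space \<Rightarrow> 'a) \<Rightarrow> ('a \<Rightarrow> real) \<Rightarrow> nat \<Rightarrow> real \<Rightarrow> real" where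
  "partition_sum f G n \<epsilon> =
     Sup {(\<Sum>y\<in>E. exp (birkhoff_sum f G n y)) | E. finite E \<and> separated_set f n \<epsilon> E}"

definition topological_pressure :: "('a::metric_space \<Rightarrow> 'a) \<Rightarrow> ('a \<Rightarrow> real) \<Rightarrow> real" where
  "topological_pressure f G =
     real_of_ereal (Lim (at_right 0)
        (\<lambda>\<epsilon>::real. limsup (\<lambda>n. ereal (ln (partition_sum f G n \<epsilon>) / real n))))"

definition borel_prob_measures :: "'a::topological_space measure set" where
  "borel_prob_measures = {\<nu>. prob_space \<nu> \<and> sets \<nu> = sets borel}"

definition invariant_measures :: "('a::topological_space \<Rightarrow> 'a) \<Rightarrow> 'a measure set" where
  "invariant_measures f = {\<nu> \<in> borel_prob_measures. distr \<nu> borel f = \<nu>}"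

definition finite_meas_partition :: "'a measure \<Rightarrow> 'a set set \<Rightarrow> bool" where
  "finite_meas_partition \<nu> P \<longleftrightarrow> finite P \<and> P \<subseteq> sets \<nu> \<and> \<Union>P = space \<nu> \<and>
     (\<forall>A\<in>P. \<forall>B\<in>P. A \<noteq> B \<longrightarrow> A \<inter> B = {})"

definition refined_partition :: "('a \<Rightarrow> 'a) \<Rightarrow> 'a set set \<Rightarrow> nat \<Rightarrow> 'a set set" where
  "refined_partition f P n =
     {(\<Inter>i<n. (f ^^ i) -` (a i)) | a. \<forall>i<n. a i \<in> P} - {{}}"

definition partition_entropy :: "'a measure \<Rightarrow> 'a set set \<Rightarrow> real" where
  "partition_entropy \<nu> P = - (\<Sum>A\<in>P. (if measure \<nu> A = 0 then 0 else measure \<nu> A * ln (measure \<nu> A)))"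

definition entropy_wrt_partition :: "('a \<Rightarrow> 'a) \<Rightarrow> 'a measure \<Rightarrow> 'a set set \<Rightarrow> real" where
  "entropy_wrt_partition f \<nu> P = lim (\<lambda>n. partition_entropy \<nu> (refined_partition f P n) / real n)"

definition ms_entropy :: "('a \<Rightarrow> 'a) \<Rightarrow> 'a measure \<Rightarrow> ereal" where
  "ms_entropy f \<nu> = (SUP P\<in>{P. finite_meas_partition \<nu> P}. ereal (entropy_wrt_partition f \<nu> P))"

definition equilibrium_state :: "('a::metric_space \<Rightarrow> 'a) \<Rightarrow> ('a \<Rightarrow> real) \<Rightarrow> 'a measure \<Rightarrow> bool" where
  "equilibrium_state f G \<mu> \<longleftrightarrow> \<mu> \<in> invariant_measures f \<and>
     ms_entropy f \<mu> + ereal (\<integral>x. G x \<partial>\<mu>) = ereal (topological_pressure f G)"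

text \<open>Weak-* topology on the Borel probability measures: coarsest topology making
  \<nu> \<mapsto> \<integral> g d\<nu> continuous for every continuous g. Its topspace is borel_prob_measures.\<close>

definition weak_star :: "'a::topological_space measure topology" where
  "weak_star = topology_generated_by
     {{\<nu> \<in> borel_prob_measures. (\<integral>x. g x \<partial>\<nu>) \<in> V} | (g :: 'a \<Rightarrow> real) V. continuous_on UNIV g \<and> open V}"

definition orbital_measure :: "('a::topological_space \<Rightarrow> 'a) \<Rightarrow> nat \<Rightarrow> 'a \<Rightarrow> 'a measure" where
  "orbital_measure f n y = distr (uniform_measure (count_space UNIV) {..<n}) borel (\<lambda>i. (f ^^ i) y)"

definition rate_function :: "('a::metric_space \<Rightarrow> 'a) \<Rightarrow> ('a \<Rightarrow> real) \<Rightarrow> 'a measure \<Rightarrow> ereal" where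
  "rate_function f G \<nu> =
     (if \<nu> \<in> invariant_measures f
      then ereal (topological_pressure f G) - ereal (\<integral>x. G x \<partial>\<nu>) - ms_entropy f \<nu>
      else \<infinity>)"

text \<open>Unstable manifolds, with d_u the induced (restricted) metric.\<close>

definition local_unstable :: "('a::metric_space \<Rightarrow> 'a \<Rightarrow> 'a) \<Rightarrow> real \<Rightarrow> 'a \<Rightarrow> 'a set" where
  "local_unstable br \<delta> x = {y. y = br y x \<and> dist x y < \<delta>}"

definition unstable_manifold :: "('a::metric_space \<Rightarrow> 'a) \<Rightarrow> 'a \<Rightarrow> 'a set" where
  "unstable_manifold f x = {y. (\<lambda>n. dist ((inv f ^^ n) y) ((inv f ^^ n) x)) \<longlonglongrightarrow> 0}"

definition unstable_bowen_ball :: "('a::metric_space \<Rightarrow> 'a) \<Rightarrow> 'a \<Rightarrow> 'a \<Rightarrow> nat \<Rightarrow> real \<Rightarrow> 'a set" where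
  "unstable_bowen_ball f x y n \<epsilon> =
     {z \<in> unstable_manifold f x. \<forall>i<n. dist ((f ^^ i) z) ((f ^^ i) y) < \<epsilon>}"

definition conditional_gibbs ::
  "('a::metric_space \<Rightarrow> 'a) \<Rightarrow> ('a \<Rightarrow> 'a \<Rightarrow> 'a) \<Rightarrow> ('a \<Rightarrow> real) \<Rightarrow> real \<Rightarrow> 'a \<Rightarrow> 'a measure \<Rightarrow> bool" where
  "conditional_gibbs f br G \<delta> x \<mu> \<longleftrightarrow>
     sets \<mu> = sets borel \<and> finite_measure \<mu> \<and> (AE y in \<mu>. y \<in> local_unstable br \<delta> x) \<and>
     (\<exists>\<epsilon>0>0. \<forall>\<epsilon>. 0 < \<epsilon> \<and> \<epsilon> < \<epsilon>0 \<longrightarrow>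
        (\<exists>K>0. \<forall>y\<in>local_unstable br \<delta> x. \<forall>n\<ge>1.
           inverse K \<le> measure \<mu> (unstable_bowen_ball f x y n \<epsilon>)
                         / exp (birkhoff_sum f G n y - real n * topological_pressure f G)
         \<and> measure \<mu> (unstable_bowen_ball f x y n \<epsilon>)
                         / exp (birkhoff_sum f G n y - real n * topological_pressure f G) \<le> K))"

definition elog :: "real \<Rightarrow> ereal" where
  "elog t = (if t \<le> 0 then -\<infinity> else ereal (ln t))"

end

theory Submission
  imports Defs
begin

text \<open>The pressure enters both the Gibbs property and the rate function only as the same additive
  constant, so the bounds reduce to counting orbit segments by their orbital measures. For the
  upper bound, the space of probability measures is compact, and near an invariant \<open>\<nu>\<close> the words
  of length \<open>n\<close> of a small partition with \<open>\<nu>\<close>-null boundary are weighed by a product measure on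
  \<open>m\<close>-blocks: segments whose orbital measure is close to \<open>\<nu>\<close> have weight at least
  \<open>exp (- n (h + \<eta>))\<close>, so there are at most about \<open>exp (n (h + \<eta>))\<close> separated ones. For the lower
  bound, \<open>m\<close>-blocks are drawn independently with the law of \<open>\<nu>\<close> and glued by specification to
  orbits that start on the local unstable set. The independence makes the weak law of large numbers
  sufficient, so neither ergodicity of \<open>\<nu>\<close> nor an approximation by ergodic measures is needed.\<close>

section \<open>Entropy of finite-valued labels\<close>

text \<open>For the upper bound the count must hold on a weak-* neighbourhood of
  \<open>\<nu>\<close>, whereas the log-weight of an orbit is a Birkhoff sum of a step function.
  Null boundaries give this function a continuous majorant of nearly the same integral, and mixing
  the block law with the uniform law keeps log-weights bounded; closeness to \<open>\<nu>\<close>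
  then becomes one open inequality between integrals. For the lower bound, partitions need not be
  related to the metric, so passing to separated orbits must not lose entropy: closed cores of the
  atoms are metrically apart. Fekete's limit is also an infimum, hence blocks of every length
  \<open>m\<close> have entropy at least \<open>m\<close> times the rate. The gap \<open>M\<close>
  of the specification depends only on the scale, so \<open>m\<close> can be taken large after
  \<open>M\<close>, and the time spent in gaps becomes negligible. The Gibbs property links counting
  and measure at one scale in each direction: balls of twice the separation scale cover the event,
  balls of a sixth of it are disjoint.\<close>

text \<open>Shannon entropy in nats of the law of \<open>F\<close>. Null values contribute
  \<open>0 * ln 0 = 0\<close>. Labels are used instead of set partitions because joins become pairs
  and dynamical refinements become words.\<close>

definition label_entropy :: "'a measure \<Rightarrow> ('a \<Rightarrow> 'b) \<Rightarrow> real" where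
  "label_entropy \<nu> F =
     - (\<Sum>v\<in>F ` space \<nu>. measure \<nu> (F -` {v} \<inter> space \<nu>) * ln (measure \<nu> (F -` {v} \<inter> space \<nu>)))"

definition word :: "('a \<Rightarrow> 'a) \<Rightarrow> ('a \<Rightarrow> 'b) \<Rightarrow> nat \<Rightarrow> 'a \<Rightarrow> 'b list" where
  "word f c n y = map (\<lambda>i. c ((f ^^ i) y)) [0..<n]"

lemma word_0 [simp]: "word f c 0 y = []"
  by (simp add: word_def)

lemma length_word [simp]: "length (word f c n y) = n"
  by (simp add: word_def)

lemma word_add: "word f c (m + n) y = word f c m y @ word f c n ((f ^^ m) y)"
proof (rule nth_equalityI)
  fix i assume "i < length (word f c (m + n) y)"
  moreover have "(f ^^ (i - m)) ((f ^^ m) y) = (f ^^ i) y" if "m \<le> i"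
    using that by (metis comp_apply funpow_add le_add_diff_inverse2)
  ultimately show "word f c (m + n) y ! i = (word f c m y @ word f c n ((f ^^ m) y)) ! i"
    by (auto simp: word_def nth_append)
qed simp

lemma word_Suc: "word f c (Suc n) y = c y # word f c n (f y)"
  using word_add[of f c 1 n y] by (simp add: word_def)

lemma word_eq_iff: "word f c n y = word f c n z \<longleftrightarrow> (\<forall>i<n. c ((f ^^ i) y) = c ((f ^^ i) z))"
  by (auto simp: word_def)

lemma set_word_subset: "set (word f c n y) \<subseteq> range c"
  by (auto simp: word_def)

context prob_space
begin

lemma label_entropy_eq_entropy:
  assumes "simple_function M F"
  shows "label_entropy M F = entropy (exp 1) (count_space (F ` space M)) F"
proof -
  interpret information_space M "exp 1"
    by standard simp
  show ?thesis
    unfolding label_entropy_def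
    by (subst entropy_simple_distributed[OF simple_distributedI[OF assms measure_nonneg refl]])
       (simp add: log_def)
qed

lemma label_entropy_pair_le:
  assumes F: "simple_function M F" and G: "simple_function M G"
  shows "label_entropy M (\<lambda>x. (F x, G x)) \<le> label_entropy M F + label_entropy M G"
proof -
  interpret information_space M "exp 1"
    by standard simp
  show ?thesis
    using entropy_chain_rule[OF F G] conditional_entropy_less_eq_entropy[OF G F]
    by (simp add: label_entropy_eq_entropy F G simple_function_Pair)
qed

lemma label_entropy_comp_le:
  assumes F: "simple_function M F"
  shows "label_entropy M (\<lambda>x. g (F x)) \<le> label_entropy M F"
proof -
  interpret information_space M "exp 1"
    by standard simp
  show ?thesis
    using entropy_data_processing[OF F, of g] simple_function_compose[OF F, of g]
    by (simp add: label_entropy_eq_entropy F o_def)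
qed

text \<open>\<open>G\<close> is a function of \<open>F\<close>: the factor map evaluates
  \<open>G\<close> at a chosen point of each level set of \<open>F\<close>. This reduces the claim
  to data processing.\<close>

lemma label_entropy_factor_le:
  assumes F: "simple_function M F"
    and det: "\<And>x y. x \<in> space M \<Longrightarrow> y \<in> space M \<Longrightarrow> F x = F y \<Longrightarrow> G x = G y"
  shows "label_entropy M G \<le> label_entropy M F"
proof -
  define g where "g v = G (SOME y. y \<in> space M \<and> F y = v)" for v
  have g: "g (F x) = G x" if "x \<in> space M" for x
  proof -
    have "(SOME y. y \<in> space M \<and> F y = F x) \<in> space M \<and> F (SOME y. y \<in> space M \<and> F y = F x) = F x"
      by (rule someI[of _ x]) (simp add: that)
    thus ?thesis
      unfolding g_def using that by (intro det) auto
  qed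
  have im: "G ` space M = (\<lambda>x. g (F x)) ` space M"
    using g by (intro image_cong) auto
  have pre: "G -` {v} \<inter> space M = (\<lambda>x. g (F x)) -` {v} \<inter> space M" for v
    using g by auto
  have "label_entropy M G = label_entropy M (\<lambda>x. g (F x))"
    unfolding label_entropy_def im pre ..
  thus ?thesis
    using label_entropy_comp_le[OF F] by metis
qed

lemma label_entropy_nonneg: "0 \<le> label_entropy M F"
proof -
  have "measure M A * ln (measure M A) \<le> 0" for A
    by (cases "measure M A = 0") (auto simp: mult_le_0_iff zero_less_measure_iff)
  thus ?thesis
    unfolding label_entropy_def by (simp add: sum_nonpos)
qed

end

text \<open>Fekete's subadditive lemma with the limit identified as an infimum; the second
  conclusion makes the limiting rate a lower bound at every finite length.\<close>

lemma fekete: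
  fixes a :: "nat \<Rightarrow> real"
  assumes sub: "\<And>m n. a (m + n) \<le> a m + a n" and nonneg: "\<And>n. 0 \<le> a n"
  obtains L where "(\<lambda>n. a n / real n) \<longlonglongrightarrow> L" "\<And>n. n \<ge> 1 \<Longrightarrow> L * real n \<le> a n"
proof -
  define L where "L = (INF n\<in>{1..}. a n / real n)"
  have bdd: "bdd_below ((\<lambda>n. a n / real n) ` {1..})"
    by (rule bdd_belowI[of _ 0]) (auto simp: nonneg)
  have L: "L \<le> a n / real n" if "n \<ge> 1" for n
    unfolding L_def using that by (intro cINF_lower bdd) auto
  have mult: "a (q * m) \<le> real q * a m" if "q \<ge> 1" for q m
    using that
  proof (induction q rule: nat_induct_at_least)
    case (Suc q)
    have "a (Suc q * m) \<le> a m + a (q * m)"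
      using sub[of m "q * m"] by simp
    thus ?case using Suc by (simp add: algebra_simps)
  qed simp
  have "(\<lambda>n. a n / real n) \<longlonglongrightarrow> L"
  proof (rule LIMSEQ_I)
    fix e :: real assume e: "e > 0"
    have "\<exists>n\<in>{1..}. a n / real n < L + e / 2"
      using e bdd unfolding L_def by (subst cINF_less_iff[symmetric]) auto
    then obtain m where m: "m \<ge> 1" "a m / real m < L + e / 2" by auto
    \<comment> \<open>Bounds the term of the remainder \<open>n mod m\<close>, which disappears
      after division by \<open>n\<close>.\<close>
    define B where "B = Max (a ` {..m})"
    have B: "a i \<le> B" if "i \<le> m" for i
      unfolding B_def using that by (intro Max_ge) auto
    have B0: "0 \<le> B" using B[of 0] nonneg[of 0] by simp
    obtain N :: nat where N: "real N > 2 * B / e"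
      using reals_Archimedean2 by blast
    have "norm (a n / real n - L) < e" if n: "n \<ge> max (Suc N) m" for n
    proof -
      have n1: "n \<ge> 1" "n \<ge> m" using n by auto
      define q where "q = n div m"
      have q1: "q \<ge> 1" using n1 m by (simp add: q_def div_greater_zero_iff Suc_leI)
      have "a n \<le> a (q * m) + a (n mod m)"
        using sub[of "q * m" "n mod m"] by (simp add: q_def)
      also have "\<dots> \<le> real q * a m + B"
        using mult[OF q1] B[of "n mod m"] m by (simp add: add_mono less_imp_le)
      also have "real q * a m = real (q * m) * (a m / real m)"
        using m by simp
      also have "\<dots> \<le> real n * (a m / real m)"
        using nonneg[of m] by (intro mult_right_mono of_nat_mono) (auto simp: q_def)
      finally have "a n / real n \<le> a m / real m + B / real n"
        using n1 by (simp add: field_simps)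
      also have "B / real n < e / 2"
      proof -
        have "real N \<le> real n" using n by simp
        hence "2 * B / e < real n" using N by linarith
        thus ?thesis using e n1 by (simp add: field_simps)
      qed
      finally show ?thesis using m L[OF n1(1)] by simp
    qed
    thus "\<exists>no. \<forall>n\<ge>no. norm (a n / real n - L) < e" by blast
  qed
  thus ?thesis
    using that[of L] L by (simp add: field_simps)
qed

locale invariant_measure = prob_space \<nu> for \<nu> :: "'a::metric_space measure" +
  fixes f :: "'a \<Rightarrow> 'a"
  assumes sets_eq [measurable_cong, simp]: "sets \<nu> = sets borel"
    and f_meas [measurable]: "f \<in> borel_measurable borel"
    and distr_eq: "distr \<nu> borel f = \<nu>"
begin

lemma space_eq [simp]: "space \<nu> = UNIV"
  using sets_eq_imp_space_eq[OF sets_eq] by simp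

lemma funpow_meas [measurable]: "(f ^^ n) \<in> borel_measurable borel"
  by (induction n) (auto simp: o_def)

lemma distr_funpow: "distr \<nu> borel (f ^^ n) = \<nu>"
proof (induction n)
  case 0
  have "distr \<nu> borel id = distr \<nu> \<nu> id"
    by (rule distr_cong) auto
  thus ?case by (simp add: id_def)
next
  case (Suc n)
  have "distr (distr \<nu> borel (f ^^ n)) borel f = distr \<nu> borel (f \<circ> f ^^ n)"
    by (rule distr_distr) auto
  thus ?case using Suc distr_eq by (simp del: comp_apply)
qed

lemma measure_vimage_funpow:
  "A \<in> sets borel \<Longrightarrow> measure \<nu> ((f ^^ n) -` A) = measure \<nu> A"
  using measure_distr[of "f ^^ n" \<nu> borel A] by (simp add: distr_funpow)

lemma integral_funpow:
  fixes g :: "'a \<Rightarrow> real"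
  assumes "g \<in> borel_measurable borel"
  shows "(\<integral>y. g ((f ^^ n) y) \<partial>\<nu>) = (\<integral>y. g y \<partial>\<nu>)"
  using integral_distr[of "f ^^ n" \<nu> borel g] assms by (simp add: distr_funpow)

lemma simple_function_funpow:
  assumes "simple_function \<nu> c"
  shows "simple_function \<nu> (\<lambda>y. c ((f ^^ n) y))"
proof -
  have "finite (range (\<lambda>y. c ((f ^^ n) y)))"
    using assms by (auto simp: simple_function_def intro: finite_subset[of _ "range c"])
  moreover have "(\<lambda>y. c ((f ^^ n) y)) -` {v} \<in> sets borel" for v
  proof (cases "v \<in> range c")
    case True
    hence "c -` {v} \<in> sets borel" using assms by (auto simp: simple_function_def)
    hence "(f ^^ n) -` (c -` {v}) \<inter> space borel \<in> sets borel"
      by (rule measurable_sets[OF funpow_meas])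
    thus ?thesis by (simp add: vimage_def)
  next
    case False
    hence "(\<lambda>y. c ((f ^^ n) y)) -` {v} = {}" by auto
    thus ?thesis by simp
  qed
  ultimately show ?thesis by (auto simp: simple_function_def)
qed

lemma simple_function_word:
  assumes c: "simple_function \<nu> c"
  shows "simple_function \<nu> (word f c n)"
proof (induction n)
  case 0
  have "word f c 0 = (\<lambda>_. [])" by (rule ext) simp
  thus ?case by simp
next
  case (Suc n)
  have "word f c (Suc n) = (\<lambda>y. (\<lambda>(a, b). a # b) (c y, word f c n (f y)))"
    by (rule ext) (simp add: word_Suc)
  moreover have "simple_function \<nu> (\<lambda>y. word f c n ((f ^^ 1) y))"
    by (rule simple_function_funpow[OF Suc])
  hence "simple_function \<nu> (\<lambda>y. (\<lambda>(a, b). a # b) (c y, word f c n (f y)))"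
    by (intro simple_function_compose1[OF simple_function_Pair[OF c]]) simp
  ultimately show ?case by (simp only:)
qed

lemma label_entropy_funpow:
  assumes "simple_function \<nu> c"
  shows "label_entropy \<nu> (\<lambda>y. c ((f ^^ n) y)) = label_entropy \<nu> c"
proof -
  let ?c = "\<lambda>y. c ((f ^^ n) y)"
  have eq: "measure \<nu> (?c -` {v}) = measure \<nu> (c -` {v})" if "v \<in> range c" for v
  proof -
    have "c -` {v} \<in> sets borel" using assms that by (auto simp: simple_function_def)
    from measure_vimage_funpow[OF this, of n] show ?thesis by (simp add: vimage_def)
  qed
  have "label_entropy \<nu> ?c
      = - (\<Sum>v\<in>range c. measure \<nu> (?c -` {v}) * ln (measure \<nu> (?c -` {v})))"
  proof -
    have "measure \<nu> (?c -` {v}) = 0" if "v \<notin> range ?c" for v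
    proof -
      have "?c -` {v} = {}" using that by auto
      thus ?thesis by simp
    qed
    thus ?thesis
      using assms unfolding label_entropy_def
      by (intro arg_cong[where f=uminus]) (auto simp: simple_function_def intro!: sum.mono_neutral_left)
  qed
  also have "\<dots> = label_entropy \<nu> c"
    unfolding label_entropy_def by (simp add: eq cong: sum.cong)
  finally show ?thesis .
qed

lemma label_entropy_word_add:
  assumes c: "simple_function \<nu> c"
  shows "label_entropy \<nu> (word f c (m + n)) \<le> label_entropy \<nu> (word f c m) + label_entropy \<nu> (word f c n)"
proof -
  have s1: "simple_function \<nu> (word f c m)" and s2: "simple_function \<nu> (\<lambda>y. word f c n ((f ^^ m) y))"
    using simple_function_word[OF c] simple_function_funpow by blast+
  have "label_entropy \<nu> (word f c (m + n)) \<le> label_entropy \<nu> (\<lambda>y. (word f c m y, word f c n ((f ^^ m) y)))"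
    by (rule label_entropy_factor_le) (auto simp: s1 s2 simple_function_Pair word_add)
  also have "\<dots> \<le> label_entropy \<nu> (word f c m) + label_entropy \<nu> (word f c n)"
    using label_entropy_pair_le[OF s1 s2] label_entropy_funpow[OF simple_function_word[OF c]] by simp
  finally show ?thesis .
qed

lemma label_entropy_word_le:
  assumes c: "simple_function \<nu> c"
  shows "label_entropy \<nu> (word f c n) \<le> real n * label_entropy \<nu> c"
proof (induction n)
  case 0
  have "word f c 0 = (\<lambda>_. [])" by (rule ext) simp
  moreover have "label_entropy \<nu> (\<lambda>_. []) = 0"
    using prob_space by (auto simp: label_entropy_def)
  ultimately show ?case by (metis of_nat_0 mult_zero_left order_refl)
next
  case (Suc n)
  have "label_entropy \<nu> (word f c 1) \<le> label_entropy \<nu> c"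
    by (rule label_entropy_factor_le[OF c]) (simp add: word_def)
  thus ?case using label_entropy_word_add[OF c, of 1 n] Suc by (simp add: algebra_simps)
qed

definition label_rate :: "('a \<Rightarrow> 'b) \<Rightarrow> real" where
  "label_rate c = lim (\<lambda>n. label_entropy \<nu> (word f c n) / real n)"

lemma label_rate:
  assumes c: "simple_function \<nu> c"
  shows "(\<lambda>n. label_entropy \<nu> (word f c n) / real n) \<longlonglongrightarrow> label_rate c"
    and "n \<ge> 1 \<Longrightarrow> label_rate c * real n \<le> label_entropy \<nu> (word f c n)"
    and "0 \<le> label_rate c"
proof -
  obtain L where L: "(\<lambda>n. label_entropy \<nu> (word f c n) / real n) \<longlonglongrightarrow> L"
    "\<And>n. n \<ge> 1 \<Longrightarrow> L * real n \<le> label_entropy \<nu> (word f c n)"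
    using fekete[of "\<lambda>n. label_entropy \<nu> (word f c n)", OF label_entropy_word_add[OF c]
      label_entropy_nonneg] by blast
  have LL: "label_rate c = L"
    unfolding label_rate_def using L(1) by (rule limI)
  show "(\<lambda>n. label_entropy \<nu> (word f c n) / real n) \<longlonglongrightarrow> label_rate c"
    and "n \<ge> 1 \<Longrightarrow> label_rate c * real n \<le> label_entropy \<nu> (word f c n)"
    using L by (simp_all add: LL)
  show "0 \<le> label_rate c"
    unfolding LL by (rule LIMSEQ_le_const[OF L(1)]) (auto simp: label_entropy_nonneg)
qed

text \<open>Atoms of the refined partition are the level sets of the word map. Since empty
  intersections were removed from \<open>refined_partition\<close>, atoms and occurring words
  correspond bijectively, and the entropy sum can be reindexed.\<close>

lemma partition_entropy_refined:
  assumes P: "\<And>y. c y \<in> P \<and> y \<in> c y" and disj: "\<And>A y. A \<in> P \<Longrightarrow> y \<in> A \<Longrightarrow> A = c y"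
  shows "partition_entropy \<nu> (refined_partition f P n) = label_entropy \<nu> (word f c n)"
proof -
  define h where "h w = (word f c n) -` {w}" for w
  have mem: "y \<in> A \<longleftrightarrow> c y = A" if "A \<in> P" for A y
    using P disj that by blast
  have h: "h (word f c n y) = (\<Inter>i<n. (f ^^ i) -` (c ((f ^^ i) y)))" for y
    using P by (auto simp: h_def word_eq_iff mem)
  have "refined_partition f P n = h ` range (word f c n)"
  proof (intro equalityI subsetI)
    fix A assume "A \<in> refined_partition f P n"
    then obtain a y where a: "A = (\<Inter>i<n. (f ^^ i) -` (a i))" "\<forall>i<n. a i \<in> P" "y \<in> A"
      by (auto simp: refined_partition_def)
    have ai: "a i = c ((f ^^ i) y)" if "i < n" for i
      using a that by (intro disj) auto
    have "A = h (word f c n y)"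
      unfolding a(1) h by (intro INF_cong refl) (simp add: ai)
    thus "A \<in> h ` range (word f c n)" by auto
  next
    fix A assume "A \<in> h ` range (word f c n)"
    then obtain y where y: "A = h (word f c n y)" by auto
    have "A = (\<Inter>i<n. (f ^^ i) -` (c ((f ^^ i) y)))"
      unfolding y h ..
    moreover have "A \<noteq> {}" by (auto simp: y h_def)
    ultimately show "A \<in> refined_partition f P n"
      unfolding refined_partition_def using P
      by (intro DiffI CollectI exI[of _ "\<lambda>i. c ((f ^^ i) y)"]) auto
  qed
  moreover have "inj_on h (range (word f c n))"
    by (auto simp: inj_on_def h_def)
  moreover have "(if measure \<nu> A = 0 then 0 else measure \<nu> A * ln (measure \<nu> A)) = measure \<nu> A * ln (measure \<nu> A)" for A
    by simp
  ultimately show ?thesis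
    unfolding partition_entropy_def label_entropy_def
    by (simp add: sum.reindex) (simp add: h_def)
qed

lemma entropy_wrt_partition_eq_label_rate:
  assumes P: "\<And>y. c y \<in> P \<and> y \<in> c y" and disj: "\<And>A y. A \<in> P \<Longrightarrow> y \<in> A \<Longrightarrow> A = c y"
  shows "entropy_wrt_partition f \<nu> P = label_rate c"
  unfolding entropy_wrt_partition_def label_rate_def by (simp add: partition_entropy_refined[of c P] assms)

text \<open>The label of a point is the atom that contains it, so the level sets of the label are
  the atoms themselves.\<close>

lemma finite_meas_partition_label:
  assumes "finite_meas_partition \<nu> P"
  obtains c :: "'a \<Rightarrow> 'a set" where "simple_function \<nu> c" "entropy_wrt_partition f \<nu> P = label_rate c"
proof -
  define c where "c y = (THE A. A \<in> P \<and> y \<in> A)" for y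
  have ex: "\<exists>!A. A \<in> P \<and> y \<in> A" for y
  proof -
    have "\<Union>P = UNIV" "\<And>A B. A \<in> P \<Longrightarrow> B \<in> P \<Longrightarrow> A \<noteq> B \<Longrightarrow> A \<inter> B = {}"
      using assms by (auto simp: finite_meas_partition_def)
    thus ?thesis by blast
  qed
  have P: "c y \<in> P \<and> y \<in> c y" for y
    unfolding c_def by (rule theI'[OF ex])
  have disj: "A = c y" if "A \<in> P" "y \<in> A" for A y
    unfolding c_def using the1_equality[OF ex] that by metis
  have "c z = c y \<longleftrightarrow> z \<in> c y" for y z
    using P[of y] P[of z] disj[of "c y" z] by auto
  hence "c -` {c y} = c y" for y
    by auto
  hence "simple_function \<nu> c"
    using assms P finite_subset[of "range c" P]
    by (auto simp: simple_function_def finite_meas_partition_def)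
  thus ?thesis
    using that[of c] entropy_wrt_partition_eq_label_rate[of c P] P disj by simp
qed

text \<open>The level sets of \<open>c\<close> form a partition. Its canonical label
  \<open>c'\<close> and \<open>c\<close> determine each other, so their words have the same entropy
  at every length.\<close>

lemma label_rate_le_ms_entropy:
  assumes c: "simple_function \<nu> c"
  shows "ereal (label_rate c) \<le> ms_entropy f \<nu>"
proof -
  define P where "P = range (\<lambda>y. c -` {c y})"
  have "P = (\<lambda>v. c -` {v}) ` range c" by (auto simp: P_def)
  hence fin: "finite P" using c by (simp add: simple_function_def)
  have part: "finite_meas_partition \<nu> P"
    using c fin by (auto simp: finite_meas_partition_def P_def simple_function_def)
  define c' where "c' y = c -` {c y}" for y
  have "entropy_wrt_partition f \<nu> P = label_rate c'"
    by (rule entropy_wrt_partition_eq_label_rate) (auto simp: P_def c'_def)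
  also have "\<dots> = label_rate c"
  proof -
    have c': "simple_function \<nu> c'"
      unfolding c'_def using simple_function_compose1[OF c, of "\<lambda>v. c -` {v}"] by simp
    have "label_entropy \<nu> (word f c' n) = label_entropy \<nu> (word f c n)" for n
      by (intro antisym label_entropy_factor_le simple_function_word c c')
         (auto simp: word_eq_iff c'_def)
    thus ?thesis by (simp add: label_rate_def)
  qed
  finally show ?thesis
    unfolding ms_entropy_def using part by (metis SUP_upper mem_Collect_eq)
qed

end

section \<open>Borel measures on metric spaces\<close>

lemma open_approx:
  fixes U :: "'a::metric_space set"
  assumes "open U"
  obtains u :: "nat \<Rightarrow> 'a \<Rightarrow> real" where
    "\<And>k. continuous_on UNIV (u k)" "\<And>k y. 0 \<le> u k y" "\<And>k y. u k y \<le> indicator U y"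
    "\<And>k l y. k \<le> l \<Longrightarrow> u k y \<le> u l y" "\<And>y. (\<lambda>k. u k y) \<longlonglongrightarrow> indicator U y"
proof (cases "U = UNIV")
  \<comment> \<open>\<open>infdist\<close> to the empty set is 0 by convention, so the formula of
    the other case would give the zero function here.\<close>
  case True
  show ?thesis by (rule that[of "\<lambda>_ _. 1"]) (auto simp: True)
next
  case False
  define u where "u k y = min 1 (real k * infdist y (- U))" for k y
  have clo: "closed (- U)" "- U \<noteq> {}" using assms False by auto
  have out: "u k y = 0" if "y \<notin> U" for k y
    using that by (simp add: u_def)
  show ?thesis
  proof (rule that[of u])
    show "continuous_on UNIV (u k)" for k
      unfolding u_def by (intro continuous_intros)
    show "0 \<le> u k y" for k y by (simp add: u_def infdist_nonneg)
    show "u k y \<le> indicator U y" for k y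
      by (cases "y \<in> U") (simp_all add: out, simp add: u_def)
    show "u k y \<le> u l y" if "k \<le> l" for k l y
    proof -
      have "real k * infdist y (- U) \<le> real l * infdist y (- U)"
        using that by (intro mult_right_mono) (auto simp: infdist_nonneg)
      thus ?thesis by (simp add: u_def min_def)
    qed
    show "(\<lambda>k. u k y) \<longlonglongrightarrow> indicator U y" for y
    proof (cases "y \<in> U")
      case True
      hence pos: "0 < infdist y (- U)"
        using infdist_pos_not_in_closed[OF clo, of y] by simp
      obtain N :: nat where N: "1 < real N * infdist y (- U)"
        using pos by (metis reals_Archimedean3)
      have "u k y = 1" if "k \<ge> N" for k
      proof -
        have "real N * infdist y (- U) \<le> real k * infdist y (- U)"
          using that pos by (intro mult_right_mono) auto
        thus ?thesis using N by (simp add: u_def)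
      qed
      thus ?thesis using True by (intro tendsto_eventually eventually_sequentiallyI[of N]) simp
    qed (simp add: out)
  qed
qed

lemma integral_open_approx:
  fixes \<nu> :: "'a::metric_space measure"
  assumes "finite_measure \<nu>" "sets \<nu> = sets borel" "open U"
    and u: "\<And>k. continuous_on UNIV (u k)" "\<And>k y. 0 \<le> u k y" "\<And>k y. u k y \<le> indicator U y"
    "\<And>y. (\<lambda>k. u k y) \<longlonglongrightarrow> indicator U y"
  shows "(\<lambda>k. \<integral>y. u k y \<partial>\<nu>) \<longlonglongrightarrow> measure \<nu> U"
proof -
  interpret finite_measure \<nu> by fact
  have [measurable]: "U \<in> sets \<nu>" using assms by simp
  have m: "u k \<in> borel_measurable \<nu>" for k
    using borel_measurable_continuous_onI[OF u(1)[of k]] measurable_cong_sets[OF assms(2) refl] by blast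
  have "(\<lambda>k. \<integral>y. u k y \<partial>\<nu>) \<longlonglongrightarrow> (\<integral>y. indicator U y \<partial>\<nu>)"
  proof (rule integral_dominated_convergence[where w="\<lambda>_. 1"])
    show "AE y in \<nu>. norm (u k y) \<le> 1" for k
      using u(2)[of k] order_trans[OF u(3)[of k] indicator_le_1] by (intro AE_I2) simp
  qed (use u m in auto)
  thus ?thesis by simp
qed

text \<open>Integrals of continuous functions determine the measure of each open set by monotone
  approximation, and the open sets are an intersection-stable generator.\<close>

lemma measure_eqI_continuous:
  fixes \<mu> \<nu> :: "'a::metric_space measure"
  assumes fin: "finite_measure \<mu>" "finite_measure \<nu>"
    and sets: "sets \<mu> = sets borel" "sets \<nu> = sets borel"
    and eq: "\<And>g :: 'a \<Rightarrow> real. continuous_on UNIV g \<Longrightarrow> (\<integral>y. g y \<partial>\<mu>) = (\<integral>y. g y \<partial>\<nu>)"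
  shows "\<mu> = \<nu>"
proof (rule measure_eqI_generator_eq[where E="{U. open U}" and \<Omega>=UNIV and A="\<lambda>_. UNIV"])
  interpret \<mu>: finite_measure \<mu> by fact
  interpret \<nu>: finite_measure \<nu> by fact
  fix U :: "'a set" assume "U \<in> {U. open U}"
  hence U: "open U" by simp
  obtain u :: "nat \<Rightarrow> 'a \<Rightarrow> real" where u:
    "\<And>k. continuous_on UNIV (u k)" "\<And>k y. 0 \<le> u k y" "\<And>k y. u k y \<le> indicator U y"
    "\<And>y. (\<lambda>k. u k y) \<longlonglongrightarrow> indicator U y"
    using open_approx[OF U] by metis
  have "(\<lambda>k. \<integral>y. u k y \<partial>\<mu>) \<longlonglongrightarrow> measure \<mu> U" "(\<lambda>k. \<integral>y. u k y \<partial>\<nu>) \<longlonglongrightarrow> measure \<nu> U"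
    by (intro integral_open_approx fin sets U u)+
  hence "measure \<mu> U = measure \<nu> U"
    unfolding eq[OF u(1)] by (rule LIMSEQ_unique)
  thus "emeasure \<mu> U = emeasure \<nu> U"
    by (simp add: \<mu>.emeasure_eq_measure \<nu>.emeasure_eq_measure)
next
  show "emeasure \<mu> UNIV \<noteq> \<infinity>"
    using finite_measure.emeasure_finite[OF fin(1)] by simp
qed (auto simp: sets borel_def Int_stable_def sets_measure_of)

text \<open>The sets that lie between a closed and an open set of nearly equal measure form a
  sigma-algebra containing the open sets. The outer open set is carried along because
  complementation exchanges the two sides.\<close>

lemma closed_inner_regular:
  fixes \<nu> :: "'a::metric_space measure"
  assumes "finite_measure \<nu>" "sets \<nu> = sets borel" "A \<in> sets borel" "e > 0"
  obtains F where "closed F" "F \<subseteq> A" "measure \<nu> (A - F) < e"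
proof -
  interpret finite_measure \<nu> by fact
  have sp: "space \<nu> = UNIV" using sets_eq_imp_space_eq[OF assms(2)] by simp
  have closed_sets: "closed F \<Longrightarrow> F \<in> sets \<nu>" and open_sets: "open U \<Longrightarrow> U \<in> sets \<nu>" for F U
    using assms(2) by auto
  define reg where "reg A \<longleftrightarrow> A \<in> sets \<nu> \<and>
    (\<forall>e>0. \<exists>F U. closed F \<and> open U \<and> F \<subseteq> A \<and> A \<subseteq> U \<and> measure \<nu> (U - F) < e)" for A
  have regD: "\<exists>F U. closed F \<and> open U \<and> F \<subseteq> A \<and> A \<subseteq> U \<and> measure \<nu> (U - F) < e"
    if "reg A" "e > 0" for A e
    using that unfolding reg_def by (elim conjE allE[of _ e]) simp
  have regS: "A \<in> sets \<nu>" if "reg A" for A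
    using that unfolding reg_def by (rule conjunct1)
  have "A \<in> sigma_sets UNIV {U. open U}"
    using assms(3) by (simp add: borel_def)
  hence "reg A"
  proof induction
    case (Basic U)
    hence U: "open U" by simp
    have "\<exists>F V. closed F \<and> open V \<and> F \<subseteq> U \<and> U \<subseteq> V \<and> measure \<nu> (V - F) < e" if e: "e > 0" for e
    proof -
      obtain u :: "nat \<Rightarrow> 'a \<Rightarrow> real" where u:
        "\<And>k. continuous_on UNIV (u k)" "\<And>k y. 0 \<le> u k y" "\<And>k y. u k y \<le> indicator U y"
        "\<And>y. (\<lambda>k. u k y) \<longlonglongrightarrow> indicator U y" "\<And>k l y. k \<le> l \<Longrightarrow> u k y \<le> u l y"
        using open_approx[OF U] by metis
      define F where "F k = {y. u k y \<ge> 1 / 2}" for k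
      have cF: "closed (F k)" for k
        unfolding F_def using u(1) by (intro closed_Collect_le) auto
      have FU: "F k \<subseteq> U" for k
      proof
        fix y assume "y \<in> F k"
        hence "indicator U y \<ge> (1 / 2 :: real)" using u(3)[of k y] by (simp add: F_def)
        thus "y \<in> U" by (cases "y \<in> U") auto
      qed
      have "incseq F"
        unfolding F_def incseq_def using u(5) by (auto intro: order_trans)
      hence "(\<lambda>k. measure \<nu> (F k)) \<longlonglongrightarrow> measure \<nu> (\<Union>k. F k)"
        using cF closed_sets by (intro finite_Lim_measure_incseq) auto
      moreover have "(\<Union>k. F k) = U"
      proof
        show "U \<subseteq> (\<Union>k. F k)"
        proof
          fix y assume "y \<in> U"
          hence "(\<lambda>k. u k y) \<longlonglongrightarrow> 1" using u(4)[of y] by simp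
          hence "eventually (\<lambda>k. u k y > 1 / 2) sequentially" by (rule order_tendstoD) simp
          then obtain k where "u k y > 1 / 2" by (auto simp: eventually_sequentially)
          thus "y \<in> (\<Union>k. F k)" by (auto simp: F_def intro: less_imp_le)
        qed
      qed (use FU in auto)
      ultimately have "eventually (\<lambda>k. measure \<nu> (F k) > measure \<nu> U - e) sequentially"
        using e by (intro order_tendstoD) auto
      then obtain k where "measure \<nu> (F k) > measure \<nu> U - e" by (auto simp: eventually_sequentially)
      hence "measure \<nu> (U - F k) < e"
        using finite_measure_Diff[of U "F k"] U cF FU closed_sets open_sets by simp
      thus ?thesis using cF FU U by blast
    qed
    thus ?case unfolding reg_def using open_sets[OF U] by (intro conjI allI impI)
  next
    case Empty
    have "\<forall>e>0. \<exists>F U :: 'a set. closed F \<and> open U \<and> F \<subseteq> {} \<and> {} \<subseteq> U \<and> measure \<nu> (U - F) < e"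
      by (intro allI impI exI[of _ "{}"] conjI) auto
    thus ?case unfolding reg_def by (intro conjI sets.empty_sets)
  next
    case (Compl A)
    have "\<exists>F U. closed F \<and> open U \<and> F \<subseteq> - A \<and> - A \<subseteq> U \<and> measure \<nu> (U - F) < e" if e: "e > 0" for e
    proof -
      obtain F U where FU: "closed F" "open U" "F \<subseteq> A" "A \<subseteq> U" "measure \<nu> (U - F) < e"
        using regD[OF Compl.IH(1) e] by blast
      moreover have "- F - - U = U - F" by auto
      ultimately show ?thesis
        by (intro exI[of _ "- U"] exI[of _ "- F"]) (auto simp: closed_Compl open_Compl)
    qed
    moreover have "UNIV - A \<in> sets \<nu>"
      using regS[OF Compl.IH(1)] sets.compl_sets[of A \<nu>] by (simp add: sp)
    ultimately show ?case unfolding reg_def Compl_eq_Diff_UNIV by (intro conjI allI impI)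
  next
    case (Union A)
    have A: "A i \<in> sets \<nu>" for i using Union.IH by (rule regS)
    have "\<exists>F U. closed F \<and> open U \<and> F \<subseteq> (\<Union>i. A i) \<and> (\<Union>i. A i) \<subseteq> U \<and> measure \<nu> (U - F) < e"
      if e: "e > 0" for e
    proof -
      \<comment> \<open>These allowances sum to \<open>e / 2\<close>. The other half pays for
        truncating the union of the \<open>F i\<close> to finitely many, since a countable union of
        closed sets need not be closed.\<close>
      have "\<exists>F U. closed F \<and> open U \<and> F \<subseteq> A i \<and> A i \<subseteq> U \<and> measure \<nu> (U - F) < e / 4 * (1/2) ^ i" for i
        using e by (intro regD[OF Union.IH]) simp
      then obtain F U where FU: "\<And>i. closed (F i)" "\<And>i. open (U i)" "\<And>i. F i \<subseteq> A i" "\<And>i. A i \<subseteq> U i"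
        "\<And>i. measure \<nu> (U i - F i) < e / 4 * (1/2) ^ i"
        by metis
      have meas [measurable]: "F i \<in> sets \<nu>" "U i \<in> sets \<nu>" for i
        using FU closed_sets open_sets by auto
      have "(\<lambda>n. measure \<nu> (\<Union>i\<le>n. F i)) \<longlonglongrightarrow> measure \<nu> (\<Union>n. \<Union>i\<le>n. F i)"
        by (intro finite_Lim_measure_incseq) (force simp: incseq_def)+
      moreover have "(\<Union>n. \<Union>i\<le>n. F i) = (\<Union>i. F i)" by auto
      ultimately have "eventually (\<lambda>n. measure \<nu> (\<Union>i\<le>n. F i) > measure \<nu> (\<Union>i. F i) - e / 2) sequentially"
        using e by (intro order_tendstoD) auto
      then obtain n where n: "measure \<nu> (\<Union>i\<le>n. F i) > measure \<nu> (\<Union>i. F i) - e / 2"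
        by (auto simp: eventually_sequentially)
      have sm: "summable (\<lambda>i. e / 4 * (1/2) ^ i)"
        by (intro summable_mult summable_geometric) simp
      have sm': "summable (\<lambda>i. measure \<nu> (U i - F i))"
      proof (rule summable_comparison_test'[OF sm, of 0])
        fix i show "norm (measure \<nu> (U i - F i)) \<le> e / 4 * (1/2) ^ i"
          using FU(5)[of i] by simp
      qed
      have "measure \<nu> ((\<Union>i. U i) - (\<Union>i. F i)) \<le> measure \<nu> (\<Union>i. U i - F i)"
        by (intro finite_measure_mono) (blast, measurable)
      also have "\<dots> \<le> (\<Sum>i. measure \<nu> (U i - F i))"
        by (intro finite_measure_subadditive_countably sm') auto
      also have "\<dots> \<le> (\<Sum>i. e / 4 * (1/2) ^ i)"
        by (intro suminf_le sm sm' less_imp_le[OF FU(5)])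
      also have "\<dots> = e / 2"
        by (subst suminf_mult) (auto simp: suminf_geometric)
      finally have 1: "measure \<nu> ((\<Union>i. U i) - (\<Union>i. F i)) \<le> e / 2" .
      have "measure \<nu> ((\<Union>i. U i) - (\<Union>i\<le>n. F i)) = measure \<nu> (\<Union>i. U i) - measure \<nu> (\<Union>i\<le>n. F i)"
        using FU(3,4) by (intro finite_measure_Diff) fastforce+
      moreover have "measure \<nu> ((\<Union>i. U i) - (\<Union>i. F i)) = measure \<nu> (\<Union>i. U i) - measure \<nu> (\<Union>i. F i)"
        using FU(3,4) by (intro finite_measure_Diff) fastforce+
      ultimately have "measure \<nu> ((\<Union>i. U i) - (\<Union>i\<le>n. F i)) < e"
        using 1 n by linarith
      moreover have "closed (\<Union>i\<le>n. F i)" using FU(1) by (intro closed_UN) auto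
      moreover have "open (\<Union>i. U i)" using FU(2) by auto
      moreover have "(\<Union>i\<le>n. F i) \<subseteq> (\<Union>i. A i)" "(\<Union>i. A i) \<subseteq> (\<Union>i. U i)" using FU(3,4) by blast+
      ultimately show ?thesis by blast
    qed
    moreover have "(\<Union>i. A i) \<in> sets \<nu>" using A by blast
    ultimately show ?case unfolding reg_def by (intro conjI allI impI)
  qed
  obtain F U where FU: "closed F" "open U" "F \<subseteq> A" "A \<subseteq> U" "measure \<nu> (U - F) < e"
    using regD[OF \<open>reg A\<close> \<open>e > 0\<close>] by blast
  moreover have "measure \<nu> (A - F) \<le> measure \<nu> (U - F)"
    using FU closed_sets open_sets by (intro finite_measure_mono) auto
  ultimately show ?thesis using that[of F] by simp
qed

lemma integrable_continuous_compact:
  fixes g :: "'a::metric_space \<Rightarrow> real"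
  assumes "compact (UNIV :: 'a set)" "finite_measure \<nu>" "sets \<nu> = sets borel" "continuous_on UNIV g"
  shows "integrable \<nu> g"
proof -
  interpret finite_measure \<nu> by fact
  obtain B where "\<And>y. norm (g y) \<le> B"
    using compact_imp_bounded[OF compact_continuous_image[OF assms(4,1)]] by (auto simp: bounded_iff)
  moreover have "g \<in> borel_measurable \<nu>"
    using borel_measurable_continuous_onI[OF assms(4)] measurable_cong_sets[OF assms(3) refl] by blast
  ultimately show ?thesis
    by (intro integrable_const_bound[of g B]) auto
qed

section \<open>Riesz representation and weak-* compactness\<close>

locale positive_functional =
  fixes \<Lambda> :: "('a::metric_space \<Rightarrow> real) \<Rightarrow> real"
  assumes compact_UNIV: "compact (UNIV :: 'a set)"
    and add: "continuous_on UNIV g \<Longrightarrow> continuous_on UNIV h \<Longrightarrow> \<Lambda> (\<lambda>y. g y + h y) = \<Lambda> g + \<Lambda> h"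
    and scale: "continuous_on UNIV g \<Longrightarrow> \<Lambda> (\<lambda>y. c * g y) = c * \<Lambda> g"
    and mono: "continuous_on UNIV g \<Longrightarrow> continuous_on UNIV h \<Longrightarrow> (\<And>y. g y \<le> h y) \<Longrightarrow> \<Lambda> g \<le> \<Lambda> h"
    and one: "\<Lambda> (\<lambda>_. 1) = 1"
begin

lemma const: "\<Lambda> (\<lambda>_. c) = c"
  using scale[of "\<lambda>_. 1" c] one by simp

lemma sum: "(\<And>i. i \<in> I \<Longrightarrow> continuous_on UNIV (g i)) \<Longrightarrow> \<Lambda> (\<lambda>y. \<Sum>i\<in>I. g i y) = (\<Sum>i\<in>I. \<Lambda> (g i))"
proof (induction I rule: infinite_finite_induct)
  case (insert i I)
  have "\<Lambda> (\<lambda>y. g i y + (\<Sum>i\<in>I. g i y)) = \<Lambda> (g i) + \<Lambda> (\<lambda>y. \<Sum>i\<in>I. g i y)"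
    using insert by (intro add continuous_on_sum) auto
  thus ?case using insert by simp
qed (simp_all add: const)

section \<open>Content of open sets and the outer measure it induces\<close>

definition below :: "'a set \<Rightarrow> ('a \<Rightarrow> real) set" where
  "below U = {g. continuous_on UNIV g \<and> (\<forall>y. 0 \<le> g y \<and> g y \<le> indicator U y)}"

text \<open>For open \<open>U\<close> this is the only value a representing measure can take, as its
  indicator is an increasing limit of functions in \<open>below U\<close>.\<close>

definition content :: "'a set \<Rightarrow> real" where
  "content U = (SUP g\<in>below U. \<Lambda> g)"

definition outer :: "'a set \<Rightarrow> real" where
  "outer A = (INF U\<in>{U. open U \<and> A \<subseteq> U}. content U)"

lemma below_bounds: "g \<in> below U \<Longrightarrow> 0 \<le> \<Lambda> g \<and> \<Lambda> g \<le> 1"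
  using mono[of "\<lambda>_. 0" g] mono[of g "\<lambda>_. 1"] order_trans[OF _ indicator_le_1]
  by (force simp: below_def const)

lemma below_ge_content: "g \<in> below U \<Longrightarrow> \<Lambda> g \<le> content U"
  unfolding content_def by (rule cSUP_upper) (auto intro!: bdd_aboveI[of _ 1] dest: below_bounds)

lemma zero_below: "(\<lambda>_. 0) \<in> below U"
  by (simp add: below_def)

lemma content_nonneg: "0 \<le> content U"
  using below_ge_content[OF zero_below] by (simp add: const)

lemma content_le: "(\<And>g. g \<in> below U \<Longrightarrow> \<Lambda> g \<le> b) \<Longrightarrow> content U \<le> b"
  unfolding content_def using zero_below by (intro cSUP_least) auto

lemma content_mono: "U \<subseteq> V \<Longrightarrow> content U \<le> content V"
proof (rule content_le)
  fix g assume UV: "U \<subseteq> V" "g \<in> below U"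
  have "indicator U y \<le> (indicator V y :: real)" for y
    using UV(1) by (auto simp: indicator_def)
  hence "g \<in> below V"
    using UV(2) order_trans by (auto simp: below_def) blast
  thus "\<Lambda> g \<le> content V" by (rule below_ge_content)
qed

lemma content_approx:
  assumes "e > 0" obtains g where "g \<in> below U" "content U - e < \<Lambda> g"
proof -
  have "\<exists>g\<in>below U. content U - e < \<Lambda> g"
    using assms zero_below unfolding content_def
    by (subst less_cSUP_iff[symmetric]) (auto intro!: bdd_aboveI[of _ 1] dest: below_bounds)
  thus ?thesis using that by blast
qed

lemma outer_le: "open U \<Longrightarrow> A \<subseteq> U \<Longrightarrow> outer A \<le> content U"
  unfolding outer_def by (rule cINF_lower) (auto intro!: bdd_belowI[of _ 0] content_nonneg)

lemma outer_ge: "(\<And>U. open U \<Longrightarrow> A \<subseteq> U \<Longrightarrow> b \<le> content U) \<Longrightarrow> b \<le> outer A"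
  unfolding outer_def by (rule cINF_greatest) auto

lemma outer_nonneg: "0 \<le> outer A"
  by (rule outer_ge) (rule content_nonneg)

lemma outer_open: "open U \<Longrightarrow> outer U = content U"
  by (intro antisym outer_le outer_ge content_mono) auto

lemma outer_mono: "A \<subseteq> B \<Longrightarrow> outer A \<le> outer B"
  by (rule outer_ge, rule outer_le) auto

lemma outer_approx:
  assumes "e > 0" obtains U where "open U" "A \<subseteq> U" "content U < outer A + e"
proof (rule ccontr)
  assume "\<not> thesis"
  hence "outer A + e \<le> outer A"
    using that by (intro outer_ge) (meson not_le)
  thus False using assms by simp
qed

text \<open>The sets where \<open>g\<close> is smaller than \<open>e\<close> plus a finite sum of functions below the \<open>U i\<close>
  increase to the whole space, so by compactness one of them is the whole space.\<close>

lemma content_UN_le: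
  assumes U: "\<And>i::nat. open (U i)" and g: "g \<in> below (\<Union>i. U i)" and e: "e > 0"
  shows "\<exists>k. \<Lambda> g \<le> (\<Sum>i<k. content (U i)) + e"
proof -
  have "\<exists>u :: nat \<Rightarrow> 'a \<Rightarrow> real. (\<forall>k. continuous_on UNIV (u k)) \<and> (\<forall>k y. 0 \<le> u k y) \<and>
     (\<forall>k y. u k y \<le> indicator (U i) y) \<and> (\<forall>k l y. k \<le> l \<longrightarrow> u k y \<le> u l y) \<and>
     (\<forall>y. (\<lambda>k. u k y) \<longlonglongrightarrow> indicator (U i) y)" for i
    using open_approx[OF U[of i]] by metis
  then obtain u :: "nat \<Rightarrow> nat \<Rightarrow> 'a \<Rightarrow> real" where u: "\<And>i k. continuous_on UNIV (u i k)"
    "\<And>i k y. 0 \<le> u i k y" "\<And>i k y. u i k y \<le> indicator (U i) y"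
    "\<And>i k l y. k \<le> l \<Longrightarrow> u i k y \<le> u i l y" "\<And>i y. (\<lambda>k. u i k y) \<longlonglongrightarrow> indicator (U i) y"
    by metis
  define s where "s k y = (\<Sum>i<k. u i k y)" for k y
  have s_cont: "continuous_on UNIV (s k)" for k
    unfolding s_def by (intro continuous_on_sum u)
  have s_mono: "s k y \<le> s l y" if "k \<le> l" for k l y
  proof -
    have "s k y \<le> (\<Sum>i<k. u i l y)"
      unfolding s_def by (intro sum_mono u that)
    also have "\<dots> \<le> s l y"
      unfolding s_def using that u(2) by (intro sum_mono2) auto
    finally show ?thesis .
  qed
  have g_cont: "continuous_on UNIV g" and g_le: "\<And>y. g y \<le> indicator (\<Union>i. U i) y"
    using g by (auto simp: below_def)
  define O' where "O' k = {y. g y < s k y + e}" for k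
  have op: "open (O' k)" for k
    unfolding O'_def by (intro open_Collect_less continuous_intros g_cont s_cont)
  have cover: "UNIV \<subseteq> (\<Union>k\<in>UNIV. O' k)"
  proof
    fix y
    show "y \<in> (\<Union>k\<in>UNIV. O' k)"
    proof (cases "y \<in> (\<Union>i. U i)")
      case False
      hence "g y \<le> 0" using g_le[of y] by simp
      hence "y \<in> O' 0" using e by (simp add: O'_def s_def)
      thus ?thesis by blast
    next
      case True
      then obtain i where i: "y \<in> U i" by auto
      have "(\<lambda>k. u i k y) \<longlonglongrightarrow> 1" using u(5)[of i y] i by simp
      hence "eventually (\<lambda>k. u i k y > 1 - e) sequentially"
        using e by (intro order_tendstoD) auto
      then obtain N where N: "\<And>k. k \<ge> N \<Longrightarrow> u i k y > 1 - e" by (auto simp: eventually_sequentially)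
      define k where "k = max N (Suc i)"
      have "u i k y \<le> s k y"
        unfolding s_def
        by (rule member_le_sum[of i "{..<k}" "\<lambda>i. u i k y"]) (simp_all add: k_def u(2))
      moreover have "g y \<le> 1" by (rule order_trans[OF g_le indicator_le_1])
      moreover have "u i k y > 1 - e" by (rule N) (simp add: k_def)
      ultimately have "y \<in> O' k" by (simp add: O'_def)
      thus ?thesis by blast
    qed
  qed
  obtain T where T: "finite T" "UNIV \<subseteq> (\<Union>k\<in>T. O' k)"
    by (rule compactE_image[OF compact_UNIV _ cover]) (use op in auto)
  obtain k where k: "\<And>l. l \<in> T \<Longrightarrow> l \<le> k"
    using finite_nat_set_iff_bounded_le T(1) by metis
  have "g y \<le> s k y + e" for y
  proof -
    obtain l where "l \<in> T" "y \<in> O' l" using T by blast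
    thus ?thesis using s_mono[OF k, of l y] by (simp add: O'_def)
  qed
  hence "\<Lambda> g \<le> \<Lambda> (\<lambda>y. s k y + e)"
    by (intro mono g_cont continuous_intros s_cont)
  also have "\<dots> = (\<Sum>i<k. \<Lambda> (u i k)) + e"
  proof -
    have "s k = (\<lambda>y. \<Sum>i<k. u i k y)" by (rule ext) (simp add: s_def)
    hence "\<Lambda> (s k) = (\<Sum>i<k. \<Lambda> (u i k))" using sum[of "{..<k}" "\<lambda>i. u i k"] u(1) by simp
    thus ?thesis using add[OF s_cont[of k], of "\<lambda>_. e"] by (simp add: const)
  qed
  also have "(\<Sum>i<k. \<Lambda> (u i k)) \<le> (\<Sum>i<k. content (U i))"
    using u by (intro sum_mono below_ge_content) (auto simp: below_def)
  finally show ?thesis by auto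
qed

text \<open>Extended nonnegative reals are used because the series on the right may diverge; if it
  converges, the finite estimate with error \<open>e\<close> gives the claim as \<open>e\<close>
  tends to 0.\<close>

lemma content_UN:
  assumes U: "\<And>i::nat. open (U i)"
  shows "ennreal (content (\<Union>i. U i)) \<le> (\<Sum>i. ennreal (content (U i)))"
proof (rule ennreal_le_epsilon)
  fix e :: real assume fin: "(\<Sum>i. ennreal (content (U i))) < top" and e: "0 < e"
  obtain c where c: "c \<ge> 0" "(\<Sum>i. ennreal (content (U i))) = ennreal c"
    using fin by (cases "\<Sum>i. ennreal (content (U i))") auto
  have "content (\<Union>i. U i) \<le> c + e"
  proof (rule content_le)
    fix g assume "g \<in> below (\<Union>i. U i)"
    then obtain k where k: "\<Lambda> g \<le> (\<Sum>i<k. content (U i)) + e"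
      using content_UN_le[of U g e] U e by blast
    have "ennreal (\<Sum>i<k. content (U i)) \<le> ennreal c"
      using sum_le_suminf[of "\<lambda>i. ennreal (content (U i))" "{..<k}"] content_nonneg c
      by (simp add: sum_ennreal)
    thus "\<Lambda> g \<le> c + e" using k c by simp
  qed
  thus "ennreal (content (\<Union>i. U i)) \<le> (\<Sum>i. ennreal (content (U i))) + ennreal e"
    using c e by (simp flip: ennreal_plus)
qed

lemma outer_measure_space_outer: "outer_measure_space UNIV (\<lambda>A. ennreal (outer A))"
proof -
  have "content {} \<le> 0"
  proof (rule content_le)
    fix g :: "'a \<Rightarrow> real" assume "g \<in> below {}"
    hence "g = (\<lambda>_. 0)" by (auto simp: below_def intro!: ext antisym)
    thus "\<Lambda> g \<le> 0" by (simp add: const)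
  qed
  hence "outer {} = 0"
    using content_nonneg[of "{}"] by (simp add: outer_open)
  hence 1: "positive UNIV (\<lambda>A. ennreal (outer A))"
    by (simp add: positive_def)
  have 2: "increasing UNIV (\<lambda>A. ennreal (outer A))"
    by (auto simp: increasing_def intro!: ennreal_leI outer_mono)
  have 3: "ennreal (outer (\<Union>i. A i)) \<le> (\<Sum>i. ennreal (outer (A i)))" for A :: "nat \<Rightarrow> 'a set"
  proof (rule ennreal_le_epsilon)
    fix e :: real assume e: "0 < e"
    have "\<exists>U. open U \<and> A i \<subseteq> U \<and> content U < outer (A i) + e * (1/2) ^ Suc i" for i
      using outer_approx[of "e * (1/2) ^ Suc i" "A i"] e by (metis half_gt_zero mult_pos_pos zero_less_one zero_less_power)
    then obtain U where U: "\<And>i. open (U i)" "\<And>i. A i \<subseteq> U i"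
      "\<And>i. content (U i) < outer (A i) + e * (1/2) ^ Suc i"
      by metis
    have "ennreal (outer (\<Union>i. A i)) \<le> ennreal (content (\<Union>i. U i))"
      using U(1,2) by (intro ennreal_leI outer_le) (blast intro: open_UN)+
    also have "\<dots> \<le> (\<Sum>i. ennreal (content (U i)))"
      by (rule content_UN[OF U(1)])
    also have "\<dots> \<le> (\<Sum>i. ennreal (outer (A i)) + ennreal (e * (1/2) ^ Suc i))"
    proof (intro suminf_le summableI)
      fix i
      have "content (U i) \<le> outer (A i) + e * (1/2) ^ Suc i" using U(3)[of i] by simp
      thus "ennreal (content (U i)) \<le> ennreal (outer (A i)) + ennreal (e * (1/2) ^ Suc i)"
        using e outer_nonneg[of "A i"] by (subst ennreal_plus[symmetric]) (auto simp del: ennreal_plus intro: ennreal_leI)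
    qed
    also have "\<dots> = (\<Sum>i. ennreal (outer (A i))) + (\<Sum>i. ennreal (e * (1/2) ^ Suc i))"
      by (rule suminf_add[symmetric]) (rule summableI)+
    also have "(\<Sum>i. ennreal (e * (1/2) ^ Suc i)) = ennreal e"
    proof -
      have "(\<lambda>i. e * (1/2) ^ Suc i) sums (e * 1)"
        by (intro sums_mult power_half_series)
      thus ?thesis using e by (intro suminf_ennreal_eq) auto
    qed
    finally show "ennreal (outer (\<Union>i. A i)) \<le> (\<Sum>i. ennreal (outer (A i))) + ennreal e" .
  qed
  show ?thesis
    using 1 2 3 by (simp add: outer_measure_space_def countably_subadditive_def)
qed

text \<open>Caratheodory's condition for an open \<open>U\<close>, checked against open
  \<open>V\<close> containing \<open>A\<close>. A function \<open>g\<close> nearly exhausting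
  \<open>V \<inter> U\<close> is lowered by \<open>e / 3\<close> and then vanishes on
  \<open>W\<close>, an open neighbourhood of \<open>V - U\<close>. A function below \<open>W\<close>
  can therefore be added without leaving \<open>below V\<close>. The two approximations and the
  lowering cost \<open>e / 3\<close> each.\<close>

lemma outer_split:
  assumes U: "open U"
  shows "outer (A \<inter> U) + outer (A - U) \<le> outer A"
proof (rule outer_ge)
  fix V assume V: "open V" "A \<subseteq> V"
  have "outer (A \<inter> U) + outer (A - U) \<le> content (V \<inter> U) + outer (V - U)"
    using V U by (intro add_mono outer_le outer_mono) auto
  also have "\<dots> \<le> content V"
  proof (rule field_le_epsilon)
    fix e :: real assume "e > 0"
    hence e: "e / 3 > 0" by simp
    obtain g where g: "g \<in> below (V \<inter> U)" "content (V \<inter> U) - e / 3 < \<Lambda> g"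
      using content_approx[OF e] by metis
    have g_cont: "continuous_on UNIV g" using g by (simp add: below_def)
    define W where "W = V \<inter> {y. g y < e / 3}"
    have W: "open W"
      unfolding W_def using V by (intro open_Int open_Collect_less continuous_intros g_cont) auto
    have "V - U \<subseteq> W"
    proof
      fix y assume "y \<in> V - U"
      moreover have "g y \<le> indicator (V \<inter> U) y" using g by (simp add: below_def)
      ultimately show "y \<in> W" using e by (simp add: W_def)
    qed
    obtain h where h: "h \<in> below W" "content W - e / 3 < \<Lambda> h"
      using content_approx[OF e] by metis
    have h_cont: "continuous_on UNIV h" using h by (simp add: below_def)
    define g' where "g' y = max 0 (g y - e / 3)" for y
    have g'_cont: "continuous_on UNIV g'"
      unfolding g'_def by (intro continuous_intros g_cont)
    have "(\<lambda>y. g' y + h y) \<in> below V"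
    proof -
      have "0 \<le> g' y + h y \<and> g' y + h y \<le> indicator V y" for y
      proof -
        have b: "0 \<le> g y" "g y \<le> indicator (V \<inter> U) y" "0 \<le> h y" "h y \<le> indicator W y"
          using g h by (auto simp: below_def)
        show ?thesis
        proof (cases "y \<in> W")
          case True
          hence "g' y = 0" by (simp add: g'_def W_def)
          thus ?thesis using b True by (simp add: W_def)
        next
          case False
          hence "h y = 0" using b by simp
          moreover have "g y \<le> indicator V y"
            using b(2) by (rule order_trans) (auto simp: indicator_def)
          ultimately show ?thesis using b e by (auto simp: g'_def)
        qed
      qed
      thus ?thesis using g'_cont h_cont by (simp add: below_def continuous_on_add)
    qed
    hence "\<Lambda> g' + \<Lambda> h \<le> content V"
      using below_ge_content add[OF g'_cont h_cont] by metis
    moreover have "\<Lambda> g \<le> \<Lambda> g' + e / 3"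
    proof -
      have "\<Lambda> g \<le> \<Lambda> (\<lambda>y. g' y + e / 3)"
        by (intro mono g_cont continuous_intros g'_cont) (simp add: g'_def)
      thus ?thesis using add[OF g'_cont, of "\<lambda>_. e / 3"] by (simp add: const)
    qed
    moreover have "outer (V - U) \<le> content W"
      by (rule outer_le) fact+
    ultimately show "content (V \<inter> U) + outer (V - U) \<le> content V + e"
      using g h by linarith
  qed
  finally show "outer (A \<inter> U) + outer (A - U) \<le> content V" .
qed

definition rep :: "'a measure" where
  "rep = measure_of UNIV (sets borel) (\<lambda>A. ennreal (outer A))"

text \<open>The Caratheodory-measurable sets (\<open>lambda_system\<close>) form a sigma-algebra on
  which \<open>outer\<close> is a measure. By \<open>outer_split\<close> it contains the open sets,
  hence all Borel sets.\<close>

lemma emeasure_rep: "A \<in> sets borel \<Longrightarrow> emeasure rep A = ennreal (outer A)"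
  and sets_rep: "sets rep = sets borel"
  and space_rep: "space rep = UNIV"
proof -
  let ?L = "lambda_system UNIV UNIV (\<lambda>A. ennreal (outer A))"
  have ms: "measure_space UNIV ?L (\<lambda>A. ennreal (outer A))"
    using sigma_algebra.caratheodory_lemma[OF sigma_algebra_Pow, of UNIV "\<lambda>A. ennreal (outer A)"]
      outer_measure_space_outer by simp
  hence L: "sigma_algebra UNIV ?L" by (simp add: measure_space_def)
  have "{U. open U} \<subseteq> ?L"
  proof
    fix U :: "'a set" assume "U \<in> {U. open U}"
    hence U: "open U" by simp
    have "outer (U \<inter> A) + outer ((UNIV - U) \<inter> A) = outer A" for A
    proof (rule antisym)
      have "U \<inter> A = A \<inter> U" "(UNIV - U) \<inter> A = A - U" by auto
      thus "outer (U \<inter> A) + outer ((UNIV - U) \<inter> A) \<le> outer A"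
        using outer_split[OF U, of A] by simp
      have sub: "subadditive UNIV (\<lambda>A. ennreal (outer A))"
        using ring_of_sets.countably_subadditive_subadditive[of UNIV UNIV "\<lambda>A. ennreal (outer A)"]
          outer_measure_space_outer sigma_algebra_Pow[of "UNIV :: 'a set"]
        by (simp add: outer_measure_space_def sigma_algebra_def algebra_def)
      have "ennreal (outer ((U \<inter> A) \<union> ((UNIV - U) \<inter> A)))
          \<le> ennreal (outer (U \<inter> A)) + ennreal (outer ((UNIV - U) \<inter> A))"
        by (rule subadditiveD[OF sub]) auto
      moreover have "(U \<inter> A) \<union> ((UNIV - U) \<inter> A) = A" by auto
      ultimately show "outer A \<le> outer (U \<inter> A) + outer ((UNIV - U) \<inter> A)"
        using outer_nonneg by (simp flip: ennreal_plus)
    qed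
    thus "U \<in> ?L"
      using outer_nonneg by (simp add: lambda_system_def flip: ennreal_plus)
  qed
  hence sub: "sets (borel :: 'a measure) \<subseteq> ?L"
    using sigma_algebra.sigma_sets_subset[OF L, of "{U. open U}"] by (simp add: borel_def)
  have sa: "sigma_algebra UNIV (sets (borel :: 'a measure))"
    using sets.sigma_algebra_axioms[of "borel :: 'a measure"] by simp
  have ms': "measure_space UNIV (sets (borel :: 'a measure)) (\<lambda>A. ennreal (outer A))"
    by (rule measure_down[OF ms sa sub])
  show "sets rep = sets borel" "space rep = UNIV"
    unfolding rep_def using sigma_algebra.sets_measure_of_eq[OF sa] by (auto simp: space_measure_of_conv)
  show "emeasure rep A = ennreal (outer A)" if "A \<in> sets borel"
    unfolding rep_def by (rule emeasure_measure_of_sigma) (use sa ms' that in \<open>auto simp: measure_space_def\<close>)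
qed

lemma prob_space_rep: "prob_space rep"
proof
  have "content UNIV = 1"
  proof (rule antisym)
    show "content UNIV \<le> 1" by (rule content_le) (simp add: below_bounds)
    have "(\<lambda>_. 1) \<in> below UNIV" by (simp add: below_def)
    from below_ge_content[OF this] show "1 \<le> content UNIV" by (simp add: one)
  qed
  hence "outer UNIV = 1" by (simp add: outer_open)
  moreover have "emeasure rep UNIV = ennreal (outer UNIV)" by (rule emeasure_rep) simp
  ultimately show "emeasure rep (space rep) = 1" by (simp add: space_rep)
qed

lemma measure_rep_open:
  assumes U: "open U" shows "measure rep U = content U"
proof -
  have "emeasure rep U = ennreal (content U)"
    using emeasure_rep[of U] U by (simp add: outer_open)
  thus ?thesis using content_nonneg[of U] by (simp add: measure_def)
qed

text \<open>Cutting a function into \<open>N\<close> horizontal slices compares each slice with the measure of a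
  superlevel set, which is at most the integral of the slice below it.\<close>

lemma functional_le_integral_unit:
  assumes g: "continuous_on UNIV g" "\<And>y. 0 \<le> g y" "\<And>y. g y \<le> 1"
  shows "\<Lambda> g \<le> (\<integral>y. g y \<partial>rep)"
proof (rule field_le_epsilon)
  interpret prob_space rep by (rule prob_space_rep)
  fix e :: real assume e: "e > 0"
  obtain N :: nat where "N > 0" "1 / real N < e"
    using e by (metis nat_approx_posE zero_less_Suc)
  note N = this
  define sl where "sl k y = max 0 (min 1 (real N * g y - real k))" for k y
  have sl_cont: "continuous_on UNIV (sl k)" for k
    unfolding sl_def by (intro continuous_intros g)
  have int: "integrable rep (sl k)" for k
    by (intro integrable_continuous_compact compact_UNIV sl_cont sets_rep finite_measure_axioms)
  have total: "(\<Sum>k<n. sl k y) = min (real n) (real N * g y)" for n y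
    using g(2)[of y] by (induction n) (auto simp: sl_def min_def max_def)
  have gsum: "real N * g y = (\<Sum>k<N. sl k y)" for y
    using g(3)[of y] N by (simp add: total)
  have "\<Lambda> (sl k) \<le> content {y. real k < real N * g y}" for k
    by (rule below_ge_content) (use sl_cont in \<open>auto simp: below_def sl_def indicator_def\<close>)
  also have "content {y. real k < real N * g y} = measure rep {y. real k < real N * g y}" for k
    by (intro measure_rep_open[symmetric] open_Collect_less continuous_intros g)
  finally have up: "\<Lambda> (sl k) \<le> measure rep {y. real k < real N * g y}" for k .
  have low: "measure rep {y. real (Suc k) < real N * g y} \<le> (\<integral>y. sl k y \<partial>rep)" for k
  proof -
    have op: "open {y. real (Suc k) < real N * g y}"
      by (intro open_Collect_less continuous_intros g)
    have "(\<integral>y. indicator {y. real (Suc k) < real N * g y} y \<partial>rep) \<le> (\<integral>y. sl k y \<partial>rep)"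
      using op sets_rep by (intro integral_mono int integrable_real_indicator)
        (auto simp: sl_def indicator_def emeasure_eq_measure)
    thus ?thesis using op by (simp add: sets_rep space_rep)
  qed
  have "real N * \<Lambda> g = (\<Sum>k<N. \<Lambda> (sl k))"
    using scale[OF g(1), of "real N"] sum[of "{..<N}" sl] sl_cont by (simp add: gsum)
  also have "\<dots> \<le> 1 + (\<Sum>k<N. \<integral>y. sl k y \<partial>rep)"
  proof -
    \<comment> \<open>Slice \<open>Suc k\<close> is compared with slice \<open>k\<close>, so the
      bottom slice remains unpaired. It contributes at most 1, which becomes the error
      \<open>1 / N\<close> after division by \<open>N\<close>.\<close>
    obtain n where n: "N = Suc n" using N by (cases N) auto
    have "(\<Sum>k<N. \<Lambda> (sl k)) = \<Lambda> (sl 0) + (\<Sum>k<n. \<Lambda> (sl (Suc k)))"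
      by (simp only: n sum.lessThan_Suc_shift)
    also have "\<dots> \<le> 1 + (\<Sum>k<n. \<integral>y. sl k y \<partial>rep)"
      using order_trans[OF up low] order_trans[OF up prob_le_1] by (intro add_mono sum_mono) auto
    also have "(\<Sum>k<n. \<integral>y. sl k y \<partial>rep) \<le> (\<Sum>k<N. \<integral>y. sl k y \<partial>rep)"
      unfolding n by (intro sum_mono2) (auto intro!: integral_nonneg_AE simp: sl_def)
    finally show ?thesis by simp
  qed
  also have "(\<Sum>k<N. \<integral>y. sl k y \<partial>rep) = (\<integral>y. real N * g y \<partial>rep)"
    unfolding gsum using int by (subst Bochner_Integration.integral_sum) auto
  also have "\<dots> = real N * (\<integral>y. g y \<partial>rep)" by simp
  finally have "\<Lambda> g \<le> 1 / real N + (\<integral>y. g y \<partial>rep)"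
    using N by (simp add: field_simps)
  thus "\<Lambda> g \<le> (\<integral>y. g y \<partial>rep) + e" using N by simp
qed

text \<open>An affine rescaling by a bound \<open>b\<close> moves the values of \<open>g\<close>
  into the unit interval.\<close>

lemma functional_le_integral:
  assumes g: "continuous_on UNIV g"
  shows "\<Lambda> g \<le> (\<integral>y. g y \<partial>rep)"
proof -
  interpret prob_space rep by (rule prob_space_rep)
  obtain B where B: "\<And>y. norm (g y) \<le> B"
    using compact_imp_bounded[OF compact_continuous_image[OF g compact_UNIV]] by (auto simp: bounded_iff)
  define b where "b = max B 1"
  have b: "b \<ge> 1" "\<And>y. - b \<le> g y" "\<And>y. g y \<le> b"
    using B by (auto simp: b_def abs_le_iff minus_le_iff intro: order_trans max.cobounded1)
      (smt (verit) B real_norm_def)+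
  have int: "integrable rep g"
    by (intro integrable_continuous_compact compact_UNIV g sets_rep finite_measure_axioms)
  have b': "0 \<le> g y + b" "g y + b \<le> 2 * b" for y
    using b(2,3)[of y] by simp_all
  define h where "h y = 1 / (2 * b) * (g y + b)" for y
  have hc: "continuous_on UNIV (\<lambda>y. g y + b)" by (intro continuous_intros g)
  have "\<Lambda> h \<le> (\<integral>y. h y \<partial>rep)"
  proof (rule functional_le_integral_unit)
    show "continuous_on UNIV h" unfolding h_def by (intro continuous_intros g)
  qed (use b b' in \<open>auto simp: h_def field_simps\<close>)
  moreover have "\<Lambda> h = 1 / (2 * b) * (\<Lambda> g + b)"
    unfolding h_def scale[OF hc] using add[OF g, of "\<lambda>_. b"] by (simp add: const)
  moreover have "(\<integral>y. h y \<partial>rep) = 1 / (2 * b) * ((\<integral>y. g y \<partial>rep) + b)"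
    unfolding h_def using int prob_space by simp
  ultimately show ?thesis using b by (simp add: divide_le_cancel)
qed

text \<open>The one-sided inequality applied to \<open>g\<close> and to its negative.\<close>

theorem riesz:
  assumes g: "continuous_on UNIV g"
  shows "(\<integral>y. g y \<partial>rep) = \<Lambda> g"
proof -
  have "\<Lambda> (\<lambda>y. (-1) * g y) \<le> (\<integral>y. (-1) * g y \<partial>rep)"
    by (intro functional_le_integral continuous_intros g)
  hence "- \<Lambda> g \<le> - (\<integral>y. g y \<partial>rep)"
    using scale[OF g, of "-1"] by simp
  thus ?thesis using functional_le_integral[OF g] by simp
qed

end

section \<open>Weak-* compactness of the Borel probability measures\<close>

definition weak_star_subbasis :: "'a::topological_space measure set set" where
  "weak_star_subbasis =
     {{\<nu> \<in> borel_prob_measures. (\<integral>x. g x \<partial>\<nu>) \<in> V} | (g :: 'a \<Rightarrow> real) V. continuous_on UNIV g \<and> open V}"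

lemma weak_star_generated: "weak_star = topology_generated_by weak_star_subbasis"
  by (simp add: weak_star_def weak_star_subbasis_def)

lemma weak_star_subbasisI:
  fixes g :: "'a::topological_space \<Rightarrow> real"
  shows "continuous_on UNIV g \<Longrightarrow> open V \<Longrightarrow> {\<nu> \<in> borel_prob_measures. (\<integral>x. g x \<partial>\<nu>) \<in> V} \<in> weak_star_subbasis"
  unfolding weak_star_subbasis_def by blast

lemma weak_star_subbasisE:
  fixes U :: "'a::topological_space measure set"
  assumes "U \<in> weak_star_subbasis"
  obtains g :: "'a \<Rightarrow> real" and V where "U = {\<nu> \<in> borel_prob_measures. (\<integral>x. g x \<partial>\<nu>) \<in> V}"
    "continuous_on UNIV g" "open V"
  using assms unfolding weak_star_subbasis_def by blast

lemma Union_weak_star_subbasis: "\<Union>weak_star_subbasis = borel_prob_measures"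
proof
  have "{\<nu> \<in> borel_prob_measures. (\<integral>x. (\<lambda>_. 0 :: real) x \<partial>\<nu>) \<in> UNIV} \<in> weak_star_subbasis"
    by (rule weak_star_subbasisI) auto
  thus "borel_prob_measures \<subseteq> \<Union>weak_star_subbasis" by auto
qed (auto simp: weak_star_subbasis_def)

lemma topspace_weak_star: "topspace weak_star = borel_prob_measures"
  by (simp add: weak_star_generated Union_weak_star_subbasis)

text \<open>Banach-Alaoglu combined with Riesz. Functionals bounded by the sup bounds
  \<open>B g\<close> lie in a product of compact intervals; linearity, monotonicity and
  normalisation each involve finitely many coordinates and are closed conditions. The map
  \<open>positive_functional.rep\<close> carries the resulting compact set continuously onto all
  Borel probability measures.\<close>

lemma compact_space_weak_star:
  assumes "compact (UNIV :: 'a::metric_space set)"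
  shows "compact_space (weak_star :: 'a measure topology)"
proof -
  define C where "C = {g :: 'a \<Rightarrow> real. continuous_on UNIV g}"
  have "\<exists>B. \<forall>y. \<bar>g y\<bar> \<le> B" if "g \<in> C" for g
    using compact_imp_bounded[OF compact_continuous_image[of UNIV g, OF _ assms]] that
    by (auto simp: bounded_iff C_def)
  then obtain B where B: "\<And>g y. g \<in> C \<Longrightarrow> \<bar>g y\<bar> \<le> B g" by metis
  define T where "T = product_topology (\<lambda>g. subtopology euclideanreal {- B g..B g}) C"
  have "compact_space T"
    unfolding T_def compact_space_product_topology by (auto simp: compact_space_subtopology)
  have proj: "continuous_map T euclideanreal (\<lambda>\<Lambda>. \<Lambda> g)" if "g \<in> C" for g
    using continuous_map_product_projection[OF that, of "\<lambda>g. subtopology euclideanreal {- B g..B g}"]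
    unfolding T_def by (rule continuous_map_into_fulltopology)
  define F where "F = {\<Lambda> \<in> topspace T. (\<forall>g\<in>C. \<forall>h\<in>C. \<Lambda> (\<lambda>y. g y + h y) = \<Lambda> g + \<Lambda> h) \<and>
     (\<forall>g\<in>C. \<forall>c. \<Lambda> (\<lambda>y. c * g y) = c * \<Lambda> g) \<and>
     (\<forall>g\<in>C. \<forall>h\<in>C. (\<forall>y. g y \<le> h y) \<longrightarrow> \<Lambda> g \<le> \<Lambda> h) \<and> \<Lambda> (\<lambda>_. 1) = 1}"
  have CI: "(\<lambda>y. g y + h y) \<in> C" "(\<lambda>y. c * g y) \<in> C" if "g \<in> C" "h \<in> C" for g h c
    using that by (auto simp: C_def intro: continuous_intros)
  have one: "(\<lambda>_. 1) \<in> C" by (simp add: C_def)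
  have clF: "closedin T F"
  proof -
    have "closedin T {\<Lambda> \<in> topspace T. u \<Lambda> \<in> S}" if "continuous_map T euclideanreal u" "closed S"
      for u :: "_ \<Rightarrow> real" and S
      using that by (intro closedin_continuous_map_preimage[where Y=euclideanreal]) auto
    note cl = this[of _ "{0}"] this[of _ "{0..}"]
    \<comment> \<open>Every law is written as the preimage of \<open>{0}\<close> or
      \<open>{0..}\<close> under a continuous function of coordinates. Including
      \<open>topspace T\<close> keeps the intersection inside the product.\<close>
    define \<F> where "\<F> = {topspace T}
      \<union> {{\<Lambda> \<in> topspace T. \<Lambda> (\<lambda>y. g y + h y) - (\<Lambda> g + \<Lambda> h) \<in> {0}} | g h. g \<in> C \<and> h \<in> C}
      \<union> {{\<Lambda> \<in> topspace T. \<Lambda> (\<lambda>y. c * g y) - c * \<Lambda> g \<in> {0}} | g c. g \<in> C}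
      \<union> {{\<Lambda> \<in> topspace T. \<Lambda> h - \<Lambda> g \<in> {0..}} | g h. g \<in> C \<and> h \<in> C \<and> (\<forall>y. g y \<le> h y)}
      \<union> {{\<Lambda> \<in> topspace T. \<Lambda> (\<lambda>_. 1) - 1 \<in> {0}}}"
    have "closedin T (\<Inter>\<F>)"
    proof (rule closedin_Inter)
      fix S assume "S \<in> \<F>"
      thus "closedin T S"
        unfolding \<F>_def
        by (elim UnE CollectE exE conjE singletonE; simp only:;
            intro closedin_topspace cl continuous_intros proj CI one; auto)
    qed (simp add: \<F>_def)
    moreover have "\<Inter>\<F> = F"
    proof (intro equalityI subsetI)
      fix \<Lambda> assume A: "\<Lambda> \<in> \<Inter>\<F>"
      have "\<Lambda> \<in> topspace T" "\<Lambda> (\<lambda>_. 1) = 1"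
        using A unfolding \<F>_def by auto
      moreover have "\<Lambda> (\<lambda>y. g y + h y) = \<Lambda> g + \<Lambda> h" if "g \<in> C" "h \<in> C" for g h
      proof -
        have "\<Lambda> \<in> {\<Lambda> \<in> topspace T. \<Lambda> (\<lambda>y. g y + h y) - (\<Lambda> g + \<Lambda> h) \<in> {0}}"
          by (rule InterD[OF A]) (use that in \<open>auto simp: \<F>_def\<close>)
        thus ?thesis by simp
      qed
      moreover have "\<Lambda> (\<lambda>y. c * g y) = c * \<Lambda> g" if "g \<in> C" for g c
      proof -
        have "\<Lambda> \<in> {\<Lambda> \<in> topspace T. \<Lambda> (\<lambda>y. c * g y) - c * \<Lambda> g \<in> {0}}"
          by (rule InterD[OF A]) (use that in \<open>auto simp: \<F>_def\<close>)
        thus ?thesis by simp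
      qed
      moreover have "\<Lambda> g \<le> \<Lambda> h" if "g \<in> C" "h \<in> C" "\<forall>y. g y \<le> h y" for g h
      proof -
        have "\<Lambda> \<in> {\<Lambda> \<in> topspace T. \<Lambda> h - \<Lambda> g \<in> {0..}}"
          by (rule InterD[OF A]) (use that in \<open>auto simp: \<F>_def\<close>)
        thus ?thesis by simp
      qed
      ultimately show "\<Lambda> \<in> F" unfolding F_def by blast
    qed (auto simp: \<F>_def F_def)
    ultimately show ?thesis by simp
  qed
  have pf: "positive_functional \<Lambda>" if "\<Lambda> \<in> F" for \<Lambda>
    using that assms unfolding F_def C_def positive_functional_def by blast
  have pm: "positive_functional.rep \<Lambda> \<in> borel_prob_measures" if "\<Lambda> \<in> F" for \<Lambda>
    using positive_functional.prob_space_rep[OF pf[OF that]] positive_functional.sets_rep[OF pf[OF that]]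
    by (simp add: borel_prob_measures_def)
  have tF: "topspace (subtopology T F) = F"
    using clF closedin_subset by auto
  have cont: "continuous_map (subtopology T F) weak_star positive_functional.rep"
    unfolding weak_star_generated
  proof (rule continuous_on_generated_topo)
    fix U :: "'a measure set" assume "U \<in> weak_star_subbasis"
    then obtain g :: "'a \<Rightarrow> real" and V where U: "U = {\<nu> \<in> borel_prob_measures. (\<integral>x. g x \<partial>\<nu>) \<in> V}"
      "continuous_on UNIV g" "open V" by (rule weak_star_subbasisE)
    have "positive_functional.rep -` U \<inter> topspace (subtopology T F) = {\<Lambda> \<in> topspace (subtopology T F). \<Lambda> g \<in> V}"
      using positive_functional.riesz[OF pf U(2)] pm unfolding tF U(1) by auto
    also have "openin (subtopology T F) \<dots>"
      using U by (intro openin_continuous_map_preimage[where Y=euclideanreal] continuous_map_from_subtopology proj)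
        (auto simp: C_def)
    finally show "openin (subtopology T F) (positive_functional.rep -` U \<inter> topspace (subtopology T F))" .
  next
    show "positive_functional.rep ` topspace (subtopology T F) \<subseteq>
      \<Union>weak_star_subbasis"
      using pm unfolding tF Union_weak_star_subbasis by blast
  qed
  have surj: "positive_functional.rep ` F = borel_prob_measures"
  proof (intro equalityI subsetI)
    fix \<nu> :: "'a measure" assume \<nu>: "\<nu> \<in> borel_prob_measures"
    interpret prob_space \<nu> using \<nu> by (simp add: borel_prob_measures_def)
    have sb: "sets \<nu> = sets borel" using \<nu> by (simp add: borel_prob_measures_def)
    have int: "integrable \<nu> g" if "g \<in> C" for g
      using that by (intro integrable_continuous_compact assms sb finite_measure_axioms) (simp add: C_def)
    \<comment> \<open>Points of the product topology are extensional functions on \<open>C\<close>,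
      hence the restriction.\<close>
    define \<Lambda> where "\<Lambda> = restrict (\<lambda>g. \<integral>y. g y \<partial>\<nu>) C"
    have "\<bar>\<integral>y. g y \<partial>\<nu>\<bar> \<le> B g" if "g \<in> C" for g
    proof -
      have "\<bar>\<integral>y. g y \<partial>\<nu>\<bar> \<le> (\<integral>y. \<bar>g y\<bar> \<partial>\<nu>)" by (rule integral_abs_bound)
      also have "\<dots> \<le> (\<integral>y. B g \<partial>\<nu>)"
        using int[OF that] B[OF that] by (intro integral_mono) auto
      finally show ?thesis using prob_space by simp
    qed
    hence "\<Lambda> \<in> topspace T"
      by (force simp: T_def \<Lambda>_def abs_le_iff)
    moreover have "\<Lambda> (\<lambda>y. g y + h y) = \<Lambda> g + \<Lambda> h" if "g \<in> C" "h \<in> C" for g h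
      using that CI int by (simp add: \<Lambda>_def)
    moreover have "\<Lambda> (\<lambda>y. c * g y) = c * \<Lambda> g" if "g \<in> C" for g c
      using that CI by (simp add: \<Lambda>_def)
    moreover have "\<Lambda> g \<le> \<Lambda> h" if "g \<in> C" "h \<in> C" "\<forall>y. g y \<le> h y" for g h
      using that int by (simp add: \<Lambda>_def integral_mono)
    moreover have "\<Lambda> (\<lambda>_. 1) = 1"
      using one prob_space by (simp add: \<Lambda>_def)
    ultimately have \<Lambda>F: "\<Lambda> \<in> F" unfolding F_def by blast
    have "positive_functional.rep \<Lambda> = \<nu>"
    proof (rule measure_eqI_continuous)
      fix g :: "'a \<Rightarrow> real" assume "continuous_on UNIV g"
      thus "(\<integral>y. g y \<partial>positive_functional.rep \<Lambda>) = (\<integral>y. g y \<partial>\<nu>)"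
        using positive_functional.riesz[OF pf[OF \<Lambda>F]] by (simp add: \<Lambda>_def C_def)
    qed (use pm[OF \<Lambda>F] sb finite_measure_axioms in \<open>auto simp: borel_prob_measures_def prob_space.finite_measure\<close>)
    thus "\<nu> \<in> positive_functional.rep ` F" using \<Lambda>F by blast
  qed (use pm in auto)
  have "compactin T F"
    using closedin_compact_space[OF \<open>compact_space T\<close> clF] .
  hence "compactin (subtopology T F) F"
    by (simp add: compactin_subtopology)
  hence "compactin weak_star (positive_functional.rep ` F)"
    using image_compactin cont by blast
  thus ?thesis
    unfolding surj by (simp add: compact_space_def topspace_weak_star)
qed

section \<open>Specification along local unstable sets\<close>

locale smale =
  fixes f :: "'a::metric_space \<Rightarrow> 'a" and br :: "'a \<Rightarrow> 'a \<Rightarrow> 'a" and \<kappa> lam :: real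
  assumes compact_UNIV: "compact (UNIV :: 'a set)"
    and bij: "bij f" and f_cont: "continuous_on UNIV f" and inv_cont: "continuous_on UNIV (inv f)"
    and \<kappa>_pos: "0 < \<kappa>"
    and br_cont: "continuous_on {p :: 'a \<times> 'a. dist (fst p) (snd p) < \<kappa>} (\<lambda>p. br (fst p) (snd p))"
    and br_self: "br x x = x"
    and br_left: "dist x y < \<kappa> \<Longrightarrow> dist (br x y) z < \<kappa> \<Longrightarrow> dist x z < \<kappa> \<Longrightarrow> br (br x y) z = br x z"
    and br_right: "dist y z < \<kappa> \<Longrightarrow> dist x (br y z) < \<kappa> \<Longrightarrow> dist x z < \<kappa> \<Longrightarrow> br x (br y z) = br x z"
    and f_br: "dist x y < \<kappa> \<Longrightarrow> dist (f x) (f y) < \<kappa> \<Longrightarrow> f (br x y) = br (f x) (f y)"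
    and lam: "0 < lam" "lam < 1"
    and stable: "dist x y < \<kappa> \<Longrightarrow> dist x z < \<kappa> \<Longrightarrow> br y x = x \<Longrightarrow> br z x = x \<Longrightarrow>
      dist (f y) (f z) \<le> lam * dist y z"
    and unstable: "dist x y < \<kappa> \<Longrightarrow> dist x z < \<kappa> \<Longrightarrow> br x y = x \<Longrightarrow> br x z = x \<Longrightarrow>
      dist (inv f y) (inv f z) \<le> lam * dist y z"

lemma smale_space_smale:
  assumes "smale_space f br"
  obtains \<kappa> lam where "smale f br \<kappa> lam"
  using assms unfolding smale_space_def
  apply (elim conjE exE)
  apply (rule that)
  apply (unfold_locales; (assumption | blast)?)
  done

context smale
begin

lemma f_inv [simp]: "f (inv f x) = x" and inv_f [simp]: "inv f (f x) = x"
  using bij by (auto simp: bij_def surj_f_inv_f)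

lemma funpow_inv [simp]: "(f ^^ n) ((inv f ^^ n) x) = x"
  by (induction n arbitrary: x) (simp_all del: funpow.simps(2) add: funpow_Suc_right[of _ f] , simp)

lemma inv_funpow [simp]: "(inv f ^^ n) ((f ^^ n) x) = x"
  by (induction n arbitrary: x) (simp_all del: funpow.simps(2) add: funpow_Suc_right[of _ "inv f"] , simp)

text \<open>Writing $x \sim_u y$ for points on a common local unstable set and $x \sim_s y$ for the
  stable analogue, the bracket of two points is stably equivalent to its first and
  unstably equivalent to its second argument.\<close>

definition usim :: "'a \<Rightarrow> 'a \<Rightarrow> bool" where
  "usim x y \<longleftrightarrow> dist x y < \<kappa> \<and> br x y = x"

definition ssim :: "'a \<Rightarrow> 'a \<Rightarrow> bool" where
  "ssim x y \<longleftrightarrow> dist x y < \<kappa> \<and> br y x = x"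

lemma usim_br_flip: "usim x y \<Longrightarrow> br y x = y"
  using br_right[of x y y] \<kappa>_pos by (auto simp: usim_def br_self dist_commute)

text \<open>The relation is symmetric; the flipped form is the one that occurs in
  \<open>local_unstable\<close>.\<close>

lemma usim_iff_flip: "usim x y \<longleftrightarrow> dist x y < \<kappa> \<and> br y x = y"
  using usim_br_flip[of x y] br_right[of y x x] \<kappa>_pos by (auto simp: usim_def br_self dist_commute)

lemma usim_trans: "usim x y \<Longrightarrow> usim y z \<Longrightarrow> dist x z < \<kappa> \<Longrightarrow> usim x z"
  using br_right[of y z x] \<kappa>_pos by (simp add: usim_def)

text \<open>The contraction keeps the preimages within \<open>\<kappa>\<close>, where
  \<open>f\<close> commutes with the bracket, so the relation itself passes to preimages and can be
  iterated. \<open>ssim_f\<close> is the forward analogue.\<close>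

lemma usim_inv:
  assumes "usim x y" shows "usim (inv f x) (inv f y)" "dist (inv f x) (inv f y) \<le> lam * dist x y"
proof -
  show d: "dist (inv f x) (inv f y) \<le> lam * dist x y"
    using unstable[of x x y] assms by (simp add: usim_def br_self \<kappa>_pos)
  also have "\<dots> \<le> dist x y"
    using lam by (simp add: mult_left_le_one_le)
  finally have d2: "dist (inv f x) (inv f y) < \<kappa>"
    using assms by (simp add: usim_def)
  hence "f (br (inv f x) (inv f y)) = x"
    using f_br[of "inv f x" "inv f y"] assms by (simp add: usim_def)
  hence "br (inv f x) (inv f y) = inv f x"
    by (metis inv_f)
  thus "usim (inv f x) (inv f y)" using d2 by (simp add: usim_def)
qed

lemma usim_inv_funpow:
  assumes "usim x y"
  shows "usim ((inv f ^^ n) x) ((inv f ^^ n) y) \<and>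
    dist ((inv f ^^ n) x) ((inv f ^^ n) y) \<le> lam ^ n * dist x y"
proof (induction n)
  case (Suc n)
  have "dist ((inv f ^^ Suc n) x) ((inv f ^^ Suc n) y) \<le> lam * (lam ^ n * dist x y)"
    using usim_inv(2)[OF conjunct1[OF Suc]] Suc lam
    by (auto intro: order_trans mult_left_mono)
  thus ?case using usim_inv(1)[OF conjunct1[OF Suc]] by simp
qed (use assms in simp)

lemma ssim_f:
  assumes "ssim x y" shows "ssim (f x) (f y)" "dist (f x) (f y) \<le> lam * dist x y"
proof -
  show d: "dist (f x) (f y) \<le> lam * dist x y"
    using stable[of x x y] assms by (simp add: ssim_def br_self \<kappa>_pos)
  also have "\<dots> \<le> dist x y"
    using lam by (simp add: mult_left_le_one_le)
  finally have d2: "dist (f x) (f y) < \<kappa>"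
    using assms by (simp add: ssim_def)
  hence "br (f y) (f x) = f x"
    using f_br[of y x] assms by (simp add: ssim_def dist_commute)
  thus "ssim (f x) (f y)" using d2 by (simp add: ssim_def)
qed

lemma ssim_funpow:
  assumes "ssim x y"
  shows "ssim ((f ^^ n) x) ((f ^^ n) y) \<and> dist ((f ^^ n) x) ((f ^^ n) y) \<le> dist x y"
proof (induction n)
  case (Suc n)
  have "dist ((f ^^ Suc n) x) ((f ^^ Suc n) y) \<le> lam * dist ((f ^^ n) x) ((f ^^ n) y)"
    using ssim_f(2)[OF conjunct1[OF Suc]] by simp
  also have "\<dots> \<le> dist ((f ^^ n) x) ((f ^^ n) y)"
    using lam by (simp add: mult_left_le_one_le)
  finally show ?case using ssim_f(1)[OF conjunct1[OF Suc]] Suc by simp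
qed (use assms in simp)

text \<open>On the diagonal the bracket is the identity, and it is uniformly continuous on the
  closed set of pairs at distance at most \<open>\<kappa> / 2\<close>. The half is taken because the
  full domain is open and need not be compact.\<close>

lemma br_close:
  assumes "\<alpha> > 0"
  obtains \<beta> where "\<beta> > 0" "\<beta> < \<kappa>" "\<beta> \<le> \<alpha>" "\<And>x y. dist x y < \<beta> \<Longrightarrow> dist (br x y) x < \<alpha>"
proof -
  let ?S = "{p :: 'a \<times> 'a. dist (fst p) (snd p) \<le> \<kappa> / 2}"
  have "closed ?S"
    by (intro closed_Collect_le continuous_intros)
  moreover have "compact (UNIV :: ('a \<times> 'a) set)"
    using compact_Times[OF compact_UNIV compact_UNIV] by (simp add: UNIV_Times_UNIV)
  ultimately have "compact ?S"
    using compact_Int_closed[of UNIV ?S] by simp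
  moreover have "continuous_on ?S (\<lambda>p. br (fst p) (snd p))"
    by (rule continuous_on_subset[OF br_cont]) (use \<kappa>_pos in auto)
  ultimately have "uniformly_continuous_on ?S (\<lambda>p. br (fst p) (snd p))"
    by (rule compact_uniformly_continuous[rotated])
  then obtain d where d: "d > 0" "\<forall>p\<in>?S. \<forall>q\<in>?S. dist q p < d \<longrightarrow>
      dist (br (fst q) (snd q)) (br (fst p) (snd p)) < \<alpha>"
    unfolding uniformly_continuous_on_def using \<open>\<alpha> > 0\<close> by (elim allE[of _ \<alpha>]) auto
  have "dist (br x y) x < \<alpha>" if "dist x y < min d (min \<alpha> (\<kappa> / 2))" for x y
  proof -
    have "dist (x, y) (x, x) < d"
      using that by (simp add: dist_Pair_Pair dist_commute)
    thus ?thesis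
      using d(2)[THEN bspec, THEN bspec, of "(x, x)" "(x, y)"] that \<kappa>_pos by (simp add: br_self)
  qed
  thus ?thesis
    using that[of "min d (min \<alpha> (\<kappa> / 2))"] d \<kappa>_pos assms by auto
qed

text \<open>Mixing supplies an orbit piece from a neighbour of \<open>z\<close> to a neighbour of \<open>p\<close>; two
  brackets move its start onto the unstable set of \<open>z\<close> and its end onto the stable set of \<open>p\<close>.\<close>

lemma unstable_connection:
  assumes mix: "topologically_mixing f" and \<alpha>: "\<alpha> > 0"
  obtains M where "\<And>z p. \<exists>y. usim z y \<and> dist z y < \<alpha> \<and> (\<forall>i. dist ((f ^^ (M + i)) y) ((f ^^ i) p) < \<alpha>)"
proof -
  define \<gamma> where "\<gamma> = min \<alpha> \<kappa> / 4"
  have \<gamma>: "\<gamma> > 0" "4 * \<gamma> \<le> \<alpha>" "4 * \<gamma> \<le> \<kappa>"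
    using \<alpha> \<kappa>_pos by (auto simp: \<gamma>_def)
  obtain \<beta> where \<beta>: "\<beta> > 0" "\<beta> < \<kappa>" "\<beta> \<le> \<gamma>" "\<And>x y. dist x y < \<beta> \<Longrightarrow> dist (br x y) x < \<gamma>"
    using br_close[OF \<gamma>(1)] by metis
  \<comment> \<open>Scales are chosen backwards: a mixing error below \<open>r\<close> and a first
    bracket error below \<open>\<beta> / 2\<close> add up to less than \<open>\<beta>\<close>, which
    is what the second bracket needs to move points by less than \<open>\<gamma>\<close>.\<close>
  obtain r where r: "r > 0" "r < \<kappa>" "r \<le> \<beta> / 2" "\<And>x y. dist x y < r \<Longrightarrow> dist (br x y) x < \<beta> / 2"
    using br_close[OF half_gt_zero[OF \<beta>(1)]] by metis
  have cover: "UNIV \<subseteq> (\<Union>t\<in>UNIV. ball t (r / 2))"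
  proof
    fix t
    have "t \<in> ball t (r / 2)" using r(1) by simp
    thus "t \<in> (\<Union>t\<in>UNIV. ball t (r / 2))" by blast
  qed
  obtain T :: "'a set" where T: "finite T" "UNIV \<subseteq> (\<Union>t\<in>T. ball t (r / 2))"
    by (rule compactE_image[OF compact_UNIV _ cover]) auto
  have "\<exists>N. \<forall>n\<ge>N. (f ^^ n) ` ball s (r / 2) \<inter> ball t (r / 2) \<noteq> {}" for s t
  proof -
    have "open (ball s (r / 2))" "open (ball t (r / 2))" "ball s (r / 2) \<noteq> {}" "ball t (r / 2) \<noteq> {}"
      using r(1) by auto
    thus ?thesis using mix unfolding topologically_mixing_def by blast
  qed
  then obtain N where N: "\<And>s t n. n \<ge> N s t \<Longrightarrow> (f ^^ n) ` ball s (r / 2) \<inter> ball t (r / 2) \<noteq> {}"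
    by metis
  \<comment> \<open>The mixing time depends on the pair of open sets. A finite cover by small balls
    leaves finitely many pairs, so one \<open>M\<close> serves all \<open>z\<close> and
    \<open>p\<close>.\<close>
  define M where "M = Max ((\<lambda>(s, t). N s t) ` (T \<times> T))"
  have M: "M \<ge> N s t" if "s \<in> T" "t \<in> T" for s t
    unfolding M_def using T(1) that by (intro Max_ge) auto
  have "\<exists>y. usim z y \<and> dist z y < \<alpha> \<and> (\<forall>i. dist ((f ^^ (M + i)) y) ((f ^^ i) p) < \<alpha>)" for z p
  proof -
    obtain s t where "s \<in> T" "t \<in> T" "z \<in> ball s (r / 2)" "p \<in> ball t (r / 2)"
      using T(2) by blast
    hence st: "s \<in> T" "t \<in> T" "dist s z < r / 2" "dist t p < r / 2"
      by auto
    obtain w where "w \<in> ball s (r / 2)" "(f ^^ M) w \<in> ball t (r / 2)"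
      using N[OF M[OF st(1,2)]] by blast
    hence w: "dist s w < r / 2" "dist t ((f ^^ M) w) < r / 2"
      by auto
    have wz: "dist w z < r" "dist ((f ^^ M) w) p < r"
      using st w by metric+
    define w' where "w' = br w z"
    have w'w: "dist w' w < \<beta> / 2" unfolding w'_def by (rule r(4)[OF wz(1)])
    have zw': "dist z w' < \<beta>" using w'w wz r(3) \<beta>(1) by metric
    have "br z w' = z"
      unfolding w'_def using br_right[of w z z] wz(1) r(2) zw' \<beta>(2) \<kappa>_pos
      by (simp add: w'_def br_self)
    hence u1: "usim z w'" using zw' \<beta>(2) by (simp add: usim_def)
    have "br w' w = w"
      unfolding w'_def using br_left[of w z w] wz(1) r(2) w'w \<beta> \<kappa>_pos by (simp add: w'_def br_self)
    hence "ssim w w'" using w'w \<beta> by (simp add: ssim_def dist_commute)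
    hence "dist ((f ^^ M) w) ((f ^^ M) w') < \<beta> / 2"
      using ssim_funpow[of w w' M] w'w by (simp add: dist_commute)
    hence pv: "dist p ((f ^^ M) w') < \<beta>" using wz r(3) by metric
    define v where "v = (f ^^ M) w'"
    define q where "q = br p v"
    have qp: "dist q p < \<gamma>" unfolding q_def by (rule \<beta>(4)) (use pv in \<open>simp add: v_def\<close>)
    have vq: "dist v q < 2 * \<gamma>" using qp pv \<beta>(3) unfolding v_def by metric
    have "br q p = p"
      unfolding q_def using br_left[of p v p] pv \<beta>(2) qp \<gamma> \<kappa>_pos by (simp add: q_def v_def br_self)
    hence "ssim p q" using qp \<gamma> by (simp add: ssim_def dist_commute)
    hence qi: "dist ((f ^^ i) q) ((f ^^ i) p) < \<gamma>" for i
      using ssim_funpow[of p q i] qp by (simp add: dist_commute)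
    have "br v q = v"
      unfolding q_def using br_right[of p v v] pv \<beta>(2) vq \<gamma> \<kappa>_pos by (simp add: q_def v_def br_self)
    hence "usim v q" using vq \<gamma> by (simp add: usim_def)
    note u = usim_inv_funpow[OF this, of M]
    \<comment> \<open>\<open>q\<close> is on the unstable set of \<open>v\<close> and on the stable
      set of \<open>p\<close>. Pulling it back \<open>M\<close> steps contracts its distance to the
      orbit of \<open>w'\<close>, while its forward orbit keeps following that of
      \<open>p\<close>.\<close>
    define y where "y = (inv f ^^ M) q"
    have u2: "usim w' y" using u by (simp add: v_def y_def)
    have "dist w' y \<le> lam ^ M * dist v q" using u by (simp add: v_def y_def)
    also have "\<dots> \<le> dist v q"
      using lam by (simp add: mult_left_le_one_le power_le_one)
    finally have "dist w' y < 2 * \<gamma>" using vq by simp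
    hence zy: "dist z y < 3 * \<gamma>" using zw' \<beta>(3) by metric
    have "usim z y" by (rule usim_trans[OF u1 u2]) (use zy \<gamma> in simp)
    moreover have "dist ((f ^^ (M + i)) y) ((f ^^ i) p) < \<alpha>" for i
    proof -
      have "(f ^^ (M + i)) y = (f ^^ i) q"
        by (subst add.commute) (simp add: funpow_add y_def)
      thus ?thesis using qi[of i] \<gamma> by simp
    qed
    ultimately show ?thesis using zy \<gamma> by (intro exI[of _ y]) auto
  qed
  thus ?thesis using that by blast
qed

text \<open>Blocks are prepended one at a time: pulling back the orbit that shadows the remaining
  blocks perturbs the current block only by a geometrically small amount.\<close>

lemma unstable_specification:
  assumes mix: "topologically_mixing f" and \<eta>: "\<eta> > 0"
  obtains M where "\<And>m x s. m \<ge> 1 \<Longrightarrow> \<exists>y. usim x y \<and> dist x y < \<eta> \<and>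
     (\<forall>j<length s. \<forall>i<m. dist ((f ^^ (j * (m + M) + M + i)) y) ((f ^^ i) (s ! j)) < \<eta>)"
proof -
  define R where "R = min \<eta> \<kappa> / 3"
  have R: "R > 0" "2 * R < \<eta>" "2 * R < \<kappa>"
    using \<eta> \<kappa>_pos by (auto simp: R_def)
  \<comment> \<open>This choice closes the induction: the new connection contributes
    \<open>(1 - lam) * R\<close>, the pulled-back error of the later blocks at most
    \<open>lam * R\<close>, together \<open>R\<close> again.\<close>
  define \<alpha> where "\<alpha> = (1 - lam) * R"
  have \<alpha>: "\<alpha> > 0" using lam R by (simp add: \<alpha>_def)
  have "\<alpha> \<le> 1 * R" unfolding \<alpha>_def using lam R by (intro mult_right_mono) auto
  hence \<alpha>R: "\<alpha> \<le> R" by simp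
  obtain M where M: "\<And>z p. \<exists>y. usim z y \<and> dist z y < \<alpha> \<and> (\<forall>i. dist ((f ^^ (M + i)) y) ((f ^^ i) p) < \<alpha>)"
    using unstable_connection[OF mix \<alpha>] by metis
  have "\<exists>y. usim x y \<and> dist x y \<le> R \<and>
     (\<forall>j<length s. \<forall>i<m. dist ((f ^^ (j * (m + M) + M + i)) y) ((f ^^ i) (s ! j)) < 2 * R)"
    if m: "m \<ge> 1" for m x s
  proof (induction s arbitrary: x)
    case Nil
    show ?case using R \<kappa>_pos by (intro exI[of _ x]) (simp add: usim_def br_self)
  next
    case (Cons p s)
    \<comment> \<open>One period consists of \<open>M\<close> connecting steps followed by a block
      of \<open>m\<close> steps.\<close>
    define L where "L = m + M"
    obtain y1 where y1: "usim x y1" "dist x y1 < \<alpha>" "\<And>i. dist ((f ^^ (M + i)) y1) ((f ^^ i) p) < \<alpha>"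
      using M by metis
    obtain y2 where y2: "usim ((f ^^ L) y1) y2" "dist ((f ^^ L) y1) y2 \<le> R"
      "\<And>j i. j < length s \<Longrightarrow> i < m \<Longrightarrow> dist ((f ^^ (j * L + M + i)) y2) ((f ^^ i) (s ! j)) < 2 * R"
      using Cons.IH[of "(f ^^ L) y1"] unfolding L_def by blast
    define y where "y = (inv f ^^ L) y2"
    have fy: "(f ^^ L) y = y2" by (simp add: y_def)
    have pull: "(inv f ^^ k) ((f ^^ L) u) = (f ^^ (L - k)) u" if "k \<le> L" for k u
    proof -
      have "(f ^^ L) u = (f ^^ k) ((f ^^ (L - k)) u)"
        using that by (metis comp_apply funpow_add le_add_diff_inverse)
      thus ?thesis by simp
    qed
    have close: "usim ((f ^^ (L - k)) y1) ((f ^^ (L - k)) y) \<and>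
        dist ((f ^^ (L - k)) y1) ((f ^^ (L - k)) y) \<le> lam ^ k * R" if "k \<le> L" for k
    proof -
      have "lam ^ k * dist ((f ^^ L) y1) y2 \<le> lam ^ k * R"
        using y2(2) lam by (intro mult_left_mono) auto
      thus ?thesis
        using usim_inv_funpow[OF y2(1), of k] pull[OF that, of y1] pull[OF that, of y] fy by auto
    qed
    have close1: "lam ^ k * R \<le> lam * R" if "k \<ge> 1" for k
      using power_decreasing[OF that, of lam] lam R by simp
    have "dist y1 y \<le> lam * R"
      using close[of L] close1[of L] m by (simp add: L_def)
    hence xy: "dist x y \<le> R"
      using y1(2) unfolding \<alpha>_def by (simp add: algebra_simps) metric
    have uxy: "usim x y"
      by (rule usim_trans[OF y1(1)]) (use close[of L] xy R in auto)
    have "dist ((f ^^ (j * L + M + i)) y) ((f ^^ i) ((p # s) ! j)) < 2 * R"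
      if j: "j < length (p # s)" and i: "i < m" for i j
    proof (cases j)
      case 0
      \<comment> \<open>Times in the current block precede time \<open>L\<close> by at least one
        step, which gives at least one contraction factor \<open>lam\<close>.\<close>
      have Mi: "M + i = L - (m - i)" "m - i \<le> L" "m - i \<ge> 1" using i by (auto simp: L_def)
      have "dist ((f ^^ (M + i)) y1) ((f ^^ (M + i)) y) \<le> lam * R"
        using close[OF Mi(2)] close1[OF Mi(3)] Mi(1) by simp
      moreover have "lam * R \<le> R" using lam R by simp
      ultimately show ?thesis
        using y1(3)[of i] 0 \<alpha>R by simp metric
    next
      case (Suc j')
      have "(f ^^ (j * L + M + i)) y = (f ^^ ((j' * L + M + i) + L)) y"
        using Suc by (simp add: algebra_simps)
      also have "\<dots> = (f ^^ (j' * L + M + i)) y2"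
        by (subst funpow_add) (simp add: fy)
      finally show ?thesis using y2(3)[of j' i] j i Suc by simp
    qed
    thus ?case using uxy xy unfolding L_def by blast
  qed
  note * = this
  have "\<exists>y. usim x y \<and> dist x y < \<eta> \<and>
     (\<forall>j<length s. \<forall>i<m. dist ((f ^^ (j * (m + M) + M + i)) y) ((f ^^ i) (s ! j)) < \<eta>)"
    if "m \<ge> 1" for m x s
  proof -
    obtain y where y: "usim x y" "dist x y \<le> R"
      "\<And>j i. j < length s \<Longrightarrow> i < m \<Longrightarrow> dist ((f ^^ (j * (m + M) + M + i)) y) ((f ^^ i) (s ! j)) < 2 * R"
      using *[OF \<open>m \<ge> 1\<close>] by blast
    have "dist x y < \<eta>" using y(2) R by linarith
    moreover have "dist ((f ^^ (j * (m + M) + M + i)) y) ((f ^^ i) (s ! j)) < \<eta>"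
      if "j < length s" "i < m" for j i
      using y(3)[OF that] R(2) by linarith
    ultimately show ?thesis using y(1) by blast
  qed
  thus ?thesis using that by blast
qed

lemma local_unstable_iff_usim: "\<delta> \<le> \<kappa> \<Longrightarrow> y \<in> local_unstable br \<delta> x \<longleftrightarrow> usim x y \<and> dist x y < \<delta>"
  by (auto simp: local_unstable_def usim_iff_flip)

lemma usim_imp_unstable_manifold:
  assumes "usim x y" shows "y \<in> unstable_manifold f x"
proof -
  have "(\<lambda>n. lam ^ n * dist x y) \<longlonglongrightarrow> 0"
    using lam by (intro tendsto_mult_left_zero LIMSEQ_realpow_zero) auto
  hence "(\<lambda>n. dist ((inv f ^^ n) x) ((inv f ^^ n) y)) \<longlonglongrightarrow> 0"
    by (rule Lim_null_comparison[rotated]) (use usim_inv_funpow[OF assms] in auto)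
  thus ?thesis by (simp add: unstable_manifold_def dist_commute)
qed

end

section \<open>Orbital measures and the weak-* topology\<close>

text \<open>The uniform measure on the nonempty set \<open>{..<n}\<close> is that of
  \<open>pmf_of_set\<close>, whose integrals are averages.\<close>

lemma integral_orbital_measure:
  fixes g :: "'a::metric_space \<Rightarrow> real"
  assumes "n \<ge> 1" "g \<in> borel_measurable borel"
  shows "(\<integral>y. g y \<partial>orbital_measure f n x) = birkhoff_sum f g n x / real n"
proof -
  have fin: "finite {..<n}" "{..<n} \<noteq> {}" using assms(1) by (auto simp: lessThan_empty_iff)
  have "uniform_measure (count_space UNIV) {..<n} = measure_pmf (pmf_of_set {..<n})"
  proof (rule measure_eqI)
    fix A :: "nat set"
    show "emeasure (uniform_measure (count_space UNIV) {..<n}) A = emeasure (measure_pmf (pmf_of_set {..<n})) A"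
      using assms(1) by (simp add: emeasure_pmf_of_set fin divide_ennreal flip: ennreal_of_nat_eq_real_of_nat)
        (simp add: ennreal_of_nat_eq_real_of_nat divide_ennreal)
  qed simp
  hence "(\<integral>y. g y \<partial>orbital_measure f n x) = (\<integral>i. g ((f ^^ i) x) \<partial>measure_pmf (pmf_of_set {..<n}))"
    unfolding orbital_measure_def using assms(2) by (subst integral_distr) auto
  also have "\<dots> = birkhoff_sum f g n x / real n"
    using fin by (simp add: integral_pmf_of_set birkhoff_sum_def)
  finally show ?thesis .
qed

lemma orbital_measure_in:
  assumes "n \<ge> 1"
  shows "orbital_measure f n x \<in> borel_prob_measures"
proof -
  have "emeasure (count_space UNIV) {..<n} \<noteq> 0" "emeasure (count_space UNIV) {..<n} \<noteq> \<infinity>"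
    using assms by (auto simp: emeasure_count_space_finite)
  hence "prob_space (uniform_measure (count_space UNIV) {..<n})"
    by (rule prob_space_uniform_measure)
  hence "prob_space (orbital_measure f n x)"
    unfolding orbital_measure_def by (rule prob_space.prob_space_distr) (simp add: measurable_def)
  thus ?thesis
    by (simp add: borel_prob_measures_def orbital_measure_def)
qed

lemma weak_star_basic_open:
  fixes g :: "'a::topological_space \<Rightarrow> real"
  assumes "continuous_on UNIV g" "open V"
  shows "openin weak_star {\<nu> \<in> borel_prob_measures. (\<integral>x. g x \<partial>\<nu>) \<in> V}"
  unfolding weak_star_generated by (intro topology_generated_by_Basis weak_star_subbasisI assms)

text \<open>Induction over the generated topology: an intersection joins the two finite test
  families and takes the smaller tolerance, a union keeps those of one member, and a subbasic set
  tests a single function.\<close>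

lemma weak_star_nbhd:
  fixes J :: "'a::topological_space measure set"
  assumes "openin weak_star J" "\<nu> \<in> J"
  obtains Gs :: "('a \<Rightarrow> real) set" and \<rho> where "finite Gs" "\<rho> > 0" "\<And>g. g \<in> Gs \<Longrightarrow> continuous_on UNIV g"
    "\<And>\<zeta>. \<zeta> \<in> borel_prob_measures \<Longrightarrow> (\<And>g. g \<in> Gs \<Longrightarrow> \<bar>(\<integral>x. g x \<partial>\<zeta>) - (\<integral>x. g x \<partial>\<nu>)\<bar> < \<rho>) \<Longrightarrow> \<zeta> \<in> J"
proof -
  define good where "good J Gs \<rho> \<longleftrightarrow> finite Gs \<and> \<rho> > 0 \<and> (\<forall>g\<in>Gs. continuous_on UNIV g) \<and>
    (\<forall>\<zeta>\<in>borel_prob_measures. (\<forall>g\<in>Gs. \<bar>(\<integral>x. g x \<partial>\<zeta>) - (\<integral>x. g x \<partial>\<nu>)\<bar> < \<rho>) \<longrightarrow> \<zeta> \<in> J)"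
    for J and Gs :: "('a \<Rightarrow> real) set" and \<rho> :: real
  have "generate_topology_on weak_star_subbasis J"
    using assms(1) unfolding weak_star_generated by (rule openin_topology_generated_by)
  hence "\<nu> \<in> J \<Longrightarrow> \<exists>Gs \<rho>. good J Gs \<rho>"
  proof induction
    case Empty
    thus ?case by simp
  next
    case (Int a b)
    obtain G1 \<rho>1 where 1: "good a G1 \<rho>1" using Int.IH(1) Int.prems by auto
    obtain G2 \<rho>2 where 2: "good b G2 \<rho>2" using Int.IH(2) Int.prems by auto
    have "good (a \<inter> b) (G1 \<union> G2) (min \<rho>1 \<rho>2)"
      using 1 2 unfolding good_def by (auto simp: ball_Un)
    thus ?case by blast
  next
    case (UN K)
    then obtain k where k: "k \<in> K" "\<nu> \<in> k" by blast
    obtain G \<rho> where "good k G \<rho>" using UN.IH[OF k] by blast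
    hence "good (\<Union>K) G \<rho>" using k(1) unfolding good_def by blast
    thus ?case by blast
  next
    case (Basis s)
    obtain g :: "'a \<Rightarrow> real" and V where gV: "s = {\<nu> \<in> borel_prob_measures. (\<integral>x. g x \<partial>\<nu>) \<in> V}"
      "continuous_on UNIV g" "open V" by (rule weak_star_subbasisE[OF Basis.hyps])
    have "(\<integral>x. g x \<partial>\<nu>) \<in> V" using Basis.prems gV(1) by simp
    then obtain \<rho> where \<rho>: "\<rho> > 0" "\<And>t. \<bar>t - (\<integral>x. g x \<partial>\<nu>)\<bar> < \<rho> \<Longrightarrow> t \<in> V"
      using gV(3) unfolding open_dist dist_real_def by blast
    have "good s {g} \<rho>"
      unfolding good_def gV(1) using \<rho> gV(2) by simp
    thus ?case by blast
  qed
  then obtain Gs \<rho> where "good J Gs \<rho>" using assms(2) by blast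
  thus ?thesis using that[of Gs \<rho>] unfolding good_def by blast
qed

lemma funpow_continuous:
  fixes f :: "'a::topological_space \<Rightarrow> 'a"
  assumes "continuous_on UNIV f" shows "continuous_on UNIV (f ^^ n)"
  by (induction n) (auto intro: continuous_on_compose2[OF assms])

lemma birkhoff_sum_continuous:
  fixes f :: "'a::topological_space \<Rightarrow> 'a"
  assumes "continuous_on UNIV f" "continuous_on UNIV g"
  shows "continuous_on UNIV (birkhoff_sum f g n)"
proof -
  have "birkhoff_sum f g n = (\<lambda>y. \<Sum>i<n. g ((f ^^ i) y))"
    by (rule ext) (simp add: birkhoff_sum_def)
  thus ?thesis
    using continuous_on_compose2[OF assms(2) funpow_continuous[OF assms(1)]]
    by (simp add: continuous_on_sum)
qed

text \<open>Testing an orbital measure against a continuous function gives a Birkhoff average, which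
  is continuous in the starting point. This supplies the Borel measurability of the events being
  estimated.\<close>

lemma open_orbital_measure_vimage:
  fixes f :: "'a::metric_space \<Rightarrow> 'a"
  assumes f: "continuous_on UNIV f" and n: "n \<ge> 1" and J: "openin weak_star J"
  shows "open {y. orbital_measure f n y \<in> J}"
proof -
  have "continuous_map euclidean weak_star (orbital_measure f n)"
    unfolding weak_star_generated
  proof (rule continuous_on_generated_topo)
    fix U :: "'a measure set" assume "U \<in> weak_star_subbasis"
    then obtain g :: "'a \<Rightarrow> real" and V where U: "U = {\<nu> \<in> borel_prob_measures. (\<integral>x. g x \<partial>\<nu>) \<in> V}"
      "continuous_on UNIV g" "open V" by (rule weak_star_subbasisE)
    have gm: "g \<in> borel_measurable borel" by (rule borel_measurable_continuous_onI) fact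
    have "orbital_measure f n -` U \<inter> topspace euclidean = (\<lambda>y. birkhoff_sum f g n y / real n) -` V"
      using orbital_measure_in[OF n] integral_orbital_measure[OF n gm] by (auto simp: U(1))
    moreover have "open \<dots>"
      using U(3) birkhoff_sum_continuous[OF f U(2), of n] n
      by (intro continuous_open_vimage continuous_intros) (auto simp: continuous_on_eq_continuous_at)
    ultimately show "openin euclidean (orbital_measure f n -` U \<inter> topspace euclidean)" by simp
  next
    show "orbital_measure f n ` topspace euclidean \<subseteq> \<Union>weak_star_subbasis"
      using orbital_measure_in[OF n] unfolding Union_weak_star_subbasis by blast
  qed
  from openin_continuous_map_preimage[OF this J] show ?thesis by simp
qed

section \<open>Sums over words\<close>

lemma sum_lists_Suc:
  assumes "finite E"
  shows "(\<Sum>s\<in>{s. set s \<subseteq> E \<and> length s = Suc N}. g s)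
    = (\<Sum>a\<in>E. \<Sum>s\<in>{s. set s \<subseteq> E \<and> length s = N}. g (a # s))"
proof -
  have "(\<Sum>s\<in>{s. set s \<subseteq> E \<and> length s = Suc N}. g s)
      = (\<Sum>(s, a)\<in>{s. set s \<subseteq> E \<and> length s = N} \<times> E. g (a # s))"
    unfolding lists_length_Suc_eq by (subst sum.reindex) (auto simp: inj_on_def intro!: sum.cong)
  also have "\<dots> = (\<Sum>s\<in>{s. set s \<subseteq> E \<and> length s = N}. \<Sum>a\<in>E. g (a # s))"
    using assms by (simp add: sum.cartesian_product)
  finally show ?thesis by (simp only: sum.swap[of _ E])
qed

lemma sum_prod_list_words:
  fixes q :: "'b \<Rightarrow> real"
  assumes "finite E"
  shows "(\<Sum>s\<in>{s. set s \<subseteq> E \<and> length s = N}. prod_list (map q s)) = (\<Sum>a\<in>E. q a) ^ N"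
proof (induction N)
  case 0
  have "{s. set s \<subseteq> E \<and> length s = 0} = {[]}" by auto
  thus ?case by simp
next
  case (Suc N)
  have "(\<Sum>s\<in>{s. set s \<subseteq> E \<and> length s = Suc N}. prod_list (map q s))
      = (\<Sum>a\<in>E. q a * (\<Sum>s\<in>{s. set s \<subseteq> E \<and> length s = N}. prod_list (map q s)))"
    by (simp add: sum_lists_Suc[OF assms] sum_distrib_left)
  thus ?case by (simp add: Suc sum_distrib_right)
qed

text \<open>Letters are independent under the product weight, so the cross terms vanish for centred
  \<open>\<psi>\<close>. The vanishing mean is proved alongside because the expansion of the square
  uses it.\<close>

lemma variance_words:
  fixes p \<psi> :: "'b \<Rightarrow> real"
  assumes E: "finite E" and p: "(\<Sum>a\<in>E. p a) = 1" and \<psi>: "(\<Sum>a\<in>E. p a * \<psi> a) = 0"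
  shows "(\<Sum>s\<in>{s. set s \<subseteq> E \<and> length s = N}. prod_list (map p s) * sum_list (map \<psi> s)) = 0"
    and "(\<Sum>s\<in>{s. set s \<subseteq> E \<and> length s = N}. prod_list (map p s) * (sum_list (map \<psi> s))\<^sup>2)
      = real N * (\<Sum>a\<in>E. p a * (\<psi> a)\<^sup>2)"
proof (induction N)
  let ?L = "\<lambda>N. {s. set s \<subseteq> E \<and> length s = N}"
  let ?P = "\<lambda>s. prod_list (map p s)" and ?S = "\<lambda>s. sum_list (map \<psi> s)"
  case 0
  have L0: "?L 0 = {[]}" by auto
  { case 1 show ?case by (simp add: L0) }
  { case 2 show ?case by (simp add: L0) }
next
  let ?L = "\<lambda>N. {s. set s \<subseteq> E \<and> length s = N}"
  let ?P = "\<lambda>s. prod_list (map p s)" and ?S = "\<lambda>s. sum_list (map \<psi> s)"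
  case (Suc N)
  have P1: "(\<Sum>s\<in>?L N. ?P s) = 1"
    using sum_prod_list_words[OF E, of p N] p by simp
  { case 1
    have "(\<Sum>s\<in>?L (Suc N). ?P s * ?S s)
        = (\<Sum>a\<in>E. p a * \<psi> a * (\<Sum>s\<in>?L N. ?P s) + p a * (\<Sum>s\<in>?L N. ?P s * ?S s))"
      unfolding sum_lists_Suc[OF E]
      by (intro sum.cong refl) (simp add: sum_distrib_left sum.distrib[symmetric] algebra_simps)
    thus ?case using Suc.IH(1) \<psi> by (simp add: P1) }
  { case 2
    have "(\<Sum>s\<in>?L (Suc N). ?P s * (?S s)\<^sup>2)
        = (\<Sum>a\<in>E. p a * (\<psi> a)\<^sup>2 * (\<Sum>s\<in>?L N. ?P s) + 2 * (p a * \<psi> a) * (\<Sum>s\<in>?L N. ?P s * ?S s)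
            + p a * (\<Sum>s\<in>?L N. ?P s * (?S s)\<^sup>2))"
      unfolding sum_lists_Suc[OF E]
      by (intro sum.cong refl)
        (simp add: sum_distrib_left sum.distrib[symmetric] algebra_simps power2_eq_square)
    also have "\<dots> = (\<Sum>a\<in>E. p a * (\<psi> a)\<^sup>2) + (\<Sum>a\<in>E. p a) * (real N * (\<Sum>a\<in>E. p a * (\<psi> a)\<^sup>2))"
      by (simp add: P1 Suc.IH(1)) (simp add: Suc.IH(2) sum.distrib sum_distrib_right)
    finally show ?case by (simp add: p algebra_simps) }
qed

lemma sum_UN_le:
  fixes g :: "'b \<Rightarrow> real"
  assumes "finite I" "\<And>i. i \<in> I \<Longrightarrow> finite (A i)" "\<And>i x. i \<in> I \<Longrightarrow> x \<in> A i \<Longrightarrow> 0 \<le> g x"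
  shows "sum g (\<Union>i\<in>I. A i) \<le> (\<Sum>i\<in>I. sum g (A i))"
  using assms
proof (induction I)
  case (insert i I)
  have "0 \<le> sum g (A i \<inter> (\<Union>j\<in>I. A j))"
    using insert.prems(2) by (intro sum_nonneg) auto
  hence "sum g (A i \<union> (\<Union>j\<in>I. A j)) \<le> sum g (A i) + sum g (\<Union>j\<in>I. A j)"
    using insert by (subst sum_Un) auto
  also have "\<dots> \<le> sum g (A i) + (\<Sum>j\<in>I. sum g (A j))"
    by (intro add_left_mono insert.IH) (use insert.prems in auto)
  finally show ?case using insert.hyps by simp
qed simp

text \<open>Chebyshev's inequality for each of the finitely many \<open>\<phi>\<close>, followed by
  a union bound; \<open>N\<close> is taken so large that the exceptional words have total weight at
  most one half.\<close>

lemma weak_law_words: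
  fixes p :: "'b \<Rightarrow> real"
  assumes E: "finite E" and p: "(\<Sum>a\<in>E. p a) = 1" "\<And>a. a \<in> E \<Longrightarrow> 0 \<le> p a"
    and \<Phi>: "finite \<Phi>" and \<rho>: "\<rho> > 0"
  obtains N0 where "\<And>N. N \<ge> N0 \<Longrightarrow>
    1 / 2 \<le> (\<Sum>s | set s \<subseteq> E \<and> length s = N \<and>
      (\<forall>\<phi>\<in>\<Phi>. \<bar>sum_list (map \<phi> s) - real N * (\<Sum>a\<in>E. p a * \<phi> a)\<bar> \<le> real N * \<rho>). prod_list (map p s))"
proof -
  define mean where "mean \<phi> = (\<Sum>a\<in>E. p a * \<phi> a)" for \<phi>
  define V where "V \<phi> = (\<Sum>a\<in>E. p a * (\<phi> a - mean \<phi>)\<^sup>2)" for \<phi>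
  have V0: "0 \<le> V \<phi>" for \<phi> unfolding V_def using p(2) by (intro sum_nonneg) auto
  let ?L = "\<lambda>N. {s. set s \<subseteq> E \<and> length s = N}"
  let ?P = "\<lambda>s. prod_list (map p s)"
  have finL: "finite (?L N)" for N by (rule finite_lists_length_eq[OF E])
  have P0: "0 \<le> ?P s" if "set s \<subseteq> E" for s
    using that p(2) by (induction s) auto
  define bad where "bad N \<phi> = {s \<in> ?L N. \<bar>sum_list (map \<phi> s) - real N * mean \<phi>\<bar> > real N * \<rho>}" for N \<phi>
  have cheb: "(\<Sum>s\<in>bad N \<phi>. ?P s) \<le> V \<phi> / (real N * \<rho>\<^sup>2)" if N: "N \<ge> 1" for N \<phi>
  proof -
    define \<psi> where "\<psi> a = \<phi> a - mean \<phi>" for a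
    have \<psi>0: "(\<Sum>a\<in>E. p a * \<psi> a) = 0"
      using p(1) by (simp add: \<psi>_def right_diff_distrib sum_subtractf mean_def flip: sum_distrib_right)
    have S: "sum_list (map \<psi> s) = sum_list (map \<phi> s) - real (length s) * mean \<phi>" for s
      by (induction s) (simp_all add: \<psi>_def algebra_simps)
    have "(real N * \<rho>)\<^sup>2 * (\<Sum>s\<in>bad N \<phi>. ?P s) \<le> (\<Sum>s\<in>bad N \<phi>. ?P s * (sum_list (map \<psi> s))\<^sup>2)"
      unfolding sum_distrib_left
    proof (rule sum_mono)
      fix s assume s: "s \<in> bad N \<phi>"
      have "(real N * \<rho>)\<^sup>2 \<le> (sum_list (map \<psi> s))\<^sup>2"
        using s \<rho> by (simp add: bad_def S abs_le_square_iff[symmetric])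
      thus "(real N * \<rho>)\<^sup>2 * ?P s \<le> ?P s * (sum_list (map \<psi> s))\<^sup>2"
        using P0[of s] s by (subst mult.commute) (auto simp: bad_def intro: mult_left_mono)
    qed
    also have "\<dots> \<le> (\<Sum>s\<in>?L N. ?P s * (sum_list (map \<psi> s))\<^sup>2)"
      using finL P0 by (intro sum_mono2) (auto simp: bad_def)
    also have "\<dots> = real N * V \<phi>"
      unfolding variance_words(2)[OF E p(1) \<psi>0] by (simp add: V_def \<psi>_def)
    finally show ?thesis using N \<rho> by (simp add: field_simps power2_eq_square)
  qed
  obtain N0 :: nat where N0: "real N0 > 2 * (\<Sum>\<phi>\<in>\<Phi>. V \<phi>) / \<rho>\<^sup>2"
    using reals_Archimedean2 by blast
  have "1 / 2 \<le> (\<Sum>s | set s \<subseteq> E \<and> length s = N \<and>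
      (\<forall>\<phi>\<in>\<Phi>. \<bar>sum_list (map \<phi> s) - real N * (\<Sum>a\<in>E. p a * \<phi> a)\<bar> \<le> real N * \<rho>). ?P s)"
    (is "_ \<le> sum ?P ?G") if N: "N \<ge> N0 + 1" for N
  proof -
    have "?L N \<subseteq> ?G \<union> (\<Union>\<phi>\<in>\<Phi>. bad N \<phi>)"
      by (auto simp: bad_def mean_def not_le)
    moreover have finG: "finite ?G" "finite (\<Union>\<phi>\<in>\<Phi>. bad N \<phi>)"
      using finL[of N] \<Phi> by (auto intro: finite_subset[OF _ finL[of N]] simp: bad_def)
    ultimately have "(\<Sum>s\<in>?L N. ?P s) \<le> sum ?P (?G \<union> (\<Union>\<phi>\<in>\<Phi>. bad N \<phi>))"
      using P0 by (intro sum_mono2) (auto simp: bad_def)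
    also have "\<dots> \<le> sum ?P ?G + sum ?P (\<Union>\<phi>\<in>\<Phi>. bad N \<phi>)"
    proof -
      have "0 \<le> sum ?P (?G \<inter> (\<Union>\<phi>\<in>\<Phi>. bad N \<phi>))"
        using P0 by (intro sum_nonneg) auto
      thus ?thesis by (simp add: sum_Un finG)
    qed
    also have "sum ?P (\<Union>\<phi>\<in>\<Phi>. bad N \<phi>) \<le> (\<Sum>\<phi>\<in>\<Phi>. sum ?P (bad N \<phi>))"
      using P0 by (intro sum_UN_le \<Phi> finite_subset[OF _ finL[of N]]) (auto simp: bad_def)
    also have "\<dots> \<le> (\<Sum>\<phi>\<in>\<Phi>. V \<phi> / (real N * \<rho>\<^sup>2))"
      using N by (intro sum_mono cheb) simp
    also have "\<dots> = (\<Sum>\<phi>\<in>\<Phi>. V \<phi>) / (real N * \<rho>\<^sup>2)" by (simp add: sum_divide_distrib)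
    also have "\<dots> \<le> 1 / 2"
    proof -
      have "2 * (\<Sum>\<phi>\<in>\<Phi>. V \<phi>) / \<rho>\<^sup>2 \<le> real N" using N0 N by linarith
      thus ?thesis using N \<rho> by (simp add: field_simps)
    qed
    finally show ?thesis
      using sum_prod_list_words[OF E, of p N] p by simp
  qed
  thus ?thesis using that by blast
qed

section \<open>Fine labels and labels with null boundary\<close>

lemma separate_compact_closed_metric:
  fixes S T :: "'a::metric_space set"
  assumes "compact S" "closed T" "S \<inter> T = {}"
  obtains d where "d > 0" "\<And>x y. x \<in> S \<Longrightarrow> y \<in> T \<Longrightarrow> d < dist x y"
proof (cases "S = {} \<or> T = {}")
  case True
  thus ?thesis using that[of 1] by auto
next
  case False
  have "continuous_on S (\<lambda>x. infdist x T)" by (intro continuous_intros)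
  then obtain x0 where x0: "x0 \<in> S" "\<And>x. x \<in> S \<Longrightarrow> infdist x0 T \<le> infdist x T"
    using continuous_attains_inf[OF assms(1)] False by metis
  have pos: "infdist x0 T > 0"
    using infdist_pos_not_in_closed[OF assms(2)] False x0(1) assms(3) by blast
  have "infdist x0 T / 2 < dist x y" if "x \<in> S" "y \<in> T" for x y
    using x0(2)[OF that(1)] infdist_le[OF that(2), of x] pos by linarith
  thus ?thesis using that[of "infdist x0 T / 2"] pos by simp
qed

text \<open>Both come from \<open>ln s \<le> s - 1\<close>; writing
  \<open>ln t = 2 * ln (sqrt t)\<close> yields the square root. The first bound serves rare label
  values, the second a value of probability close to 1.\<close>

lemma mult_ln_bounds:
  fixes t :: real
  shows "0 \<le> t \<Longrightarrow> - (t * ln t) \<le> 2 * sqrt t" and "0 \<le> t \<Longrightarrow> - (t * ln t) \<le> 1 - t"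
proof -
  have aux: "- ln s \<le> 1 / s - 1" if "s > 0" for s :: real
    using ln_le_minus_one[of "1 / s"] that by (simp add: ln_div)
  show "- (t * ln t) \<le> 1 - t" if "0 \<le> t"
  proof (cases "t = 0")
    case False
    hence "t * (- ln t) \<le> t * (1 / t - 1)"
      using that aux[of t] by (intro mult_left_mono) auto
    also have "\<dots> = 1 - t" using False by (simp add: right_diff_distrib)
    finally show ?thesis by simp
  qed simp
  show "- (t * ln t) \<le> 2 * sqrt t" if "0 \<le> t"
  proof (cases "t = 0")
    case False
    hence t: "t > 0" using that by simp
    have "t * (- ln t) = 2 * (t * (- ln (sqrt t)))"
      using t by (simp add: ln_sqrt)
    also have "\<dots> \<le> 2 * (t * (1 / sqrt t))"
      using t aux[of "sqrt t"] by (intro mult_left_mono) auto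
    also have "t * (1 / sqrt t) = sqrt t" using t by (simp add: real_div_sqrt)
    finally show ?thesis by simp
  qed simp
qed

lemma (in prob_space) integral_simple_label:
  fixes h :: "'b \<Rightarrow> real"
  assumes F: "simple_function M F"
  shows "(\<integral>y. h (F y) \<partial>M) = (\<Sum>v\<in>F ` space M. measure M (F -` {v} \<inter> space M) * h v)"
    and "integrable M (\<lambda>y. h (F y))"
proof -
  have fin: "finite (F ` space M)" and ms: "v \<in> F ` space M \<Longrightarrow> F -` {v} \<inter> space M \<in> events" for v
    using F by (auto simp: simple_function_def)
  let ?g = "\<lambda>y. \<Sum>v\<in>F ` space M. h v * indicator (F -` {v} \<inter> space M) y"
  have eq: "h (F y) = ?g y" if "y \<in> space M" for y
  proof -
    have "?g y = (\<Sum>v\<in>F ` space M. if v = F y then h v else 0)"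
      using that by (intro sum.cong) (auto simp: indicator_def)
    also have "\<dots> = h (F y)" using that fin by simp
    finally show ?thesis by simp
  qed
  have int: "integrable M (\<lambda>y. h v * indicator (F -` {v} \<inter> space M) y)" if "v \<in> F ` space M" for v
    using ms[OF that] by (intro integrable_mult_right integrable_real_indicator)
      (auto simp: emeasure_eq_measure)
  have "(\<integral>y. h (F y) \<partial>M) = (\<integral>y. ?g y \<partial>M)"
    by (rule Bochner_Integration.integral_cong) (simp_all add: eq)
  also have "\<dots> = (\<Sum>v\<in>F ` space M. \<integral>y. h v * indicator (F -` {v} \<inter> space M) y \<partial>M)"
    by (rule Bochner_Integration.integral_sum) (rule int)
  also have "\<dots> = (\<Sum>v\<in>F ` space M. measure M (F -` {v} \<inter> space M) * h v)"
  proof (intro sum.cong refl)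
    fix v assume "v \<in> F ` space M"
    from ms[OF this] show "(\<integral>y. h v * indicator (F -` {v} \<inter> space M) y \<partial>M)
      = measure M (F -` {v} \<inter> space M) * h v" by simp
  qed
  finally show "(\<integral>y. h (F y) \<partial>M) = (\<Sum>v\<in>F ` space M. measure M (F -` {v} \<inter> space M) * h v)" .
  have "integrable M ?g" by (rule Bochner_Integration.integrable_sum) (rule int)
  thus "integrable M (\<lambda>y. h (F y))"
    by (rule Bochner_Integration.integrable_cong[THEN iffD2, rotated -1]) (simp_all add: eq)
qed

lemma (in prob_space) sum_measure_label:
  assumes F: "simple_function M F"
  shows "(\<Sum>v\<in>F ` space M. measure M (F -` {v} \<inter> space M)) = 1"
  using integral_simple_label(1)[OF F, of "\<lambda>_. 1"] prob_space by simp

context invariant_measure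
begin

text \<open>\<open>c'\<close> merges all cores into the single value \<open>None\<close> and shows
  the label only off the cores. When the cores are nearly full, one value dominates and the entropy
  of \<open>c'\<close> is small.\<close>

lemma simple_function_closed_core:
  assumes c: "simple_function \<nu> c" and B: "\<And>a. closed (B a)" "\<And>a. a \<in> range c \<Longrightarrow> B a \<subseteq> c -` {a}"
  defines "c' \<equiv> (\<lambda>y. if y \<in> B (c y) then None else Some (c y))"
  shows "simple_function \<nu> c'"
proof -
  have fin: "finite (range c)" using c by (simp add: simple_function_def)
  have ms: "c -` {a} \<in> sets borel" if "a \<in> range c" for a
    using c that by (auto simp: simple_function_def)
  have cB: "c y = a" if "y \<in> B a" "a \<in> range c" for y a
    using B(2)[OF that(2)] that(1) by auto
  have "range c' \<subseteq> insert None (Some ` range c)" by (auto simp: c'_def)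
  hence "finite (range c')" by (rule finite_subset) (use fin in simp)
  moreover have "c' -` {v} \<in> sets borel" if "v \<in> range c'" for v
  proof (cases v)
    case None
    have "c' -` {v} = (\<Union>a\<in>range c. B a)"
    proof (intro equalityI subsetI)
      fix y assume "y \<in> c' -` {v}"
      hence "y \<in> B (c y)" by (simp add: None c'_def split: if_splits)
      thus "y \<in> (\<Union>a\<in>range c. B a)" by blast
    next
      fix y assume "y \<in> (\<Union>a\<in>range c. B a)"
      then obtain a where a: "a \<in> range c" "y \<in> B a" by blast
      thus "y \<in> c' -` {v}" using cB[OF a(2,1)] by (simp add: None c'_def)
    qed
    also have "closed \<dots>" using fin B(1) by (intro closed_UN) auto
    finally show ?thesis by (simp add: borel_closed)
  next
    case (Some a)
    have a: "a \<in> range c" using that unfolding Some c'_def by (auto split: if_splits)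
    have "c' -` {v} = c -` {a} - B a"
      unfolding Some c'_def by (auto split: if_splits)
    thus ?thesis using ms[OF a] B(1)[of a] by (simp add: borel_closed sets.Diff)
  qed
  ultimately show ?thesis by (auto simp: simple_function_def)
qed

text \<open>Shrink the atoms of \<open>c\<close> to closed cores. A label \<open>F\<close> that resolves \<open>m\<close>-step orbits to a scale
  below the separation of the cores determines the \<open>c\<close>-word except at the rare visits outside
  the cores, which carry little entropy.\<close>

lemma label_entropy_fine_ge:
  assumes cpt: "compact (UNIV :: 'a set)" and c: "simple_function \<nu> c" and \<theta>: "\<theta> > 0"
  obtains \<epsilon> where "\<epsilon> > 0" "\<And>m (F :: 'a \<Rightarrow> 'a). simple_function \<nu> F \<Longrightarrow> m \<ge> 1 \<Longrightarrow>
    (\<And>y z i. F y = F z \<Longrightarrow> i < m \<Longrightarrow> dist ((f ^^ i) y) ((f ^^ i) z) \<le> \<epsilon>) \<Longrightarrow>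
    real m * (label_rate c - \<theta>) \<le> label_entropy \<nu> F"
proof -
  define k where "k = card (range c)"
  have fin: "finite (range c)" using c by (simp add: simple_function_def)
  have k: "k \<ge> 1" using fin by (simp add: k_def card_gt_0_iff Suc_leI)
  have ms: "c -` {a} \<in> sets borel" if "a \<in> range c" for a
    using c that by (auto simp: simple_function_def)
  \<comment> \<open>Makes \<open>3 * k * sqrt \<tau> \<le> \<theta>\<close>: the \<open>k\<close>
    revealed values cost at most \<open>2 * sqrt \<tau>\<close> each, and \<open>None\<close> costs
    at most their total mass, which is at most \<open>k * sqrt \<tau>\<close> because
    \<open>\<tau> \<le> 1\<close>.\<close>
  define \<tau> where "\<tau> = min 1 ((\<theta> / (3 * real k))\<^sup>2)"
  have \<tau>: "\<tau> > 0" "\<tau> \<le> 1" using \<theta> k by (auto simp: \<tau>_def)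
  have s\<tau>: "sqrt \<tau> \<le> \<theta> / (3 * real k)"
    unfolding \<tau>_def using \<theta> k by (intro real_le_lsqrt) auto
  have \<tau>s: "\<tau> \<le> sqrt \<tau>" using \<tau> by (intro real_le_rsqrt) (simp add: power2_eq_square mult_left_le)
  have "\<exists>B. closed B \<and> (a \<in> range c \<longrightarrow> B \<subseteq> c -` {a} \<and> measure \<nu> (c -` {a} - B) < \<tau>)" for a
  proof (cases "a \<in> range c")
    case True
    thus ?thesis
      using closed_inner_regular[OF finite_measure_axioms sets_eq ms[OF True] \<tau>(1)] by metis
  qed (auto intro: exI[of _ "{}"])
  then obtain B where B: "\<And>a. closed (B a)" "\<And>a. a \<in> range c \<Longrightarrow> B a \<subseteq> c -` {a}"
    "\<And>a. a \<in> range c \<Longrightarrow> measure \<nu> (c -` {a} - B a) < \<tau>"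
    by metis
  define c' where "c' y = (if y \<in> B (c y) then None else Some (c y))" for y
  have c': "simple_function \<nu> c'"
    unfolding c'_def by (rule simple_function_closed_core[OF c B(1,2)])
  have fin': "finite (range c')" using c' by (simp add: simple_function_def)
  have cB: "c y = a" if "y \<in> B a" "a \<in> range c" for y a
    using B(2)[OF that(2)] that(1) by auto
  have Hc': "label_entropy \<nu> c' \<le> \<theta>"
  proof -
    define p where "p v = measure \<nu> (c' -` {v})" for v
    have p0: "0 \<le> p v" for v by (simp add: p_def)
    have pS: "p (Some a) < \<tau>" if "a \<in> range c" for a
    proof -
      have "c' -` {Some a} = c -` {a} - B a"
        unfolding c'_def by (auto split: if_splits)
      thus ?thesis using B(3)[OF that] by (simp add: p_def)
    qed
    have sub: "range c' \<subseteq> insert None (Some ` range c)" by (auto simp: c'_def)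
    have p_out: "p v = 0" if "v \<notin> range c'" for v
    proof -
      have "c' -` {v} = {}" using that by auto
      thus ?thesis by (simp add: p_def)
    qed
    have total: "p None + (\<Sum>a\<in>range c. p (Some a)) = 1"
    proof -
      have "1 = (\<Sum>v\<in>range c'. p v)"
        using sum_measure_label[OF c'] by (simp add: p_def)
      also have "\<dots> = (\<Sum>v\<in>insert None (Some ` range c). p v)"
        using sub fin p_out by (intro sum.mono_neutral_left) auto
      also have "\<dots> = p None + (\<Sum>a\<in>range c. p (Some a))"
        using fin by (simp add: sum.reindex)
      finally show ?thesis by simp
    qed
    have "label_entropy \<nu> c' = (\<Sum>v\<in>range c'. - (p v * ln (p v)))"
      by (simp add: label_entropy_def p_def sum_negf)
    also have "\<dots> = (\<Sum>v\<in>insert None (Some ` range c). - (p v * ln (p v)))"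
      using sub fin p_out by (intro sum.mono_neutral_left) auto
    also have "\<dots> = - (p None * ln (p None)) + (\<Sum>a\<in>range c. - (p (Some a) * ln (p (Some a))))"
      using fin by (simp add: sum.reindex)
    also have "\<dots> \<le> (1 - p None) + (\<Sum>a\<in>range c. 2 * sqrt \<tau>)"
    proof (intro add_mono sum_mono mult_ln_bounds(2) p0)
      fix a assume a: "a \<in> range c"
      have "sqrt (p (Some a)) \<le> sqrt \<tau>" using pS[OF a] by simp
      thus "- (p (Some a) * ln (p (Some a))) \<le> 2 * sqrt \<tau>"
        using mult_ln_bounds(1)[OF p0[of "Some a"]] by linarith
    qed
    also have "1 - p None = (\<Sum>a\<in>range c. p (Some a))" using total by simp
    also have "(\<Sum>a\<in>range c. p (Some a)) \<le> (\<Sum>a\<in>range c. sqrt \<tau>)"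
      using less_imp_le[OF pS] \<tau>s by (intro sum_mono) (meson order_trans)
    also have "(\<Sum>a\<in>range c. sqrt \<tau>) + (\<Sum>a\<in>range c. 2 * sqrt \<tau>) = 3 * real k * sqrt \<tau>"
      by (simp add: k_def)
    also have "\<dots> \<le> 3 * real k * (\<theta> / (3 * real k))"
      using s\<tau> by (intro mult_left_mono) auto
    also have "\<dots> = \<theta>" using k by simp
    finally show ?thesis by simp
  qed
  have "\<exists>d>0. a \<noteq> b \<longrightarrow> (\<forall>x\<in>B a. \<forall>y\<in>B b. d < dist x y)" if "a \<in> range c" "b \<in> range c" for a b
  proof (cases "a = b")
    case False
    have "compact (B a)" using compact_Int_closed[OF cpt B(1)[of a]] by simp
    moreover have "B a \<inter> B b = {}"
      using cB[OF _ that(1)] cB[OF _ that(2)] False by (metis disjoint_iff)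
    ultimately show ?thesis using separate_compact_closed_metric[OF _ B(1)[of b], of "B a"] by metis
  qed (auto intro: exI[of _ 1])
  then obtain d where d: "\<And>a b. a \<in> range c \<Longrightarrow> b \<in> range c \<Longrightarrow> 0 < d a b"
    "\<And>a b x y. a \<in> range c \<Longrightarrow> b \<in> range c \<Longrightarrow> a \<noteq> b \<Longrightarrow> x \<in> B a \<Longrightarrow> y \<in> B b \<Longrightarrow> d a b < dist x y"
    by metis
  define \<epsilon> where "\<epsilon> = Min ((\<lambda>(a, b). d a b) ` (range c \<times> range c))"
  have \<epsilon>0: "\<epsilon> > 0"
    unfolding \<epsilon>_def using fin d(1) by (subst Min_gr_iff) auto
  have \<epsilon>: "\<epsilon> < dist x y" if "a \<in> range c" "b \<in> range c" "a \<noteq> b" "x \<in> B a" "y \<in> B b" for a b x y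
  proof -
    have "\<epsilon> \<le> d a b" unfolding \<epsilon>_def using fin that(1,2) by (intro Min_le) auto
    thus ?thesis using d(2)[OF that] by simp
  qed
  show ?thesis
  proof (rule that[OF \<epsilon>0])
    fix m and F :: "'a \<Rightarrow> 'a"
    assume F: "simple_function \<nu> F" and m: "m \<ge> 1"
      and res: "\<And>y z i. F y = F z \<Longrightarrow> i < m \<Longrightarrow> dist ((f ^^ i) y) ((f ^^ i) z) \<le> \<epsilon>"
    have w: "simple_function \<nu> (word f c' m)" by (rule simple_function_word[OF c'])
    have "real m * label_rate c \<le> label_entropy \<nu> (word f c m)"
      using label_rate(2)[OF c m] by (simp add: mult.commute)
    also have "\<dots> \<le> label_entropy \<nu> (\<lambda>y. (F y, word f c' m y))"
    proof (rule label_entropy_factor_le[OF simple_function_Pair[OF F w]])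
      fix y z assume eq: "(F y, word f c' m y) = (F z, word f c' m z)"
      have "c ((f ^^ i) y) = c ((f ^^ i) z)" if i: "i < m" for i
      proof (rule ccontr)
        \<comment> \<open>Equal values of \<open>c'\<close> with different labels can only be
          \<open>None\<close>: both points are in cores of different atoms, hence more than
          \<open>\<epsilon>\<close> apart, which contradicts the resolution of
          \<open>F\<close>.\<close>
        assume ne: "c ((f ^^ i) y) \<noteq> c ((f ^^ i) z)"
        have "c' ((f ^^ i) y) = c' ((f ^^ i) z)" using eq i by (simp add: word_eq_iff)
        hence "(f ^^ i) y \<in> B (c ((f ^^ i) y))" "(f ^^ i) z \<in> B (c ((f ^^ i) z))"
          using ne unfolding c'_def by (auto split: if_splits)
        from \<epsilon>[OF rangeI rangeI ne this] show False using res[of y z i] eq i by simp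
      qed
      thus "word f c m y = word f c m z" by (simp add: word_eq_iff)
    qed
    also have "\<dots> \<le> label_entropy \<nu> F + label_entropy \<nu> (word f c' m)"
      by (rule label_entropy_pair_le[OF F w])
    also have "label_entropy \<nu> (word f c' m) \<le> real m * \<theta>"
      using label_entropy_word_le[OF c', of m] Hc' mult_left_mono[OF Hc', of "real m"] by simp
    finally show "real m * (label_rate c - \<theta>) \<le> label_entropy \<nu> F"
      by (simp add: right_diff_distrib)
  qed
qed

text \<open>The law of the distance from \<open>x\<close> has at most countably many atoms, whereas
  the interval of radii is uncountable.\<close>

lemma null_sphere:
  assumes "a < b"
  obtains r where "a < r" "r < b" "measure \<nu> {y. dist x y = r} = 0"
proof -
  have m: "(\<lambda>y. dist x y) \<in> borel_measurable \<nu>"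
    by (simp add: borel_measurable_continuous_onI continuous_intros cong: measurable_cong_sets)
  interpret D: finite_measure "distr \<nu> borel (\<lambda>y. dist x y)"
    by (rule finite_measure_distr[OF m])
  have "uncountable {a<..<b}" using assms by (simp add: uncountable_open_interval)
  moreover have "countable {r. measure (distr \<nu> borel (\<lambda>y. dist x y)) {r} \<noteq> 0}"
    by (rule D.countable_support)
  ultimately have "\<not> {a<..<b} \<subseteq> {r. measure (distr \<nu> borel (\<lambda>y. dist x y)) {r} \<noteq> 0}"
    using countable_subset by blast
  then obtain r where "r \<in> {a<..<b}" "r \<notin> {r. measure (distr \<nu> borel (\<lambda>y. dist x y)) {r} \<noteq> 0}"
    unfolding subset_iff by blast
  hence r: "a < r" "r < b" "measure (distr \<nu> borel (\<lambda>y. dist x y)) {r} = 0"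
    by simp_all
  moreover have "(\<lambda>y. dist x y) -` {r} = {y. dist x y = r}" by auto
  ultimately show ?thesis
    using that[of r] measure_distr[OF m, of "{r}"] by simp
qed

text \<open>The first covering set containing a point turns a cover into a partition. The last
  conclusion says that only the membership pattern matters, which is how local constancy off the
  boundaries is obtained.\<close>

lemma first_index_label:
  assumes Q: "\<And>i. i < k \<Longrightarrow> Q i \<in> sets borel" "UNIV \<subseteq> (\<Union>i<k. Q i)"
  obtains c :: "'a \<Rightarrow> nat" where "simple_function \<nu> c" "\<And>y. c y < k" "\<And>y. y \<in> Q (c y)"
    "\<And>y z. (\<And>i. i < k \<Longrightarrow> y \<in> Q i \<longleftrightarrow> z \<in> Q i) \<Longrightarrow> c y = c z"
proof -
  define R where "R i y \<longleftrightarrow> i < k \<and> y \<in> Q i" for i y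
  define c where "c y = (LEAST i. R i y)" for y
  have "\<exists>i. R i y" for y using Q(2) by (auto simp: R_def)
  hence Rc: "R (c y) y" for y unfolding c_def by (rule LeastI_ex)
  have RS: "{y. R i y} \<in> sets borel" for i
    using Q(1) by (cases "i < k") (simp_all add: R_def)
  have "c -` {v} \<in> sets borel" for v
  proof -
    have "c y = v \<longleftrightarrow> R v y \<and> (\<forall>i<v. \<not> R i y)" for y
      using Rc[of y] not_less_Least[of _ "\<lambda>i. R i y"] Least_le[of "\<lambda>i. R i y"]
      unfolding c_def by (metis linorder_neqE_nat)
    hence "c -` {v} = {y. R v y} - (\<Union>i<v. {y. R i y})" by auto
    also have "\<dots> \<in> sets borel"
      using RS by (intro sets.Diff sets.finite_UN) auto
    finally show ?thesis .
  qed
  moreover have "range c \<subseteq> {..<k}" using Rc by (auto simp: R_def)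
  hence "finite (range c)" by (rule finite_subset) simp
  ultimately have "simple_function \<nu> c" by (auto simp: simple_function_def)
  moreover have "c y < k" "y \<in> Q (c y)" for y using Rc[of y] by (simp_all add: R_def)
  moreover have "c y = c z" if "\<And>i. i < k \<Longrightarrow> y \<in> Q i \<longleftrightarrow> z \<in> Q i" for y z
    unfolding c_def R_def using that by metis
  ultimately show ?thesis by (rule that)
qed

text \<open>A finite cover by small balls with null bounding spheres is turned into a partition by
  first index. \<open>D\<close> collects the spheres; off \<open>D\<close>, membership in each ball
  is locally constant.\<close>

lemma small_null_boundary_label:
  assumes cpt: "compact (UNIV :: 'a set)" and \<epsilon>: "\<epsilon> > 0"
  obtains c :: "'a \<Rightarrow> nat" and D where "simple_function \<nu> c" "closed D" "measure \<nu> D = 0"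
    "\<And>y z. c y = c z \<Longrightarrow> dist y z \<le> \<epsilon>"
    "\<And>y. y \<notin> D \<Longrightarrow> \<exists>U. open U \<and> y \<in> U \<and> (\<forall>z\<in>U. c z = c y)"
proof -
  have "\<exists>r>0. r < \<epsilon> / 2 \<and> measure \<nu> {y. dist x y = r} = 0" for x
    using null_sphere[of 0 "\<epsilon> / 2" x] \<epsilon> by (metis half_gt_zero)
  then obtain r where r: "\<And>x. r x > 0" "\<And>x. r x < \<epsilon> / 2" "\<And>x. measure \<nu> {y. dist x y = r x} = 0"
    by metis
  have cover: "UNIV \<subseteq> (\<Union>x\<in>UNIV. ball x (r x))"
  proof
    fix t
    have "t \<in> ball t (r t)" using r(1) by simp
    thus "t \<in> (\<Union>x\<in>UNIV. ball x (r x))" by blast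
  qed
  obtain T where T: "finite T" "UNIV \<subseteq> (\<Union>x\<in>T. ball x (r x))"
    by (rule compactE_image[OF cpt _ cover]) auto
  obtain xs where xs: "set xs = T" using finite_list[OF T(1)] by blast
  define Q where "Q i = ball (xs ! i) (r (xs ! i))" for i
  have "T = (\<lambda>i. xs ! i) ` {..<length xs}"
    unfolding xs[symmetric] by (auto simp: in_set_conv_nth)
  hence Qcov: "UNIV \<subseteq> (\<Union>i<length xs. Q i)" using T(2) by (simp add: Q_def image_image)
  obtain c :: "'a \<Rightarrow> nat" where c: "simple_function \<nu> c" "\<And>y. c y < length xs" "\<And>y. y \<in> Q (c y)"
    "\<And>y z. (\<And>i. i < length xs \<Longrightarrow> y \<in> Q i \<longleftrightarrow> z \<in> Q i) \<Longrightarrow> c y = c z"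
    using first_index_label[OF _ Qcov] by (metis Q_def borel_open open_ball)
  define D where "D = (\<Union>i<length xs. {y. dist (xs ! i) y = r (xs ! i)})"
  have cl: "closed {y. dist (xs ! i) y = r (xs ! i)}" for i
    by (intro closed_Collect_eq continuous_intros)
  have "closed D"
    unfolding D_def by (intro closed_UN) (simp_all add: cl)
  have "measure \<nu> D \<le> (\<Sum>i<length xs. measure \<nu> {y. dist (xs ! i) y = r (xs ! i)})"
    unfolding D_def
    by (intro finite_measure_subadditive_finite)
      (simp_all add: image_subset_iff borel_closed cl)
  also have "\<dots> = 0" by (simp add: r(3))
  finally have "measure \<nu> D = 0" by (simp add: measure_le_0_iff)
  have "dist y z \<le> \<epsilon>" if "c y = c z" for y z
  proof -
    have "dist (xs ! c y) y < \<epsilon> / 2" "dist (xs ! c y) z < \<epsilon> / 2"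
      using c(3)[of y] c(3)[of z] r(2)[of "xs ! c y"] that by (auto simp: Q_def)
    thus ?thesis by metric
  qed
  moreover have "\<exists>U. open U \<and> y \<in> U \<and> (\<forall>z\<in>U. c z = c y)" if y: "y \<notin> D" for y
  proof -
    define V where "V i = (if y \<in> Q i then Q i else {z. r (xs ! i) < dist (xs ! i) z})" for i
    have "open (V i)" for i
      unfolding V_def Q_def by (auto intro!: open_Collect_less continuous_intros)
    hence "open (\<Inter>i<length xs. V i)" by (intro open_INT) auto
    moreover have "y \<in> (\<Inter>i<length xs. V i)"
      using y by (auto simp: V_def Q_def D_def not_less less_le)
    moreover have "c z = c y" if "z \<in> (\<Inter>i<length xs. V i)" for z
    proof (rule c(4))
      fix i assume "i < length xs"
      hence "z \<in> V i" using that by blast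
      thus "z \<in> Q i \<longleftrightarrow> y \<in> Q i" by (auto simp: V_def Q_def split: if_splits)
    qed
    ultimately show ?thesis by blast
  qed
  ultimately show ?thesis
    using that[of c D] c(1) \<open>closed D\<close> \<open>measure \<nu> D = 0\<close> by blast
qed

text \<open>\<open>\<phi>'\<close> interpolates between the bound \<open>L\<close> and
  \<open>\<phi>\<close> with a continuous weight \<open>u k\<close> that vanishes on
  \<open>D\<close>. It is continuous off \<open>D\<close> because \<open>\<phi>\<close> is locally
  constant there, and on \<open>D\<close> because \<open>\<phi> - L\<close> is bounded and the
  weight tends to 0. The excess is at most \<open>L * (1 - u k)\<close>, of small integral since
  \<open>D\<close> is null.\<close>

lemma continuous_majorant:
  fixes \<phi> :: "'a \<Rightarrow> real"
  assumes D: "closed D" "measure \<nu> D = 0"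
    and \<phi>: "\<And>y. 0 \<le> \<phi> y" "\<And>y. \<phi> y \<le> L" "integrable \<nu> \<phi>"
    and loc: "\<And>y. y \<notin> D \<Longrightarrow> \<exists>U. open U \<and> y \<in> U \<and> (\<forall>z\<in>U. \<phi> z = \<phi> y)"
    and \<eta>: "\<eta> > 0"
  obtains \<phi>' where "continuous_on UNIV \<phi>'" "\<And>y. \<phi> y \<le> \<phi>' y" "(\<integral>y. \<phi>' y \<partial>\<nu>) < (\<integral>y. \<phi> y \<partial>\<nu>) + \<eta>"
proof -
  have L0: "0 \<le> L" using \<phi>(1,2)[of undefined] by linarith
  obtain u :: "nat \<Rightarrow> 'a \<Rightarrow> real" where u:
    "\<And>k. continuous_on UNIV (u k)" "\<And>k y. 0 \<le> u k y" "\<And>k y. u k y \<le> indicator (- D) y"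
    "\<And>y. (\<lambda>k. u k y) \<longlonglongrightarrow> indicator (- D) y"
    using open_approx[of "- D"] D(1) by (metis open_Compl)
  have u1: "u k y \<le> 1" for k y by (rule order_trans[OF u(3) indicator_le_1])
  have uint: "integrable \<nu> (u k)" for k
    using u(2)[of k] u1[of k] borel_measurable_continuous_onI[OF u(1)[of k]]
    by (intro integrable_const_bound[where B=1]) (auto cong: measurable_cong_sets)
  have "(\<lambda>k. \<integral>y. u k y \<partial>\<nu>) \<longlonglongrightarrow> measure \<nu> (- D)"
    by (intro integral_open_approx finite_measure_axioms sets_eq u open_Compl D)
  also have "measure \<nu> (- D) = 1"
    using prob_compl[of D] D by (simp add: Compl_eq_Diff_UNIV)
  finally have "eventually (\<lambda>k. (\<integral>y. u k y \<partial>\<nu>) > 1 - \<eta> / (L + 1)) sequentially"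
    using \<eta> L0 by (intro order_tendstoD) auto
  then obtain k where k: "(\<integral>y. u k y \<partial>\<nu>) > 1 - \<eta> / (L + 1)" by (auto simp: eventually_sequentially)
  define \<phi>' where "\<phi>' y = L + (\<phi> y - L) * u k y" for y
  have "continuous_on UNIV (\<lambda>y. (\<phi> y - L) * u k y)"
  proof (rule continuous_at_imp_continuous_on, rule ballI)
    fix y
    have uk: "u k \<midarrow>y\<rightarrow> u k y"
      using u(1)[of k] by (simp add: continuous_on_eq_continuous_at isCont_def)
    show "isCont (\<lambda>y. (\<phi> y - L) * u k y) y"
    proof (cases "y \<in> D")
      case True
      hence z: "u k y = 0" using u(2,3)[of k y] by simp
      have "(\<lambda>z. (\<phi> z - L) * u k z) \<midarrow>y\<rightarrow> 0"
      proof (rule Lim_null_comparison)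
        show "\<forall>\<^sub>F z in at y. norm ((\<phi> z - L) * u k z) \<le> L * u k z"
        proof (rule always_eventually, rule allI)
          fix z
          have "\<bar>\<phi> z - L\<bar> \<le> L" using \<phi>(1,2)[of z] by linarith
          thus "norm ((\<phi> z - L) * u k z) \<le> L * u k z"
            using u(2)[of k z] by (simp add: abs_mult mult_right_mono)
        qed
        show "(\<lambda>z. L * u k z) \<midarrow>y\<rightarrow> 0"
          using tendsto_mult_left[OF uk, of L] z by simp
      qed
      thus ?thesis by (simp add: isCont_def z)
    next
      case False
      then obtain U where U: "open U" "y \<in> U" "\<And>z. z \<in> U \<Longrightarrow> \<phi> z = \<phi> y" using loc[OF False] by blast
      have "(\<lambda>z. (\<phi> y - L) * u k z) \<midarrow>y\<rightarrow> (\<phi> y - L) * u k y"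
        by (intro tendsto_intros uk)
      moreover have "\<forall>\<^sub>F z in at y. (\<phi> y - L) * u k z = (\<phi> z - L) * u k z"
        unfolding eventually_at_topological
      proof (intro exI[of _ U] conjI ballI impI U(1,2))
        fix z assume "z \<in> U"
        from U(3)[OF this] show "(\<phi> y - L) * u k z = (\<phi> z - L) * u k z" by simp
      qed
      ultimately have "(\<lambda>z. (\<phi> z - L) * u k z) \<midarrow>y\<rightarrow> (\<phi> y - L) * u k y"
        by (rule Lim_transform_eventually)
      thus ?thesis by (simp add: isCont_def)
    qed
  qed
  hence cont: "continuous_on UNIV \<phi>'"
    unfolding \<phi>'_def[abs_def] by (rule continuous_on_add[OF continuous_on_const])
  have ge: "\<phi> y \<le> \<phi>' y" for y
  proof -
    have "0 \<le> (L - \<phi> y) * (1 - u k y)"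
      using \<phi>(2)[of y] u1[of k y] by simp
    thus ?thesis by (simp add: \<phi>'_def algebra_simps)
  qed
  have le: "\<phi>' y \<le> \<phi> y + L * (1 - u k y)" for y
  proof -
    have "0 \<le> \<phi> y * (1 - u k y)" using \<phi>(1)[of y] u1[of k y] by simp
    thus ?thesis by (simp add: \<phi>'_def algebra_simps)
  qed
  have bd: "0 \<le> \<phi>' y" "\<phi>' y \<le> 2 * L" for y
  proof -
    have "L * (1 - u k y) \<le> L * 1" using L0 u(2)[of k y] by (intro mult_left_mono) auto
    thus "\<phi>' y \<le> 2 * L" using le[of y] \<phi>(2)[of y] by simp
    show "0 \<le> \<phi>' y" using ge[of y] \<phi>(1)[of y] by simp
  qed
  have int': "integrable \<nu> \<phi>'"
    using bd borel_measurable_continuous_onI[OF cont]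
    by (intro integrable_const_bound[where B="2 * L"]) (auto cong: measurable_cong_sets)
  have "(\<integral>y. \<phi>' y \<partial>\<nu>) \<le> (\<integral>y. \<phi> y + L * (1 - u k y) \<partial>\<nu>)"
    using int' \<phi>(3) uint le by (intro integral_mono) auto
  also have "\<dots> = (\<integral>y. \<phi> y \<partial>\<nu>) + L * (1 - (\<integral>y. u k y \<partial>\<nu>))"
    using \<phi>(3) uint[of k] prob_space by simp
  also have "L * (1 - (\<integral>y. u k y \<partial>\<nu>)) < \<eta>"
  proof -
    have "L * (1 - (\<integral>y. u k y \<partial>\<nu>)) \<le> L * (\<eta> / (L + 1))"
      using k L0 by (intro mult_left_mono) auto
    also have "\<dots> < \<eta>" using L0 \<eta> by (simp add: field_simps)
    finally show ?thesis .
  qed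
  finally show ?thesis using that[OF cont ge] by simp
qed

end

section \<open>Counting separated orbits\<close>

lemma word_mult:
  "word f c (J * m) y = concat (map (\<lambda>j. word f c m ((f ^^ (j * m)) y)) [0..<J])"
proof (induction J)
  case (Suc J)
  have "word f c (Suc J * m) y = word f c (J * m + m) y" by (simp add: add.commute)
  also have "\<dots> = word f c (J * m) y @ word f c m ((f ^^ (J * m)) y)" by (rule word_add)
  finally show ?case by (simp add: Suc)
qed simp

lemma word_blocks:
  "word f c (t + J * m + u) y = word f c t y
    @ concat (map (\<lambda>j. word f c m ((f ^^ (t + j * m)) y)) [0..<J]) @ word f c u ((f ^^ (t + J * m)) y)"
proof -
  have "(f ^^ (j * m)) ((f ^^ t) y) = (f ^^ (t + j * m)) y" for j
    by (simp add: add.commute[of t] funpow_add)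
  moreover have "word f c (t + J * m + u) y
      = (word f c t y @ word f c (J * m) ((f ^^ t) y)) @ word f c u ((f ^^ (t + J * m)) y)"
    by (simp only: word_add)
  ultimately show ?thesis by (simp add: word_mult)
qed

text \<open>The weights \<open>q\<close> of the consecutive \<open>m\<close>-blocks starting at residue \<open>t\<close> have total mass at most
  \<open>1\<close>. Averaging over the \<open>m\<close> residues, every orbit has a residue along which the product of its
  weights is at least \<open>exp (- B / m)\<close>.\<close>

lemma card_words_le:
  fixes q :: "'b list \<Rightarrow> real" and c :: "'a \<Rightarrow> 'b"
  assumes A: "finite A" "range c \<subseteq> A" and m: "m \<ge> 1" and n: "n \<ge> m"
  defines "W \<equiv> {w. set w \<subseteq> A \<and> length w = m}"
  assumes q: "\<And>w. w \<in> W \<Longrightarrow> 0 < q w" "(\<Sum>w\<in>W. q w) = 1"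
    and E: "finite E" "inj_on (word f c n) E"
    and B: "\<And>e. e \<in> E \<Longrightarrow> (\<Sum>i<n. - ln (q (word f c m ((f ^^ i) e)))) \<le> B"
  shows "real (card E) \<le> real m * real (card A) ^ (3 * m) * exp (B / real m)"
proof -
  \<comment> \<open>One block fewer than \<open>n div m\<close>, so that \<open>J\<close> blocks fit
    into length \<open>n\<close> from every residue \<open>t < m\<close>.\<close>
  define J where "J = n div m - 1"
  have "n div m \<ge> 1" using n m by (simp add: div_greater_zero_iff Suc_leI)
  hence nJ: "n = J * m + m + n mod m" by (simp add: J_def diff_mult_distrib)
  have finW: "finite W" unfolding W_def by (rule finite_lists_length_eq[OF A(1)])
  have "A \<noteq> {}" using A(2) by auto
  hence kA: "card A \<ge> 1" using A(1) by (simp add: card_gt_0_iff Suc_leI)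
  define b where "b i e = word f c m ((f ^^ i) e)" for i e
  have bW: "b i e \<in> W" for i e
    using set_word_subset[of f c m] A(2) by (auto simp: b_def W_def)
  have q1: "q w \<le> 1" if "w \<in> W" for w
    using member_le_sum[OF that, of q] q finW less_imp_le by auto
  define \<phi> where "\<phi> i e = - ln (q (b i e))" for i e
  have \<phi>0: "0 \<le> \<phi> i e" for i e
    using q1[OF bW] q(1)[OF bW] by (simp add: \<phi>_def)
  define S where "S t e = (\<Sum>j<J. \<phi> (t + j * m) e)" for t e
  have Ssum: "(\<Sum>t<m. S t e) \<le> (\<Sum>i<n. \<phi> i e)" for e
  proof -
    have "(\<Sum>t<m. S t e) = (\<Sum>(t, j)\<in>{..<m} \<times> {..<J}. \<phi> (t + j * m) e)"
      unfolding S_def by (simp add: sum.cartesian_product)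
    also have "\<dots> = (\<Sum>i\<in>(\<lambda>(t, j). t + j * m) ` ({..<m} \<times> {..<J}). \<phi> i e)"
    proof (subst sum.reindex)
      show "inj_on (\<lambda>(t, j). t + j * m) ({..<m} \<times> {..<J})"
      proof (rule inj_onI, clarsimp)
        fix t j t' j' assume "t < m" "t' < m" and eq: "t + j * m = t' + j' * m"
        have "t = (t + j * m) mod m" using \<open>t < m\<close> by simp
        also have "\<dots> = (t' + j' * m) mod m" by (simp only: eq)
        also have "\<dots> = t'" using \<open>t' < m\<close> by simp
        finally have "t = t'" .
        thus "t = t' \<and> j = j'" using eq m by simp
      qed
    qed (simp add: case_prod_unfold)
    also have "\<dots> \<le> (\<Sum>i<n. \<phi> i e)"
    proof (rule sum_mono2)
      show "(\<lambda>(t, j). t + j * m) ` ({..<m} \<times> {..<J}) \<subseteq> {..<n}"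
      proof clarsimp
        fix t j assume "t < m" "j < J"
        hence "j * m \<le> J * m" by simp
        thus "t + j * m < n" using \<open>t < m\<close> nJ by linarith
      qed
    qed (use \<phi>0 in auto)
    finally show ?thesis .
  qed
  have "\<exists>t<m. S t e \<le> B / real m" if "e \<in> E" for e
  proof (rule ccontr)
    assume "\<not> ?thesis"
    hence "\<And>t. t \<in> {..<m} \<Longrightarrow> B / real m < S t e" by (auto simp: not_le)
    hence "(\<Sum>t<m. B / real m) < (\<Sum>t<m. S t e)"
      using m by (intro sum_strict_mono) (auto simp: lessThan_empty_iff)
    also have "\<dots> \<le> B" using Ssum[of e] B[OF that] by (simp add: \<phi>_def b_def)
    finally show False using m by simp
  qed
  then obtain res where res: "\<And>e. e \<in> E \<Longrightarrow> res e < m" "\<And>e. e \<in> E \<Longrightarrow> S (res e) e \<le> B / real m"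
    by metis
  have per_res: "real (card {e \<in> E. res e = t}) \<le> real (card A) ^ (3 * m) * exp (B / real m)" if t: "t < m" for t
  proof -
    define Et where "Et = {e \<in> E. res e = t}"
    define u where "u = n - (t + J * m)"
    have nu: "n = t + J * m + u" using nJ t by (simp add: u_def)
    \<comment> \<open>The letters before and after the complete blocks are counted trivially; their
      number is bounded independently of \<open>n\<close>, so they only affect the
      prefactor.\<close>
    have u2: "u + t \<le> 3 * m"
    proof -
      have "n mod m < m" using m by simp
      thus ?thesis using nJ nu t by linarith
    qed
    define L where "L k = {w. set w \<subseteq> A \<and> length w = k}" for k
    define BL where "BL = {bs. set bs \<subseteq> W \<and> length bs = J}"
    have finL: "finite (L k)" for k unfolding L_def by (rule finite_lists_length_eq[OF A(1)])
    have finBL: "finite BL" unfolding BL_def by (rule finite_lists_length_eq[OF finW])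
    have cL: "card (L k) = card A ^ k" for k unfolding L_def by (rule card_lists_length_eq[OF A(1)])
    define enc where "enc e = (word f c t e, map (\<lambda>j. b (t + j * m) e) [0..<J], word f c u ((f ^^ (t + J * m)) e))" for e
    have inj: "inj_on enc Et"
    proof (rule inj_onI)
      fix e e' assume e: "e \<in> Et" "e' \<in> Et" "enc e = enc e'"
      hence "word f c n e = word f c n e'"
        unfolding nu word_blocks enc_def b_def prod.inject by (simp only:)
      thus "e = e'" using E(2) e by (auto simp: Et_def dest: inj_onD)
    qed
    have encin: "enc ` Et \<subseteq> L t \<times> BL \<times> L u"
      using set_word_subset[of f c] A(2) bW by (auto simp: enc_def L_def BL_def) blast+
    define g where "g x = prod_list (map q (fst (snd x)))" for x :: "'b list \<times> 'b list list \<times> 'b list"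
    have g0: "0 \<le> g x" if "x \<in> L t \<times> BL \<times> L u" for x
    proof -
      have "0 \<le> prod_list (map q bs)" if "set bs \<subseteq> W" for bs
        using that by (induction bs) (auto intro!: mult_nonneg_nonneg less_imp_le[OF q(1)])
      thus ?thesis using that by (auto simp: g_def BL_def)
    qed
    have genc: "g (enc e) = exp (- S t e)" for e
    proof -
      have "prod_list (map q (map (\<lambda>j. b (t + j * m) e) [0..<J'])) = exp (- (\<Sum>j<J'. \<phi> (t + j * m) e))" for J'
        using q(1)[OF bW] by (induction J') (simp_all add: \<phi>_def exp_diff exp_minus exp_add field_simps)
      thus ?thesis by (simp add: g_def enc_def S_def)
    qed
    have "real (card Et) * exp (- (B / real m)) = (\<Sum>e\<in>Et. exp (- (B / real m)))" by simp
    also have "\<dots> \<le> (\<Sum>e\<in>Et. g (enc e))"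
      unfolding genc using res(2) by (intro sum_mono) (auto simp: Et_def)
    also have "\<dots> = (\<Sum>x\<in>enc ` Et. g x)" by (simp add: sum.reindex[OF inj])
    also have "\<dots> \<le> (\<Sum>x\<in>L t \<times> BL \<times> L u. g x)"
      using encin finL finBL g0 by (intro sum_mono2) auto
    also have "\<dots> = (\<Sum>a\<in>L t. \<Sum>bs\<in>BL. \<Sum>d\<in>L u. prod_list (map q bs))"
      unfolding sum.cartesian_product by (simp add: g_def case_prod_unfold)
    also have "\<dots> = real (card (L t)) * (real (card (L u)) * (\<Sum>bs\<in>BL. prod_list (map q bs)))"
      by (simp add: sum_distrib_left)
    also have "(\<Sum>bs\<in>BL. prod_list (map q bs)) = 1"
      unfolding BL_def sum_prod_list_words[OF finW] by (simp add: q(2))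
    also have "real (card (L t)) * (real (card (L u)) * 1) = real (card A) ^ (u + t)"
      by (simp add: cL power_add)
    also have "\<dots> \<le> real (card A) ^ (3 * m)"
      using kA by (intro power_increasing u2) simp
    finally have "real (card Et) * exp (- (B / real m)) \<le> real (card A) ^ (3 * m)" .
    thus ?thesis by (simp add: Et_def exp_minus field_simps)
  qed
  have "card E \<le> card (\<Union>t<m. {e \<in> E. res e = t})"
    using res(1) E(1) by (intro card_mono) auto
  also have "\<dots> \<le> (\<Sum>t<m. card {e \<in> E. res e = t})"
    by (rule card_UN_le) simp
  finally have "real (card E) \<le> (\<Sum>t<m. real (card {e \<in> E. res e = t}))"
    by (metis of_nat_le_iff of_nat_sum)
  also have "\<dots> \<le> (\<Sum>t<m. real (card A) ^ (3 * m) * exp (B / real m))"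
    by (intro sum_mono per_res) simp
  finally show ?thesis by simp
qed

context invariant_measure
begin

text \<open>Labels of diameter at most \<open>\<epsilon>\<close> give separated orbits distinct
  words, so it suffices to count words. \<open>\<phi>\<close> majorises the negative logarithm of
  the weight of the next \<open>m\<close>-block; the inequality on its Birkhoff sum is exactly the
  hypothesis of \<open>card_words_le\<close>.\<close>

lemma count_separated:
  assumes cpt: "compact (UNIV :: 'a set)" and f: "continuous_on UNIV f"
    and r: "ms_entropy f \<nu> < ereal r" and \<epsilon>: "\<epsilon> > 0"
  obtains \<phi> s N where "continuous_on UNIV \<phi>" "(\<integral>y. \<phi> y \<partial>\<nu>) < s"
    "\<And>n E. n \<ge> N \<Longrightarrow> finite E \<Longrightarrow> separated_set f n \<epsilon> E \<Longrightarrow>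
      (\<And>e. e \<in> E \<Longrightarrow> birkhoff_sum f \<phi> n e \<le> real n * s) \<Longrightarrow> real (card E) \<le> exp (real n * r)"
proof -
  obtain c :: "'a \<Rightarrow> nat" and D where c: "simple_function \<nu> c" and D: "closed D" "measure \<nu> D = 0"
    and small: "\<And>y z. c y = c z \<Longrightarrow> dist y z \<le> \<epsilon>"
    and loc: "\<And>y. y \<notin> D \<Longrightarrow> \<exists>U. open U \<and> y \<in> U \<and> (\<forall>z\<in>U. c z = c y)"
    using small_null_boundary_label[OF cpt \<epsilon>] by metis
  have "label_rate c < r"
    using label_rate_le_ms_entropy[OF c] r by (metis le_less_trans less_ereal.simps(1))
  then obtain r1 where r1: "label_rate c < r1" "r1 < r" using dense by blast
  have "eventually (\<lambda>m. label_entropy \<nu> (word f c m) / real m < r1) sequentially"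
    using label_rate(1)[OF c] r1(1) by (rule order_tendstoD)
  hence "eventually (\<lambda>m. label_entropy \<nu> (word f c m) / real m < r1 \<and> m \<ge> 1) sequentially"
    using eventually_ge_at_top by (rule eventually_conj)
  then obtain m where m: "label_entropy \<nu> (word f c m) / real m < r1" "m \<ge> 1"
    by (auto simp: eventually_sequentially)
  define H where "H = label_entropy \<nu> (word f c m)"
  have H: "H < real m * r1" using m by (simp add: H_def field_simps)
  \<comment> \<open>The slack between \<open>H\<close> and \<open>m * r1\<close> is halved: one
    \<open>\<tau>\<close> for smoothing the block law, one for passing to a continuous
    majorant.\<close>
  define \<tau> where "\<tau> = (real m * r1 - H) / 2"
  have \<tau>: "\<tau> > 0" using H by (simp add: \<tau>_def)
  define A where "A = range c"
  have finA: "finite A" using c by (simp add: A_def simple_function_def)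
  define W where "W = {w. set w \<subseteq> A \<and> length w = m}"
  have finW: "finite W" unfolding W_def by (rule finite_lists_length_eq[OF finA])
  have wW: "word f c m y \<in> W" for y using set_word_subset[of f c m y] by (simp add: W_def A_def)
  hence W0: "card W > 0" using finW by (metis card_gt_0_iff empty_iff)
  define p where "p w = measure \<nu> (word f c m -` {w})" for w
  \<comment> \<open>With \<open>1 - \<theta> = exp (- \<tau>)\<close>, smoothing raises the negative
    logarithm of a positive block weight by at most \<open>\<tau>\<close>. The uniform part bounds
    \<open>q\<close> away from 0, also on blocks that \<open>\<nu>\<close> never sees.\<close>
  define \<theta> where "\<theta> = 1 - exp (- \<tau>)"
  have \<theta>: "0 < \<theta>" "\<theta> < 1" using \<tau> by (simp_all add: \<theta>_def)
  define q where "q w = (1 - \<theta>) * p w + \<theta> / real (card W)" for w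
  have wsf: "simple_function \<nu> (word f c m)" by (rule simple_function_word[OF c])
  have p0: "0 \<le> p w" for w by (simp add: p_def)
  have psum: "(\<Sum>w\<in>W. p w) = 1"
  proof -
    have "p w = 0" if "w \<notin> range (word f c m)" for w
    proof -
      have "word f c m -` {w} = {}" using that by auto
      thus ?thesis by (simp add: p_def)
    qed
    hence "(\<Sum>w\<in>range (word f c m). p w) = (\<Sum>w\<in>W. p w)"
      using finW wW by (intro sum.mono_neutral_left) auto
    thus ?thesis using sum_measure_label[OF wsf] by (simp add: p_def)
  qed
  have q0: "\<theta> / real (card W) \<le> q w" for w using p0[of w] \<theta> by (simp add: q_def)
  have \<theta>W: "0 < \<theta> / real (card W)" using \<theta> W0 by simp
  have qpos: "0 < q w" for w using q0[of w] \<theta>W by linarith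
  have qsum: "(\<Sum>w\<in>W. q w) = 1"
    using W0 psum by (simp add: q_def sum.distrib flip: sum_distrib_left)
  have q1: "q w \<le> 1" if "w \<in> W" for w
    using member_le_sum[OF that, of q] qsum finW less_imp_le[OF qpos] by auto
  define \<phi>0 where "\<phi>0 y = - ln (q (word f c m y))" for y
  have \<phi>int: "integrable \<nu> \<phi>0"
    unfolding \<phi>0_def[abs_def] by (rule integral_simple_label(2)[OF wsf])
  have "(\<integral>y. \<phi>0 y \<partial>\<nu>) = (\<Sum>w\<in>range (word f c m). p w * (- ln (q w)))"
    unfolding \<phi>0_def using integral_simple_label(1)[OF wsf, of "\<lambda>w. - ln (q w)"] by (simp add: p_def)
  also have "\<dots> \<le> (\<Sum>w\<in>range (word f c m). - (p w * ln (p w)) + p w * \<tau>)"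
  proof (rule sum_mono)
    fix w
    show "p w * (- ln (q w)) \<le> - (p w * ln (p w)) + p w * \<tau>"
    proof (cases "p w = 0")
      case False
      hence pw: "p w > 0" using p0[of w] by simp
      have "(1 - \<theta>) * p w \<le> q w" using \<theta>W by (simp add: q_def)
      hence "ln ((1 - \<theta>) * p w) \<le> ln (q w)" using \<theta> pw by (subst ln_le_cancel_iff) (auto simp: qpos)
      moreover have "ln ((1 - \<theta>) * p w) = - \<tau> + ln (p w)"
        using \<theta> pw by (simp add: ln_mult \<theta>_def)
      ultimately have "- ln (q w) \<le> - ln (p w) + \<tau>" by simp
      hence "p w * (- ln (q w)) \<le> p w * (- ln (p w) + \<tau>)" using pw by (intro mult_left_mono) auto
      thus ?thesis by (simp add: algebra_simps)
    qed simp
  qed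
  also have "\<dots> = H + \<tau>"
  proof -
    have "(\<Sum>w\<in>range (word f c m). p w) = 1" using sum_measure_label[OF wsf] by (simp add: p_def)
    moreover have "(\<Sum>w\<in>range (word f c m). - (p w * ln (p w))) = H"
      by (simp add: H_def label_entropy_def p_def sum_negf)
    ultimately show ?thesis unfolding sum.distrib sum_distrib_right[symmetric] by simp
  qed
  finally have \<phi>I: "(\<integral>y. \<phi>0 y \<partial>\<nu>) \<le> H + \<tau>" .
  define Dm where "Dm = (\<Union>i<m. (f ^^ i) -` D)"
  have cl: "closed ((f ^^ i) -` D)" for i
    using continuous_closed_vimage[OF D(1), of "f ^^ i"] funpow_continuous[OF f, of i]
    by (simp add: continuous_on_eq_continuous_at)
  have Dm: "closed Dm" unfolding Dm_def by (intro closed_UN) (simp_all add: cl)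
  have "measure \<nu> Dm \<le> (\<Sum>i<m. measure \<nu> ((f ^^ i) -` D))"
    unfolding Dm_def by (intro finite_measure_subadditive_finite) (simp_all add: image_subset_iff borel_closed cl)
  also have "\<dots> = 0" using D by (simp add: measure_vimage_funpow borel_closed)
  finally have Dm0: "measure \<nu> Dm = 0" by (simp add: measure_le_0_iff)
  have locm: "\<exists>U. open U \<and> y \<in> U \<and> (\<forall>z\<in>U. \<phi>0 z = \<phi>0 y)" if y: "y \<notin> Dm" for y
  proof -
    have "\<exists>U. open U \<and> (f ^^ i) y \<in> U \<and> (\<forall>z\<in>U. c z = c ((f ^^ i) y))" if "i < m" for i
      using y that by (intro loc) (auto simp: Dm_def)
    then obtain U where U: "\<And>i. i < m \<Longrightarrow> open (U i)" "\<And>i. i < m \<Longrightarrow> (f ^^ i) y \<in> U i"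
      "\<And>i z. i < m \<Longrightarrow> z \<in> U i \<Longrightarrow> c z = c ((f ^^ i) y)"
      by metis
    define V where "V = (\<Inter>i<m. (f ^^ i) -` U i)"
    have "open ((f ^^ i) -` U i)" if "i < m" for i
      using continuous_open_vimage[OF U(1)[OF that], of "f ^^ i"] funpow_continuous[OF f, of i]
      by (simp add: continuous_on_eq_continuous_at)
    hence "open V" unfolding V_def by (intro open_INT) auto
    moreover have "y \<in> V" using U(2) by (simp add: V_def)
    moreover have "\<phi>0 z = \<phi>0 y" if "z \<in> V" for z
    proof -
      have "word f c m z = word f c m y"
        unfolding word_eq_iff using U(3) that by (auto simp: V_def)
      thus ?thesis by (simp add: \<phi>0_def)
    qed
    ultimately show ?thesis by blast
  qed
  obtain \<phi> where \<phi>: "continuous_on UNIV \<phi>" "\<And>y. \<phi>0 y \<le> \<phi> y" "(\<integral>y. \<phi> y \<partial>\<nu>) < (\<integral>y. \<phi>0 y \<partial>\<nu>) + \<tau>"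
  proof -
    have low: "0 \<le> \<phi>0 y" for y using q1[OF wW[of y]] qpos by (simp add: \<phi>0_def)
    have up: "\<phi>0 y \<le> - ln (\<theta> / real (card W))" for y
      using q0[of "word f c m y"] \<theta>W qpos by (simp add: \<phi>0_def)
    show thesis
      by (rule continuous_majorant[OF Dm Dm0 low up \<phi>int locm \<tau>]) (assumption | rule that)+
  qed
  have \<phi>s: "(\<integral>y. \<phi> y \<partial>\<nu>) < real m * r1"
  proof -
    have "H + \<tau> + \<tau> = real m * r1" by (simp add: \<tau>_def field_simps)
    thus ?thesis using \<phi>(3) \<phi>I by linarith
  qed
  define K where "K = real m * real (card A) ^ (3 * m)"
  have K0: "K > 0"
    using m(2) finA by (simp add: K_def A_def card_gt_0_iff)
  \<comment> \<open>For such \<open>n\<close> the constant factor \<open>K\<close> is absorbed by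
    the gap between \<open>r1\<close> and \<open>r\<close>.\<close>
  obtain N0 :: nat where N0: "real N0 > ln K / (r - r1)" using reals_Archimedean2 by blast
  have main: "real (card E) \<le> exp (real n * r)"
    if n: "n \<ge> max N0 m" and E: "finite E" "separated_set f n \<epsilon> E"
      and b: "\<And>e. e \<in> E \<Longrightarrow> birkhoff_sum f \<phi> n e \<le> real n * (real m * r1)" for n E
  proof -
    have inj: "inj_on (word f c n) E"
    proof (rule inj_onI, rule ccontr)
      fix y z assume yz: "y \<in> E" "z \<in> E" "word f c n y = word f c n z" "y \<noteq> z"
      then obtain i where "i < n" "dist ((f ^^ i) y) ((f ^^ i) z) > \<epsilon>"
        using E(2) by (auto simp: separated_set_def)
      thus False using small[of "(f ^^ i) y" "(f ^^ i) z"] yz(3) by (auto simp: word_eq_iff)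
    qed
    have "real (card E) \<le> real m * real (card A) ^ (3 * m) * exp (real n * (real m * r1) / real m)"
    proof (rule card_words_le[where q=q, OF finA _ m(2) _ _ _ E(1) inj])
      fix e assume e: "e \<in> E"
      have "(\<Sum>i<n. - ln (q (word f c m ((f ^^ i) e)))) \<le> birkhoff_sum f \<phi> n e"
        unfolding birkhoff_sum_def using \<phi>(2) by (intro sum_mono) (simp add: \<phi>0_def)
      thus "(\<Sum>i<n. - ln (q (word f c m ((f ^^ i) e)))) \<le> real n * (real m * r1)"
        using b[OF e] by linarith
    qed (use n qpos qsum in \<open>auto simp: A_def W_def\<close>)
    also have "\<dots> = exp (ln K + real n * r1)"
      using m(2) K0 by (simp add: exp_add K_def)
    also have "\<dots> \<le> exp (real n * r)"
    proof -
      have "ln K / (r - r1) \<le> real n" using N0 n by (meson less_imp_le max.boundedE of_nat_mono order_trans)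
      thus ?thesis using r1(2) by (simp add: field_simps)
    qed
    finally show ?thesis .
  qed
  show ?thesis by (rule that[OF \<phi>(1) \<phi>s]) (rule main)
qed

end

section \<open>The upper bound\<close>

text \<open>A finite cover by Bowen balls of radius \<open>\<epsilon> / 2\<close> bounds the size of
  separated sets, since each ball holds at most one of their points. A separated subset of
  \<open>A\<close> of largest size spans \<open>A\<close>.\<close>

lemma maximal_separated_set:
  fixes f :: "'a::metric_space \<Rightarrow> 'a"
  assumes cpt: "compact (UNIV :: 'a set)" and f: "continuous_on UNIV f" and \<epsilon>: "\<epsilon> > 0"
  obtains E where "finite E" "E \<subseteq> A" "separated_set f n \<epsilon> E"
    "\<And>y. y \<in> A \<Longrightarrow> \<exists>e\<in>E. \<forall>i<n. dist ((f ^^ i) y) ((f ^^ i) e) \<le> \<epsilon>"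
proof -
  define V where "V t = (\<Inter>i<n. {y. dist ((f ^^ i) y) ((f ^^ i) t) < \<epsilon> / 2})" for t
  have "open {y. dist ((f ^^ i) y) ((f ^^ i) t) < \<epsilon> / 2}" for i t
    by (intro open_Collect_less continuous_intros funpow_continuous f)
  hence op: "open (V t)" for t
    unfolding V_def by (intro open_INT) auto
  have cover: "UNIV \<subseteq> (\<Union>t\<in>UNIV. V t)"
  proof
    fix t
    have "t \<in> V t" using \<epsilon> by (simp add: V_def)
    thus "t \<in> (\<Union>t\<in>UNIV. V t)" by blast
  qed
  obtain T where T: "finite T" "UNIV \<subseteq> (\<Union>t\<in>T. V t)"
    by (rule compactE_image[OF cpt _ cover]) (use op in auto)
  have "\<exists>t\<in>T. y \<in> V t" for y using T(2) by blast
  then obtain t where t: "\<And>y. t y \<in> T" "\<And>y. y \<in> V (t y)" by metis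
  have bound: "card E \<le> card T" if E: "separated_set f n \<epsilon> E" for E
  proof -
    have "inj_on t E"
    proof (rule inj_onI, rule ccontr)
      fix y z assume yz: "y \<in> E" "z \<in> E" "t y = t z" "y \<noteq> z"
      then obtain i where i: "i < n" "dist ((f ^^ i) y) ((f ^^ i) z) > \<epsilon>"
        using E by (auto simp: separated_set_def)
      have "dist ((f ^^ i) y) ((f ^^ i) (t y)) < \<epsilon> / 2" "dist ((f ^^ i) z) ((f ^^ i) (t y)) < \<epsilon> / 2"
        using t(2)[of y] t(2)[of z] i(1) yz(3) by (auto simp: V_def)
      thus False using i(2) by metric
    qed
    thus ?thesis using T(1) t(1) by (metis card_inj_on_le image_subsetI)
  qed
  define P where "P k \<longleftrightarrow> (\<exists>E. finite E \<and> E \<subseteq> A \<and> separated_set f n \<epsilon> E \<and> card E = k)" for k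
  have "P 0" unfolding P_def by (intro exI[of _ "{}"]) (simp add: separated_set_def)
  moreover have Pb: "k \<le> card T" if "P k" for k
    using that bound unfolding P_def by blast
  ultimately have "P (Greatest P)"
    by (rule GreatestI_nat)
  then obtain E where E: "finite E" "E \<subseteq> A" "separated_set f n \<epsilon> E" "card E = Greatest P"
    unfolding P_def by blast
  have "\<exists>e\<in>E. \<forall>i<n. dist ((f ^^ i) y) ((f ^^ i) e) \<le> \<epsilon>" if y: "y \<in> A" for y
  proof (rule ccontr)
    assume neg: "\<not> ?thesis"
    hence far: "\<exists>i<n. dist ((f ^^ i) y) ((f ^^ i) e) > \<epsilon>" if "e \<in> E" for e
      using that by (meson not_le)
    have "y \<notin> E" using neg \<epsilon> by (metis dist_self less_imp_le)
    hence "card (insert y E) = Suc (Greatest P)" using E by simp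
    moreover have "separated_set f n \<epsilon> (insert y E)"
      using E(3) far unfolding separated_set_def by (metis dist_commute insertE)
    ultimately have "P (Suc (Greatest P))"
      unfolding P_def using E(1,2) y by (intro exI[of _ "insert y E"]) simp
    hence "Suc (Greatest P) \<le> Greatest P"
      using Pb by (intro Greatest_le_nat) auto
    thus False by simp
  qed
  thus ?thesis using that E by blast
qed

lemma elog_limsup_le:
  assumes L: "L > 0" and m: "\<And>n. n \<ge> N \<Longrightarrow> m n \<le> L * exp (real n * r)"
  shows "limsup (\<lambda>n. elog (m n) / ereal (real n)) \<le> ereal r"
proof -
  have "eventually (\<lambda>n. elog (m n) / ereal (real n) \<le> ereal (ln L / real n + r)) sequentially"
  proof (rule eventually_sequentiallyI)
    fix n assume "max N 1 \<le> n"
    hence n: "n \<ge> N" "real n > 0" by auto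
    show "elog (m n) / ereal (real n) \<le> ereal (ln L / real n + r)"
    proof (cases "m n \<le> 0")
      case False
      hence "ln (m n) \<le> ln (L * exp (real n * r))" using m[OF n(1)] by simp
      also have "\<dots> = ln L + real n * r" using L by (simp add: ln_mult)
      finally have "ln (m n) / real n \<le> ln L / real n + r"
        using n(2) by (simp add: field_simps)
      thus ?thesis using False n(2) by (simp add: elog_def)
    qed (use n in \<open>simp add: elog_def\<close>)
  qed
  hence "limsup (\<lambda>n. elog (m n) / ereal (real n)) \<le> limsup (\<lambda>n. ereal (ln L / real n + r))"
    by (rule Limsup_mono)
  also have "\<dots> = ereal r"
  proof (rule lim_imp_Limsup)
    have "(\<lambda>n. ln L / real n + r) \<longlonglongrightarrow> 0 + r"
      by (intro tendsto_add tendsto_const lim_const_over_n)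
    thus "(\<lambda>n. ereal (ln L / real n + r)) \<longlonglongrightarrow> ereal r" by simp
  qed simp
  finally show ?thesis .
qed

lemma elog_liminf_ge:
  assumes m: "\<And>n. n \<ge> N \<Longrightarrow> exp (real n * r) \<le> m n"
  shows "ereal r \<le> liminf (\<lambda>n. elog (m n) / ereal (real n))"
proof (rule Liminf_bounded, rule eventually_sequentiallyI)
  fix n assume "max N 1 \<le> n"
  hence n: "n \<ge> N" "real n > 0" by auto
  have "0 < exp (real n * r)" by simp
  hence pos: "0 < m n" using m[OF n(1)] by linarith
  have "ln (exp (real n * r)) \<le> ln (m n)"
    using m[OF n(1)] pos by (subst ln_le_cancel_iff) auto
  hence "r \<le> ln (m n) / real n" using n(2) by (simp add: field_simps)
  thus "ereal r \<le> elog (m n) / ereal (real n)" using pos n(2) by (simp add: elog_def)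
qed

context smale
begin

text \<open>Quantifying over reciprocals of positive integers writes the convergence as countable
  unions and intersections of open conditions.\<close>

lemma unstable_manifold_borel: "unstable_manifold f x \<in> sets borel"
proof -
  define a where "a n y = dist ((inv f ^^ n) y) ((inv f ^^ n) x)" for n y
  have [measurable]: "a n \<in> borel_measurable borel" for n
    unfolding a_def[abs_def]
    by (intro borel_measurable_continuous_onI continuous_intros funpow_continuous inv_cont)
  have "(\<lambda>n. a n y) \<longlonglongrightarrow> 0 \<longleftrightarrow> (\<forall>k::nat. \<exists>N. \<forall>n\<ge>N. a n y < 1 / real (Suc k))" for y
  proof
    assume "(\<lambda>n. a n y) \<longlonglongrightarrow> 0"
    thus "\<forall>k::nat. \<exists>N. \<forall>n\<ge>N. a n y < 1 / real (Suc k)"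
      using order_tendstoD(2)[of "\<lambda>n. a n y" 0 sequentially] by (auto simp: eventually_sequentially)
  next
    assume *: "\<forall>k::nat. \<exists>N. \<forall>n\<ge>N. a n y < 1 / real (Suc k)"
    show "(\<lambda>n. a n y) \<longlonglongrightarrow> 0"
    proof (rule LIMSEQ_I)
      fix e :: real assume "e > 0"
      then obtain k where "1 / real (Suc k) < e" by (metis nat_approx_posE)
      moreover obtain N where "\<forall>n\<ge>N. a n y < 1 / real (Suc k)" using * by blast
      ultimately show "\<exists>no. \<forall>n\<ge>no. norm (a n y - 0) < e"
        by (intro exI[of _ N]) (auto simp: a_def)
    qed
  qed
  hence "unstable_manifold f x = {y \<in> space borel. \<forall>k::nat. \<exists>N. \<forall>n\<ge>N. a n y < 1 / real (Suc k)}"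
    by (simp add: unstable_manifold_def a_def)
  also have "\<dots> \<in> sets borel" by measurable
  finally show ?thesis .
qed

lemma unstable_bowen_ball_borel: "unstable_bowen_ball f x y n \<epsilon> \<in> sets borel"
proof -
  have "open {z. dist ((f ^^ i) z) ((f ^^ i) y) < \<epsilon>}" for i
    by (intro open_Collect_less continuous_intros funpow_continuous f_cont)
  hence "(\<Inter>i<n. {z. dist ((f ^^ i) z) ((f ^^ i) y) < \<epsilon>}) \<in> sets borel"
    by (intro borel_open open_INT) auto
  moreover have "unstable_bowen_ball f x y n \<epsilon>
      = unstable_manifold f x \<inter> (\<Inter>i<n. {z. dist ((f ^^ i) z) ((f ^^ i) y) < \<epsilon>})"
    by (auto simp: unstable_bowen_ball_def)
  ultimately show ?thesis using unstable_manifold_borel by simp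
qed

end

text \<open>\<open>\<delta> \<le> \<kappa>\<close> ensures that \<open>local_unstable\<close>
  consists of \<open>usim\<close>-related points, so the contraction and specification results apply
  to it.\<close>

locale gibbs_setting = smale f br \<kappa> lam
  for f :: "'a::metric_space \<Rightarrow> 'a" and br and \<kappa> lam :: real +
  fixes G :: "'a \<Rightarrow> real" and \<delta> :: real and x :: 'a and \<mu> :: "'a measure"
  assumes G_cont: "continuous_on UNIV G" and \<delta>: "0 < \<delta>" "\<delta> \<le> \<kappa>"
    and gibbs: "conditional_gibbs f br G \<delta> x \<mu>"
begin

abbreviation "W \<equiv> local_unstable br \<delta> x"

lemma sets_\<mu>: "sets \<mu> = sets borel" and fin_\<mu>: "finite_measure \<mu>" and AE_W: "AE y in \<mu>. y \<in> W"
  using gibbs by (simp_all add: conditional_gibbs_def)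

definition weight :: "nat \<Rightarrow> 'a \<Rightarrow> real" where
  "weight n y = exp (birkhoff_sum f G n y - real n * topological_pressure f G)"

definition gibbs_at :: "real \<Rightarrow> real \<Rightarrow> bool" where
  "gibbs_at \<epsilon> K \<longleftrightarrow> K > 0 \<and> (\<forall>y\<in>W. \<forall>n\<ge>1.
     weight n y \<le> K * measure \<mu> (unstable_bowen_ball f x y n \<epsilon>) \<and>
     measure \<mu> (unstable_bowen_ball f x y n \<epsilon>) \<le> K * weight n y)"

lemma gibbs_bounds:
  obtains \<epsilon>0 where "\<epsilon>0 > 0" "\<And>\<epsilon>. 0 < \<epsilon> \<Longrightarrow> \<epsilon> < \<epsilon>0 \<Longrightarrow> \<exists>K. gibbs_at \<epsilon> K"
proof -
  obtain \<epsilon>0 where e0: "\<epsilon>0 > 0" and e: "\<And>\<epsilon>. 0 < \<epsilon> \<Longrightarrow> \<epsilon> < \<epsilon>0 \<Longrightarrow> \<exists>K>0. \<forall>y\<in>W. \<forall>n\<ge>1.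
      inverse K \<le> measure \<mu> (unstable_bowen_ball f x y n \<epsilon>) / weight n y \<and>
      measure \<mu> (unstable_bowen_ball f x y n \<epsilon>) / weight n y \<le> K"
    using gibbs unfolding conditional_gibbs_def weight_def by blast
  have conv: "t \<le> K * b \<and> b \<le> K * t" if "K > 0" "t > 0" "inverse K \<le> b / t \<and> b / t \<le> K" for K t b :: real
    using that by (simp add: field_simps)
  show ?thesis
  proof (rule that[OF e0])
    fix \<epsilon> assume "0 < \<epsilon>" "\<epsilon> < \<epsilon>0"
    then obtain K where K: "K > 0" "\<forall>y\<in>W. \<forall>n\<ge>1.
        inverse K \<le> measure \<mu> (unstable_bowen_ball f x y n \<epsilon>) / weight n y \<and>
        measure \<mu> (unstable_bowen_ball f x y n \<epsilon>) / weight n y \<le> K"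
      using e by blast
    have "weight n y > 0" for n y by (simp add: weight_def)
    hence "gibbs_at \<epsilon> K"
      unfolding gibbs_at_def using K by (intro conjI[OF K(1)] ballI allI impI conv) auto
    thus "\<exists>K. gibbs_at \<epsilon> K" by blast
  qed
qed

lemma W_subset_unstable_manifold: "y \<in> W \<Longrightarrow> y \<in> unstable_manifold f x"
  using \<delta> by (simp add: local_unstable_iff_usim usim_imp_unstable_manifold)

lemma invariant_measuresD:
  assumes "\<nu> \<in> invariant_measures f" shows "invariant_measure \<nu> f"
  using assms f_cont
  by (auto simp: invariant_measures_def borel_prob_measures_def invariant_measure_def
      invariant_measure_axioms_def intro: borel_measurable_continuous_onI)

text \<open>\<open>C\<close> imposes two open conditions: the integral of \<open>\<phi>\<close>
  limits the number of \<open>\<epsilon>\<close>-separated orbits, the integral of \<open>G\<close>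
  limits the weight of each. Bowen balls of radius \<open>2 * \<epsilon>\<close> around a maximal
  separated set cover the event up to a null set.\<close>

lemma upper_invariant:
  assumes \<nu>: "\<nu> \<in> invariant_measures f" and r: "- rate_function f G \<nu> < ereal r"
  obtains C N where "openin weak_star C" "\<nu> \<in> C"
    "\<And>n. n \<ge> N \<Longrightarrow> measure \<mu> {y. orbital_measure f n y \<in> C} \<le> exp (real n * r)"
proof -
  interpret \<nu>: invariant_measure \<nu> f by (rule invariant_measuresD[OF \<nu>])
  interpret \<mu>: finite_measure \<mu> by (rule fin_\<mu>)
  let ?P = "topological_pressure f G"
  define g where "g = (\<integral>y. G y \<partial>\<nu>)"
  have "ms_entropy f \<nu> < ereal (r + ?P - g)"
    using r \<nu> by (cases "ms_entropy f \<nu>") (auto simp: rate_function_def g_def)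
  then obtain r2 where r2: "ms_entropy f \<nu> < ereal r2" "r2 < r + ?P - g"
    using ereal_dense2 by (metis less_ereal.simps(1))
  \<comment> \<open>A third of the slack widens the condition on \<open>G\<close>; the other two
    thirds absorb the Gibbs constant \<open>K\<close> for large \<open>n\<close>.\<close>
  define \<eta> where "\<eta> = (r + ?P - g - r2) / 3"
  have \<eta>: "\<eta> > 0" using r2 by (simp add: \<eta>_def)
  obtain \<epsilon>0 where \<epsilon>0: "\<epsilon>0 > 0" "\<And>\<epsilon>. 0 < \<epsilon> \<Longrightarrow> \<epsilon> < \<epsilon>0 \<Longrightarrow> \<exists>K. gibbs_at \<epsilon> K"
    by (rule gibbs_bounds) blast
  define \<epsilon> where "\<epsilon> = \<epsilon>0 / 4"
  have \<epsilon>: "\<epsilon> > 0" "2 * \<epsilon> < \<epsilon>0" using \<epsilon>0(1) by (simp_all add: \<epsilon>_def)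
  obtain K where K: "K > 0" "\<And>y n. y \<in> W \<Longrightarrow> n \<ge> 1 \<Longrightarrow>
    measure \<mu> (unstable_bowen_ball f x y n (2 * \<epsilon>)) \<le> K * exp (birkhoff_sum f G n y - real n * ?P)"
    using \<epsilon>0(2)[of "2 * \<epsilon>"] \<epsilon> unfolding gibbs_at_def weight_def by auto
  obtain \<phi> s N where \<phi>: "continuous_on UNIV \<phi>" "(\<integral>y. \<phi> y \<partial>\<nu>) < s"
    and count: "\<And>n E. n \<ge> N \<Longrightarrow> finite E \<Longrightarrow> separated_set f n \<epsilon> E \<Longrightarrow>
      (\<And>e. e \<in> E \<Longrightarrow> birkhoff_sum f \<phi> n e \<le> real n * s) \<Longrightarrow> real (card E) \<le> exp (real n * r2)"
  proof (rule \<nu>.count_separated[OF compact_UNIV f_cont r2(1) \<epsilon>(1)])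
    fix \<phi> s N
    assume "continuous_on UNIV \<phi>" "(\<integral>y. \<phi> y \<partial>\<nu>) < s" "\<And>n E. n \<ge> N \<Longrightarrow> finite E \<Longrightarrow> separated_set f n \<epsilon> E \<Longrightarrow>
      (\<And>e. e \<in> E \<Longrightarrow> birkhoff_sum f \<phi> n e \<le> real n * s) \<Longrightarrow> real (card E) \<le> exp (real n * r2)"
    thus thesis by (rule that)
  qed
  define C where "C = {\<zeta> \<in> borel_prob_measures. (\<integral>y. \<phi> y \<partial>\<zeta>) \<in> {..<s}} \<inter>
    {\<zeta> \<in> borel_prob_measures. (\<integral>y. G y \<partial>\<zeta>) \<in> {..<g + \<eta>}}"
  have C: "openin weak_star C"
    unfolding C_def by (intro openin_Int weak_star_basic_open \<phi> G_cont) auto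
  have "\<nu> \<in> C"
    using \<nu> \<phi>(2) \<eta> by (simp add: C_def invariant_measures_def g_def)
  obtain N1 :: nat where N1: "real N1 > ln K / (2 * \<eta>)" using reals_Archimedean2 by blast
  have "measure \<mu> {y. orbital_measure f n y \<in> C} \<le> exp (real n * r)" if n: "n \<ge> max (max N 1) N1" for n
  proof -
    have n1: "n \<ge> 1" "n \<ge> N" "n \<ge> N1" using n by auto
    \<comment> \<open>The separated set is chosen inside \<open>W\<close>, where the Gibbs bound for
      centres holds; \<open>\<mu>\<close> lives on \<open>W\<close>, so this loses nothing.\<close>
    define A where "A = {y \<in> W. orbital_measure f n y \<in> C}"
    obtain E where E: "finite E" "E \<subseteq> A" "separated_set f n \<epsilon> E"
      "\<And>y. y \<in> A \<Longrightarrow> \<exists>e\<in>E. \<forall>i<n. dist ((f ^^ i) y) ((f ^^ i) e) \<le> \<epsilon>"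
      by (rule maximal_separated_set[OF compact_UNIV f_cont \<epsilon>(1), of A n]) blast
    have int: "(\<integral>y. h y \<partial>orbital_measure f n e) = birkhoff_sum f h n e / real n"
      if "continuous_on UNIV h" for h :: "'a \<Rightarrow> real" and e
      by (rule integral_orbital_measure[OF n1(1) borel_measurable_continuous_onI[OF that]])
    have Es: "birkhoff_sum f \<phi> n e \<le> real n * s" "birkhoff_sum f G n e \<le> real n * (g + \<eta>)" if "e \<in> E" for e
    proof -
      have "orbital_measure f n e \<in> C" using that E(2) by (auto simp: A_def)
      hence "birkhoff_sum f \<phi> n e / real n < s" "birkhoff_sum f G n e / real n < g + \<eta>"
        by (simp_all add: C_def int[OF \<phi>(1)] int[OF G_cont])
      thus "birkhoff_sum f \<phi> n e \<le> real n * s" "birkhoff_sum f G n e \<le> real n * (g + \<eta>)"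
        using n1(1) by (simp_all add: field_simps)
    qed
    have card: "real (card E) \<le> exp (real n * r2)"
      by (rule count[OF n1(2) E(1,3)]) (rule Es(1))
    let ?B = "\<lambda>e. unstable_bowen_ball f x e n (2 * \<epsilon>)"
    have BS: "?B e \<in> sets \<mu>" for e using unstable_bowen_ball_borel by (simp add: sets_\<mu>)
    have "AE y in \<mu>. y \<in> {y. orbital_measure f n y \<in> C} \<longrightarrow> y \<in> (\<Union>e\<in>E. ?B e)"
      using AE_W
    proof eventually_elim
      case (elim y)
      show ?case
      proof
        assume "y \<in> {y. orbital_measure f n y \<in> C}"
        hence "y \<in> A" using elim by (simp add: A_def)
        then obtain e where e: "e \<in> E" "\<forall>i<n. dist ((f ^^ i) y) ((f ^^ i) e) \<le> \<epsilon>" using E(4) by blast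
        have "y \<in> ?B e"
          unfolding unstable_bowen_ball_def
          using W_subset_unstable_manifold[OF elim] e(2) \<epsilon>(1) by (auto intro: le_less_trans)
        thus "y \<in> (\<Union>e\<in>E. ?B e)" using e(1) by blast
      qed
    qed
    hence "measure \<mu> {y. orbital_measure f n y \<in> C} \<le> measure \<mu> (\<Union>e\<in>E. ?B e)"
      using BS E(1) by (intro \<mu>.finite_measure_mono_AE) auto
    also have "\<dots> \<le> (\<Sum>e\<in>E. measure \<mu> (?B e))"
      using BS E(1) by (intro \<mu>.finite_measure_subadditive_finite) auto
    also have "\<dots> \<le> (\<Sum>e\<in>E. K * exp (real n * (g + \<eta> - ?P)))"
    proof (rule sum_mono)
      fix e assume e: "e \<in> E"
      hence "e \<in> W" using E(2) by (auto simp: A_def)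
      hence "measure \<mu> (?B e) \<le> K * exp (birkhoff_sum f G n e - real n * ?P)"
        using n1(1) by (rule K(2))
      also have "\<dots> \<le> K * exp (real n * (g + \<eta> - ?P))"
        using K(1) Es(2)[OF e] by (simp add: right_diff_distrib)
      finally show "measure \<mu> (?B e) \<le> K * exp (real n * (g + \<eta> - ?P))" .
    qed
    also have "\<dots> \<le> exp (real n * r2) * (K * exp (real n * (g + \<eta> - ?P)))"
      using card K(1) by simp
    also have "\<dots> = exp (real n * r2 + (ln K + real n * (g + \<eta> - ?P)))"
      using K(1) by (simp add: exp_add)
    also have "\<dots> \<le> exp (real n * r)"
    proof -
      have "real N1 \<le> real n" using n1 by simp
      hence "ln K / (2 * \<eta>) < real n" using N1 by linarith
      hence "ln K \<le> real n * (2 * \<eta>)" using \<eta> by (simp add: field_simps)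
      moreover have "r2 + (g + \<eta> - ?P) + 2 * \<eta> = r" by (simp add: \<eta>_def field_simps)
      hence "real n * r2 + real n * (g + \<eta> - ?P) + real n * (2 * \<eta>) = real n * r"
        by (metis distrib_left)
      ultimately show ?thesis by simp
    qed
    finally show ?thesis .
  qed
  thus ?thesis using that[OF C \<open>\<nu> \<in> C\<close>] by blast
qed

text \<open>Some continuous \<open>g\<close> has different integrals under \<open>\<nu>\<close> and
  its image. Birkhoff sums of the coboundary \<open>h = g \<circ> f - g\<close> telescope, so its
  averages are at most \<open>2 * B / n\<close> in modulus; long orbital measures therefore stay
  away from \<open>\<nu>\<close>.\<close>

lemma upper_noninvariant:
  assumes \<nu>: "\<nu> \<in> borel_prob_measures" "\<nu> \<notin> invariant_measures f"
  obtains C N where "openin weak_star C" "\<nu> \<in> C" "\<And>n y. n \<ge> N \<Longrightarrow> orbital_measure f n y \<notin> C"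
proof -
  have sb: "sets \<nu> = sets borel" and "prob_space \<nu>" using \<nu>(1) by (simp_all add: borel_prob_measures_def)
  interpret prob_space \<nu> by fact
  have fm: "f \<in> measurable \<nu> borel"
    using borel_measurable_continuous_onI[OF f_cont] measurable_cong_sets[OF sb refl] by blast
  have "distr \<nu> borel f \<noteq> \<nu>" using \<nu> by (simp add: invariant_measures_def)
  moreover have "finite_measure (distr \<nu> borel f)" by (rule finite_measure_distr[OF fm])
  ultimately obtain g :: "'a \<Rightarrow> real" where g: "continuous_on UNIV g" "(\<integral>y. g y \<partial>distr \<nu> borel f) \<noteq> (\<integral>y. g y \<partial>\<nu>)"
    using measure_eqI_continuous[of "distr \<nu> borel f" \<nu>] sb finite_measure_axioms by (metis sets_distr)
  have gf: "continuous_on UNIV (\<lambda>y. g (f y))"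
    by (rule continuous_on_compose2[OF g(1) f_cont]) simp
  define h where "h y = g (f y) - g y" for y
  have h_cont: "continuous_on UNIV h"
    unfolding h_def by (intro continuous_on_diff gf g(1))
  have int: "integrable \<nu> u" if "continuous_on UNIV u" for u :: "'a \<Rightarrow> real"
    by (rule integrable_continuous_compact[OF compact_UNIV finite_measure_axioms sb that])
  have "(\<integral>y. g y \<partial>distr \<nu> borel f) = (\<integral>y. g (f y) \<partial>\<nu>)"
    by (rule integral_distr[OF fm borel_measurable_continuous_onI[OF g(1)]])
  hence h0: "(\<integral>y. h y \<partial>\<nu>) \<noteq> 0"
    unfolding h_def using g(2) int[OF gf] int[OF g(1)] by simp
  define a where "a = \<bar>\<integral>y. h y \<partial>\<nu>\<bar> / 2"
  have a: "a > 0" using h0 by (simp add: a_def)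
  obtain B where B: "\<And>y. \<bar>g y\<bar> \<le> B"
    using compact_imp_bounded[OF compact_continuous_image[OF g(1) compact_UNIV]] by (auto simp: bounded_iff)
  define C where "C = {\<zeta> \<in> borel_prob_measures. (\<integral>y. h y \<partial>\<zeta>) \<in> - {- a..a}}"
  have "openin weak_star C"
    unfolding C_def by (intro weak_star_basic_open h_cont open_Compl) auto
  moreover have "\<nu> \<in> C"
    using \<nu>(1) a by (auto simp: C_def a_def)
  moreover obtain N :: nat where N: "real N > 2 * B / a" using reals_Archimedean2 by blast
  have "orbital_measure f n y \<notin> C" if n: "n \<ge> max N 1" for n y
  proof -
    have "birkhoff_sum f h n y = g ((f ^^ n) y) - g y"
      by (induction n) (simp_all add: birkhoff_sum_def h_def)
    hence b: "\<bar>birkhoff_sum f h n y\<bar> \<le> 2 * B"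
      using B[of "(f ^^ n) y"] B[of y] by linarith
    have "real N \<le> real n" using n by simp
    hence "2 * B / a < real n" using N by linarith
    hence "2 * B \<le> a * real n" using a by (simp add: field_simps)
    hence "\<bar>birkhoff_sum f h n y / real n\<bar> \<le> a"
      using b n by (simp add: field_simps)
    moreover have "(\<integral>z. h z \<partial>orbital_measure f n y) = birkhoff_sum f h n y / real n"
      using n by (intro integral_orbital_measure borel_measurable_continuous_onI h_cont) simp
    ultimately have "\<bar>\<integral>z. h z \<partial>orbital_measure f n y\<bar> \<le> a" by simp
    thus ?thesis unfolding C_def by (simp add: abs_le_iff minus_le_iff)
  qed
  ultimately show ?thesis using that by blast
qed

lemma upper_local:
  assumes \<nu>: "\<nu> \<in> borel_prob_measures" and r: "- rate_function f G \<nu> < ereal r"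
  shows "\<exists>C N. openin weak_star C \<and> \<nu> \<in> C \<and>
    (\<forall>n\<ge>N. measure \<mu> {y. orbital_measure f n y \<in> C} \<le> exp (real n * r))"
proof (cases "\<nu> \<in> invariant_measures f")
  case True
  show ?thesis by (rule upper_invariant[OF True r]) blast
next
  case False
  show ?thesis
  proof (rule upper_noninvariant[OF \<nu> False])
    fix C N
    assume C: "openin weak_star C" "\<nu> \<in> C" "\<And>n y. n \<ge> N \<Longrightarrow> orbital_measure f n y \<notin> C"
    have "measure \<mu> {y. orbital_measure f n y \<in> C} \<le> exp (real n * r)" if "n \<ge> N" for n
      using C(3)[OF that] by simp
    thus ?thesis using C(1,2) by blast
  qed
qed

text \<open>Compactness of \<open>K\<close> reduces to finitely many of the local neighbourhoods.
  Each satisfies the same exponential bound, and their number is a constant factor that leaves the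
  rate unchanged.\<close>

lemma upper_bound:
  assumes K: "closedin weak_star K"
  shows "limsup (\<lambda>n. elog (measure \<mu> {y. orbital_measure f n y \<in> K}) / ereal (real n))
    \<le> - (INF \<nu>\<in>K. rate_function f G \<nu>)"
proof (rule dense_ge)
  interpret \<mu>: finite_measure \<mu> by (rule fin_\<mu>)
  fix z assume z: "- (INF \<nu>\<in>K. rate_function f G \<nu>) < z"
  show "limsup (\<lambda>n. elog (measure \<mu> {y. orbital_measure f n y \<in> K}) / ereal (real n)) \<le> z"
  proof (cases z)
    case (real r)
    have Kb: "K \<subseteq> borel_prob_measures"
      using closedin_subset[OF K] by (simp add: topspace_weak_star)
    have "\<exists>C N. openin weak_star C \<and> \<nu> \<in> C \<and>
      (\<forall>n\<ge>N. measure \<mu> {y. orbital_measure f n y \<in> C} \<le> exp (real n * r))" if "\<nu> \<in> K" for \<nu>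
    proof (rule upper_local)
      show "\<nu> \<in> borel_prob_measures" using Kb that by blast
      have "(INF \<nu>\<in>K. rate_function f G \<nu>) \<le> rate_function f G \<nu>"
        using that by (rule INF_lower)
      hence "- rate_function f G \<nu> \<le> - (INF \<nu>\<in>K. rate_function f G \<nu>)" by simp
      thus "- rate_function f G \<nu> < ereal r" using z real by (metis le_less_trans)
    qed
    then obtain C N where C: "\<And>\<nu>. \<nu> \<in> K \<Longrightarrow> openin weak_star (C \<nu>)" "\<And>\<nu>. \<nu> \<in> K \<Longrightarrow> \<nu> \<in> C \<nu>"
      "\<And>\<nu> n. \<nu> \<in> K \<Longrightarrow> n \<ge> N \<nu> \<Longrightarrow> measure \<mu> {y. orbital_measure f n y \<in> C \<nu>} \<le> exp (real n * r)"
      by metis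
    have "compactin weak_star K"
      using closedin_compact_space[OF compact_space_weak_star[OF compact_UNIV] K] .
    then obtain \<F> where \<F>: "finite \<F>" "\<F> \<subseteq> C ` K" "K \<subseteq> \<Union>\<F>"
      using C(1,2) unfolding compactin_def by (metis (no_types, lifting) UN_I image_iff subsetI)
    obtain T where T: "T \<subseteq> K" "finite T" "\<F> = C ` T"
      using finite_subset_image[OF \<F>(1,2)] by blast
    define N' where "N' = Max (insert 1 (N ` T))"
    have N': "N' \<ge> 1" "\<And>\<nu>. \<nu> \<in> T \<Longrightarrow> N' \<ge> N \<nu>"
      unfolding N'_def using T(2) by (auto intro: Max_ge)
    have "measure \<mu> {y. orbital_measure f n y \<in> K} \<le> (real (card T) + 1) * exp (real n * r)" if n: "n \<ge> N'" for n
    proof -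
      have n1: "n \<ge> 1" using n N'(1) by simp
      have op: "{y. orbital_measure f n y \<in> C \<nu>} \<in> sets \<mu>" if "\<nu> \<in> T" for \<nu>
        using open_orbital_measure_vimage[OF f_cont n1 C(1)] that T(1) by (auto simp: sets_\<mu>)
      have "measure \<mu> {y. orbital_measure f n y \<in> K} \<le> measure \<mu> (\<Union>\<nu>\<in>T. {y. orbital_measure f n y \<in> C \<nu>})"
        using op T(2,3) \<F>(3) by (intro \<mu>.finite_measure_mono) auto
      also have "\<dots> \<le> (\<Sum>\<nu>\<in>T. measure \<mu> {y. orbital_measure f n y \<in> C \<nu>})"
        using op T(2) by (intro \<mu>.finite_measure_subadditive_finite) auto
      also have "\<dots> \<le> (\<Sum>\<nu>\<in>T. exp (real n * r))"
        using T(1) N'(2) n by (intro sum_mono C(3)) (auto intro: order_trans)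
      also have "\<dots> \<le> (real (card T) + 1) * exp (real n * r)" by (simp add: algebra_simps)
      finally show ?thesis .
    qed
    hence "limsup (\<lambda>n. elog (measure \<mu> {y. orbital_measure f n y \<in> K}) / ereal (real n)) \<le> ereal r"
      by (intro elog_limsup_le[of "real (card T) + 1" N']) auto
    thus ?thesis by (simp add: real)
  qed (use z in auto)
qed

end

section \<open>The lower bound\<close>

lemma (in invariant_measure) closed_cover_label:
  assumes E: "finite E" and Q: "\<And>e. closed (Q e)" "UNIV \<subseteq> (\<Union>e\<in>E. Q e)"
  obtains F where "simple_function \<nu> F" "range F \<subseteq> E" "\<And>y. y \<in> Q (F y)"
proof -
  obtain es where es: "set es = E" using finite_list[OF E] by blast
  have "E = (\<lambda>i. es ! i) ` {..<length es}"
    unfolding es[symmetric] by (auto simp: in_set_conv_nth)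
  hence cov: "UNIV \<subseteq> (\<Union>i<length es. Q (es ! i))" using Q(2) by (simp add: image_image)
  obtain c :: "'a \<Rightarrow> nat" where c: "simple_function \<nu> c" "\<And>y. c y < length es" "\<And>y. y \<in> Q (es ! c y)"
    using first_index_label[OF _ cov] Q(1) borel_closed by metis
  from simple_function_compose1[OF c(1), of "\<lambda>i. es ! i"]
  have "simple_function \<nu> (\<lambda>y. es ! c y)" .
  moreover have "range (\<lambda>y. es ! c y) \<subseteq> E" using c(2) es by auto
  ultimately show ?thesis using c(3) by (rule that)
qed

section \<open>Birkhoff sums along concatenated blocks\<close>

lemma birkhoff_sum_add:
  "birkhoff_sum f g (a + b) y = birkhoff_sum f g a y + birkhoff_sum f g b ((f ^^ a) y)"
proof (induction b)
  case (Suc b)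
  have "(f ^^ (a + b)) y = (f ^^ b) ((f ^^ a) y)"
    by (simp add: add.commute[of a] funpow_add)
  thus ?case using Suc by (simp add: birkhoff_sum_def)
qed (simp add: birkhoff_sum_def)

lemma birkhoff_sum_abs_le:
  assumes "\<And>y. \<bar>g y\<bar> \<le> B" shows "\<bar>birkhoff_sum f g n y\<bar> \<le> real n * B"
proof -
  have "\<bar>birkhoff_sum f g n y\<bar> \<le> (\<Sum>i<n. \<bar>g ((f ^^ i) y)\<bar>)"
    unfolding birkhoff_sum_def by (rule sum_abs)
  also have "\<dots> \<le> (\<Sum>i<n. B)" by (intro sum_mono assms)
  finally show ?thesis by simp
qed

lemma birkhoff_sum_diff_le:
  assumes "\<And>i. i < n \<Longrightarrow> \<bar>g ((f ^^ i) y) - g ((f ^^ i) z)\<bar> \<le> \<rho>"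
  shows "\<bar>birkhoff_sum f g n y - birkhoff_sum f g n z\<bar> \<le> real n * \<rho>"
proof -
  have "\<bar>birkhoff_sum f g n y - birkhoff_sum f g n z\<bar> \<le> (\<Sum>i<n. \<bar>g ((f ^^ i) y) - g ((f ^^ i) z)\<bar>)"
    unfolding birkhoff_sum_def sum_subtractf[symmetric] by (rule sum_abs)
  also have "\<dots> \<le> (\<Sum>i<n. \<rho>)" using assms by (intro sum_mono) auto
  finally show ?thesis by simp
qed

text \<open>Per period, shadowing costs \<open>\<rho>\<close> at each of \<open>m\<close> times, and
  the \<open>M\<close> connecting steps, of which nothing is known, cost at most \<open>B\<close>
  each.\<close>

lemma birkhoff_sum_blocks:
  assumes B: "\<And>y. \<bar>g y\<bar> \<le> B"
    and close: "\<And>j i. j < length s \<Longrightarrow> i < m \<Longrightarrow> \<bar>g ((f ^^ (j * (m + M) + M + i)) z) - g ((f ^^ i) (s ! j))\<bar> \<le> \<rho>"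
  shows "\<bar>birkhoff_sum f g (length s * (m + M)) z - sum_list (map (birkhoff_sum f g m) s)\<bar>
    \<le> real (length s) * (real m * \<rho> + real M * B)"
  using close
proof (induction s rule: rev_induct)
  case Nil
  show ?case by (simp add: birkhoff_sum_def)
next
  case (snoc e s)
  let ?N = "length s * (m + M)"
  define w where "w = (f ^^ ?N) z"
  have IH: "\<bar>birkhoff_sum f g ?N z - sum_list (map (birkhoff_sum f g m) s)\<bar>
    \<le> real (length s) * (real m * \<rho> + real M * B)"
  proof (rule snoc.IH)
    fix j i assume "j < length s" "i < m"
    thus "\<bar>g ((f ^^ (j * (m + M) + M + i)) z) - g ((f ^^ i) (s ! j))\<bar> \<le> \<rho>"
      using snoc.prems[of j i] by (simp add: nth_append)
  qed
  have it: "(f ^^ i) ((f ^^ M) w) = (f ^^ (?N + M + i)) z" for i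
    unfolding w_def by (subst add.commute, simp only: funpow_add comp_apply)
      (metis add.commute comp_apply funpow_add)
  have "\<bar>birkhoff_sum f g m ((f ^^ M) w) - birkhoff_sum f g m e\<bar> \<le> real m * \<rho>"
  proof (rule birkhoff_sum_diff_le)
    fix i assume "i < m"
    thus "\<bar>g ((f ^^ i) ((f ^^ M) w)) - g ((f ^^ i) e)\<bar> \<le> \<rho>"
      unfolding it using snoc.prems[of "length s" i] by simp
  qed
  moreover have "\<bar>birkhoff_sum f g M w\<bar> \<le> real M * B"
    by (rule birkhoff_sum_abs_le[OF B])
  moreover have "birkhoff_sum f g (length (s @ [e]) * (m + M)) z
      = birkhoff_sum f g ?N z + (birkhoff_sum f g M w + birkhoff_sum f g m ((f ^^ M) w))"
  proof -
    have "length (s @ [e]) * (m + M) = ?N + (M + m)" by simp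
    thus ?thesis by (simp only: birkhoff_sum_add w_def)
  qed
  moreover have "sum_list (map (birkhoff_sum f g m) (s @ [e]))
      = sum_list (map (birkhoff_sum f g m) s) + birkhoff_sum f g m e" by simp
  moreover have "real (length (s @ [e])) * (real m * \<rho> + real M * B)
      = real (length s) * (real m * \<rho> + real M * B) + (real m * \<rho> + real M * B)"
    by (simp add: distrib_right)
  ultimately show ?case using IH by linarith
qed

lemma bounded_finite_family:
  fixes \<Gamma> :: "('a::metric_space \<Rightarrow> real) set"
  assumes "compact (UNIV :: 'a set)" "finite \<Gamma>" "\<And>g. g \<in> \<Gamma> \<Longrightarrow> continuous_on UNIV g"
  obtains B where "B \<ge> 1" "\<And>g y. g \<in> \<Gamma> \<Longrightarrow> \<bar>g y\<bar> \<le> B"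
proof -
  have "\<exists>b. \<forall>y. \<bar>g y\<bar> \<le> b" if "g \<in> \<Gamma>" for g
    using compact_imp_bounded[OF compact_continuous_image[OF assms(3)[OF that] assms(1)]]
    by (auto simp: bounded_iff)
  then obtain b where b: "\<And>g y. g \<in> \<Gamma> \<Longrightarrow> \<bar>g y\<bar> \<le> b g" by metis
  have "\<bar>g y\<bar> \<le> Max (insert 1 (b ` \<Gamma>))" if "g \<in> \<Gamma>" for g y
  proof -
    have "b g \<le> Max (insert 1 (b ` \<Gamma>))" using that assms(2) by (intro Max_ge) auto
    thus ?thesis using b[OF that, of y] by linarith
  qed
  moreover have "Max (insert 1 (b ` \<Gamma>)) \<ge> 1" using assms(2) by (intro Max_ge) auto
  ultimately show ?thesis using that by blast
qed

lemma uniformly_continuous_finite_family: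
  fixes \<Gamma> :: "('a::metric_space \<Rightarrow> real) set"
  assumes "compact (UNIV :: 'a set)" "finite \<Gamma>" "\<And>g. g \<in> \<Gamma> \<Longrightarrow> continuous_on UNIV g" "\<rho> > 0"
  obtains d where "d > 0" "\<And>g y z. g \<in> \<Gamma> \<Longrightarrow> dist y z < d \<Longrightarrow> \<bar>g y - g z\<bar> < \<rho>"
proof -
  have "\<exists>d>0. \<forall>y z. dist y z < d \<longrightarrow> \<bar>g y - g z\<bar> < \<rho>" if "g \<in> \<Gamma>" for g
  proof -
    have "uniformly_continuous_on UNIV g"
      using assms(3)[OF that] assms(1) by (rule compact_uniformly_continuous)
    thus ?thesis
      using assms(4) unfolding uniformly_continuous_on_def dist_real_def by (elim allE[of _ \<rho>]) auto
  qed
  then obtain d where d: "\<And>g. g \<in> \<Gamma> \<Longrightarrow> d g > 0" "\<And>g y z. g \<in> \<Gamma> \<Longrightarrow> dist y z < d g \<Longrightarrow> \<bar>g y - g z\<bar> < \<rho>"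
    by metis
  define d' where "d' = Min (insert 1 (d ` \<Gamma>))"
  have "d' > 0" unfolding d'_def using assms(2) d(1) by (subst Min_gr_iff) auto
  moreover have "\<bar>g y - g z\<bar> < \<rho>" if "g \<in> \<Gamma>" "dist y z < d'" for g y z
  proof -
    have "d' \<le> d g" unfolding d'_def using assms(2) that(1) by (intro Min_le) auto
    thus ?thesis using d(2)[OF that(1), of y z] that(2) by linarith
  qed
  ultimately show ?thesis by (rule that)
qed

text \<open>Only an inequality, because \<open>ln 0 = 0\<close>: a letter of weight zero makes the
  left side 0 but not the right.\<close>

lemma prod_list_le_exp:
  fixes p :: "'b \<Rightarrow> real"
  assumes "\<And>a. 0 \<le> p a"
  shows "prod_list (map p s) \<le> exp (- sum_list (map (\<lambda>a. - ln (p a)) s))"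
proof (induction s)
  case (Cons a s)
  have "0 \<le> prod_list (map p s)" using assms by (induction s) auto
  moreover have "p a \<le> exp (ln (p a))" using assms[of a] by (cases "p a = 0") auto
  ultimately have "p a * prod_list (map p s) \<le> exp (ln (p a)) * exp (- sum_list (map (\<lambda>a. - ln (p a)) s))"
    using Cons by (intro mult_mono) auto
  thus ?case by (simp add: exp_add[symmetric])
qed simp

context gibbs_setting
begin

text \<open>Orbit blocks of length \<open>m\<close> are drawn independently from a maximal separated set, with the
  law that \<open>\<nu>\<close> induces on it. By the weak law of large numbers typical sequences of blocks have
  the right Birkhoff sums and there are about \<open>exp (n * label_rate c)\<close> of them. Specification
  realises each one by an orbit that starts on the local unstable manifold.\<close>

lemma lower_label:
  assumes mix: "topologically_mixing f"
    and \<nu>: "\<nu> \<in> invariant_measures f" "\<nu> \<in> J" "openin weak_star J"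
    and c: "simple_function \<nu> c"
    and r: "r < invariant_measure.label_rate \<nu> f c + (\<integral>y. G y \<partial>\<nu>) - topological_pressure f G"
  shows "\<exists>N. \<forall>n\<ge>N. exp (real n * r) \<le> measure \<mu> {y. orbital_measure f n y \<in> J}"
proof -
  interpret \<nu>: invariant_measure \<nu> f by (rule invariant_measuresD[OF \<nu>(1)])
  interpret \<mu>: finite_measure \<mu> by (rule fin_\<mu>)
  let ?P = "topological_pressure f G"
  define h where "h = \<nu>.label_rate c"
  define \<gamma> where "\<gamma> = h + (\<integral>y. G y \<partial>\<nu>) - ?P - r"
  have h0: "h \<ge> 0" unfolding h_def by (rule \<nu>.label_rate(3)[OF c])
  have \<gamma>: "\<gamma> > 0" using r by (simp add: \<gamma>_def h_def)
  obtain Gs :: "('a \<Rightarrow> real) set" and \<rho>0 where Gs: "finite Gs" "\<rho>0 > 0" "\<And>g. g \<in> Gs \<Longrightarrow> continuous_on UNIV g"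
    "\<And>\<zeta>. \<zeta> \<in> borel_prob_measures \<Longrightarrow> (\<And>g. g \<in> Gs \<Longrightarrow> \<bar>(\<integral>x. g x \<partial>\<zeta>) - (\<integral>x. g x \<partial>\<nu>)\<bar> < \<rho>0) \<Longrightarrow> \<zeta> \<in> J"
    by (rule weak_star_nbhd[OF \<nu>(3,2)]) blast
  define \<Gamma> where "\<Gamma> = insert G Gs"
  have \<Gamma>: "finite \<Gamma>" "\<And>g. g \<in> \<Gamma> \<Longrightarrow> continuous_on UNIV g"
    using Gs(1,3) G_cont by (auto simp: \<Gamma>_def)
  obtain B where B: "B \<ge> 1" "\<And>g y. g \<in> \<Gamma> \<Longrightarrow> \<bar>g y\<bar> \<le> B"
    by (rule bounded_finite_family[OF compact_UNIV \<Gamma>]) blast+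
  \<comment> \<open>Averages will be accurate to \<open>5 * \<rho>\<close>, which must stay below
    \<open>\<rho>0\<close>. The exponent loses \<open>2 * \<rho>\<close> in the count,
    \<open>5 * \<rho>\<close> in the Birkhoff sum and \<open>\<rho>\<close> to constants, hence the
    eighth of \<open>\<gamma>\<close>.\<close>
  define \<rho> where "\<rho> = min (\<rho>0 / 6) (\<gamma> / 8)"
  have \<rho>: "\<rho> > 0" "5 * \<rho> < \<rho>0" "8 * \<rho> \<le> \<gamma>" using Gs(2) \<gamma> by (auto simp: \<rho>_def)
  obtain \<epsilon>1 where \<epsilon>1: "\<epsilon>1 > 0" "\<And>m (F :: 'a \<Rightarrow> 'a). simple_function \<nu> F \<Longrightarrow> m \<ge> 1 \<Longrightarrow>
    (\<And>y z i. F y = F z \<Longrightarrow> i < m \<Longrightarrow> dist ((f ^^ i) y) ((f ^^ i) z) \<le> \<epsilon>1) \<Longrightarrow>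
    real m * (h - \<rho>) \<le> label_entropy \<nu> F"
  proof (rule \<nu>.label_entropy_fine_ge[OF compact_UNIV c \<rho>(1)])
    fix \<epsilon> assume "\<epsilon> > 0" "\<And>m (F :: 'a \<Rightarrow> 'a). simple_function \<nu> F \<Longrightarrow> m \<ge> 1 \<Longrightarrow>
    (\<And>y z i. F y = F z \<Longrightarrow> i < m \<Longrightarrow> dist ((f ^^ i) y) ((f ^^ i) z) \<le> \<epsilon>) \<Longrightarrow>
    real m * (\<nu>.label_rate c - \<rho>) \<le> label_entropy \<nu> F"
    thus thesis unfolding h_def[symmetric] by (rule that)
  qed
  obtain \<epsilon>2 where \<epsilon>2: "\<epsilon>2 > 0" "\<And>g y z. g \<in> \<Gamma> \<Longrightarrow> dist y z < \<epsilon>2 \<Longrightarrow> \<bar>g y - g z\<bar> < \<rho>"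
    by (rule uniformly_continuous_finite_family[OF compact_UNIV \<Gamma> \<rho>(1)]) blast+
  obtain \<epsilon>0 where \<epsilon>0: "\<epsilon>0 > 0" "\<And>\<epsilon>. 0 < \<epsilon> \<Longrightarrow> \<epsilon> < \<epsilon>0 \<Longrightarrow> \<exists>K. gibbs_at \<epsilon> K"
    by (rule gibbs_bounds) blast
  \<comment> \<open>The half is for \<open>\<epsilon>1\<close>: two points with the same value of
    \<open>F\<close> are both \<open>\<epsilon>\<close>-close to it, hence
    \<open>2 * \<epsilon>\<close>-close to each other.\<close>
  define \<epsilon> where "\<epsilon> = min \<epsilon>1 (min \<epsilon>2 \<epsilon>0) / 2"
  have \<epsilon>: "\<epsilon> > 0" "2 * \<epsilon> \<le> \<epsilon>1" "\<epsilon> < \<epsilon>2" "\<epsilon> / 6 < \<epsilon>0"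
    using \<epsilon>1(1) \<epsilon>2(1) \<epsilon>0(1) by (auto simp: \<epsilon>_def)
  obtain K where K: "K > 0" "\<And>y n. y \<in> W \<Longrightarrow> n \<ge> 1 \<Longrightarrow>
    exp (birkhoff_sum f G n y - real n * ?P) \<le> K * measure \<mu> (unstable_bowen_ball f x y n (\<epsilon> / 6))"
    using \<epsilon>0(2)[of "\<epsilon> / 6"] \<epsilon>(1,4) unfolding gibbs_at_def weight_def by auto
  \<comment> \<open>Accuracy \<open>\<epsilon> / 3\<close> is for separating the balls; accuracy
    \<open>\<delta>\<close> makes the starting points lie in \<open>W\<close>.\<close>
  have "min (\<epsilon> / 3) \<delta> > 0" using \<epsilon>(1) \<delta>(1) by simp
  from unstable_specification[OF mix this]
  obtain M where M: "\<And>m x s. m \<ge> 1 \<Longrightarrow> \<exists>y. usim x y \<and> dist x y < min (\<epsilon> / 3) \<delta> \<and>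
     (\<forall>j<length s. \<forall>i<m. dist ((f ^^ (j * (m + M) + M + i)) y) ((f ^^ i) (s ! j)) < min (\<epsilon> / 3) \<delta>)"
    by blast
  \<comment> \<open>Price of one unit of time outside the blocks: \<open>2 * B\<close> in the
    Birkhoff sum and \<open>h\<close> in entropy. As \<open>M\<close> is already fixed,
    \<open>m\<close> can be chosen so that gaps cost at most \<open>\<rho>\<close> per unit of
    time.\<close>
  define D where "D = 2 * B + h"
  have D: "D > 0" using B(1) h0 by (simp add: D_def)
  obtain m0 :: nat where m0: "real m0 > real M * D / \<rho>" using reals_Archimedean2 by blast
  define m where "m = max m0 1"
  have m: "m \<ge> 1" "real M * D \<le> real m * \<rho>"
  proof -
    have "real M * D / \<rho> \<le> real m" using m0 by (simp add: m_def)
    thus "real M * D \<le> real m * \<rho>" using \<rho>(1) by (simp add: field_simps)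
  qed (simp add: m_def)
  define L where "L = m + M"
  have L: "L \<ge> 1" using m(1) by (simp add: L_def)
  obtain E where E: "finite E" "separated_set f m \<epsilon> E"
    "\<And>y. \<exists>e\<in>E. \<forall>i<m. dist ((f ^^ i) y) ((f ^^ i) e) \<le> \<epsilon>"
    by (rule maximal_separated_set[OF compact_UNIV f_cont \<epsilon>(1), of UNIV m]) blast
  define Q where "Q e = (\<Inter>i<m. {y. dist ((f ^^ i) y) ((f ^^ i) e) \<le> \<epsilon>})" for e
  have Qc: "closed (Q e)" for e
  proof -
    have "closed {y. dist ((f ^^ i) y) ((f ^^ i) e) \<le> \<epsilon>}" for i
      by (intro closed_Collect_le continuous_intros funpow_continuous f_cont)
    thus ?thesis unfolding Q_def by (intro closed_INT) auto
  qed
  have Qcov: "UNIV \<subseteq> (\<Union>e\<in>E. Q e)"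
  proof
    fix y
    obtain e where "e \<in> E" "\<forall>i<m. dist ((f ^^ i) y) ((f ^^ i) e) \<le> \<epsilon>" using E(3) by blast
    thus "y \<in> (\<Union>e\<in>E. Q e)" by (intro UN_I[of e]) (auto simp: Q_def)
  qed
  obtain F where F: "simple_function \<nu> F" "range F \<subseteq> E" "\<And>y. y \<in> Q (F y)"
    by (rule \<nu>.closed_cover_label[OF E(1) Qc Qcov]) blast
  have Fe: "dist ((f ^^ i) y) ((f ^^ i) (F y)) \<le> \<epsilon>" if "i < m" for i y
    using F(3)[of y] that by (simp add: Q_def)
  define H where "H = label_entropy \<nu> F"
  have H: "real m * (h - \<rho>) \<le> H"
    unfolding H_def
  proof (rule \<epsilon>1(2)[OF F(1) m(1)])
    fix y z i assume "F y = F z" "i < m"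
    hence "dist ((f ^^ i) y) ((f ^^ i) (F y)) \<le> \<epsilon>" "dist ((f ^^ i) z) ((f ^^ i) (F y)) \<le> \<epsilon>"
      using Fe[of i y] Fe[of i z] by auto
    hence "dist ((f ^^ i) y) ((f ^^ i) z) \<le> 2 * \<epsilon>" by metric
    thus "dist ((f ^^ i) y) ((f ^^ i) z) \<le> \<epsilon>1" using \<epsilon>(2) by linarith
  qed
  \<comment> \<open>The law of one block: the distribution of the separated point that represents a
    \<open>\<nu>\<close>-random orbit segment.\<close>
  define p where "p e = measure \<nu> (F -` {e})" for e
  have p0: "0 \<le> p e" for e by (simp add: p_def)
  have pint: "(\<Sum>e\<in>E. p e * \<phi> e) = (\<integral>y. \<phi> (F y) \<partial>\<nu>)" for \<phi> :: "'a \<Rightarrow> real"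
  proof -
    have "p e = 0" if "e \<notin> range F" for e
    proof -
      have "F -` {e} = {}" using that by auto
      thus ?thesis by (simp add: p_def)
    qed
    hence "(\<Sum>e\<in>range F. p e * \<phi> e) = (\<Sum>e\<in>E. p e * \<phi> e)"
      using E(1) F(2) by (intro sum.mono_neutral_left) auto
    thus ?thesis using \<nu>.integral_simple_label(1)[OF F(1), of \<phi>] by (simp add: p_def)
  qed
  have p1: "(\<Sum>e\<in>E. p e) = 1" using pint[of "\<lambda>_. 1"] \<nu>.prob_space by simp
  have pH: "(\<Sum>e\<in>E. p e * (- ln (p e))) = H"
  proof -
    have "(\<integral>y. - ln (p (F y)) \<partial>\<nu>) = H"
      using \<nu>.integral_simple_label(1)[OF F(1), of "\<lambda>e. - ln (p e)"]
      by (simp add: H_def label_entropy_def p_def sum_negf)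
    thus ?thesis using pint[of "\<lambda>e. - ln (p e)"] by simp
  qed
  have mean: "\<bar>(\<Sum>e\<in>E. p e * birkhoff_sum f g m e) - real m * (\<integral>y. g y \<partial>\<nu>)\<bar> \<le> real m * \<rho>" if g: "g \<in> \<Gamma>" for g
  proof -
    have gm: "g \<in> borel_measurable borel" by (rule borel_measurable_continuous_onI[OF \<Gamma>(2)[OF g]])
    have ig: "integrable \<nu> (\<lambda>y. g ((f ^^ i) y))" for i
      by (intro integrable_continuous_compact compact_UNIV \<nu>.finite_measure_axioms \<nu>.sets_eq
          continuous_on_compose2[OF \<Gamma>(2)[OF g] funpow_continuous[OF f_cont]]) auto
    have iS: "integrable \<nu> (birkhoff_sum f g m)"
      unfolding birkhoff_sum_def[abs_def] by (intro Bochner_Integration.integrable_sum ig)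
    have "(\<integral>y. birkhoff_sum f g m y \<partial>\<nu>) = (\<Sum>i<m. \<integral>y. g ((f ^^ i) y) \<partial>\<nu>)"
      unfolding birkhoff_sum_def by (rule Bochner_Integration.integral_sum) (rule ig)
    also have "\<dots> = real m * (\<integral>y. g y \<partial>\<nu>)" by (simp add: \<nu>.integral_funpow[OF gm])
    finally have S: "(\<integral>y. birkhoff_sum f g m y \<partial>\<nu>) = real m * (\<integral>y. g y \<partial>\<nu>)" .
    have iF: "integrable \<nu> (\<lambda>y. birkhoff_sum f g m (F y))" by (rule \<nu>.integral_simple_label(2)[OF F(1)])
    have "\<bar>birkhoff_sum f g m (F y) - birkhoff_sum f g m y\<bar> \<le> real m * \<rho>" for y
    proof (rule birkhoff_sum_diff_le)
      fix i assume "i < m"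
      hence "dist ((f ^^ i) (F y)) ((f ^^ i) y) < \<epsilon>2" using Fe[of i y] \<epsilon>(3) by (simp add: dist_commute)
      from \<epsilon>2(2)[OF g this] show "\<bar>g ((f ^^ i) (F y)) - g ((f ^^ i) y)\<bar> \<le> \<rho>" by simp
    qed
    hence "(\<integral>y. \<bar>birkhoff_sum f g m (F y) - birkhoff_sum f g m y\<bar> \<partial>\<nu>) \<le> (\<integral>y. real m * \<rho> \<partial>\<nu>)"
      using iF iS by (intro integral_mono) auto
    hence "(\<integral>y. \<bar>birkhoff_sum f g m (F y) - birkhoff_sum f g m y\<bar> \<partial>\<nu>) \<le> real m * \<rho>"
      using \<nu>.prob_space by simp
    moreover have "\<bar>\<integral>y. birkhoff_sum f g m (F y) - birkhoff_sum f g m y \<partial>\<nu>\<bar>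
        \<le> (\<integral>y. \<bar>birkhoff_sum f g m (F y) - birkhoff_sum f g m y\<bar> \<partial>\<nu>)"
      by (rule integral_abs_bound)
    ultimately show ?thesis using iF iS S pint[of "birkhoff_sum f g m"] by simp
  qed
  \<comment> \<open>Including \<open>- ln p\<close> makes every typical sequence individually
    improbable, which bounds the number of typical sequences from below.\<close>
  define \<Phi> where "\<Phi> = insert (\<lambda>e. - ln (p e)) ((\<lambda>g. birkhoff_sum f g m) ` \<Gamma>)"
  have \<Phi>: "finite \<Phi>" using \<Gamma>(1) by (simp add: \<Phi>_def)
  obtain N0 where N0: "\<And>N. N \<ge> N0 \<Longrightarrow>
    1 / 2 \<le> (\<Sum>s | set s \<subseteq> E \<and> length s = N \<and>
      (\<forall>\<phi>\<in>\<Phi>. \<bar>sum_list (map \<phi> s) - real N * (\<Sum>a\<in>E. p a * \<phi> a)\<bar> \<le> real N * \<rho>). prod_list (map p s))"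
    by (rule weak_law_words[OF E(1) p1 p0 \<Phi> \<rho>(1)]) blast
  obtain n1 :: nat where n1: "real n1 > real L * D / \<rho>" using reals_Archimedean2 by blast
  obtain n2 :: nat where n2: "real n2 > ln (2 * K) / \<rho>" using reals_Archimedean2 by blast
  have "exp (real n * r) \<le> measure \<mu> {y. orbital_measure f n y \<in> J}"
    if n: "n \<ge> max (max n1 n2) (max 1 (N0 * L))" for n
  proof -
    have nn: "n \<ge> n1" "n \<ge> n2" "n \<ge> 1" "n \<ge> N0 * L" using n by auto
    define N where "N = n div L"
    define u where "u = n mod L"
    have nNu: "n = N * L + u" "u < L" using L by (auto simp: N_def u_def)
    have NN0: "N \<ge> N0" using nn(4) L by (simp add: N_def less_eq_div_iff_mult_less_eq)
    have Nm: "real N * real m \<le> real n"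
    proof -
      have "N * m \<le> N * L" by (simp add: L_def)
      also have "\<dots> \<le> n" using nNu by simp
      finally show ?thesis by (metis of_nat_le_iff of_nat_mult)
    qed
    have Nn: "real N \<le> real n"
      using Nm mult_left_mono[of 1 "real m" "real N"] m(1) by simp
    have nreal: "real n = real N * real m + real N * real M + real u"
      using arg_cong[OF nNu(1), of real] by (simp add: L_def distrib_left)
    \<comment> \<open>Total time outside the \<open>N\<close> blocks: all gaps and the final
      remainder.\<close>
    define R where "R = real N * real M + real u"
    have R0: "R \<ge> 0" by (simp add: R_def)
    have RD: "R * D \<le> 2 * (real n * \<rho>)"
    proof -
      have "real N * (real M * D) \<le> real N * (real m * \<rho>)" by (rule mult_left_mono[OF m(2)]) simp
      also have "\<dots> = (real N * real m) * \<rho>" by simp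
      also have "\<dots> \<le> real n * \<rho>" by (rule mult_right_mono[OF Nm]) (use \<rho>(1) in simp)
      finally have 1: "real N * real M * D \<le> real n * \<rho>" by simp
      have "real u * D \<le> real L * D" using nNu(2) D by (intro mult_right_mono) auto
      also have "\<dots> \<le> real n * \<rho>"
      proof -
        have "real n1 \<le> real n" using nn(1) by simp
        hence "real L * D / \<rho> \<le> real n" using n1 by linarith
        thus ?thesis using \<rho>(1) by (simp add: field_simps)
      qed
      finally show ?thesis using 1 by (simp add: R_def distrib_right)
    qed
    have RB: "2 * B * R + h * R \<le> 2 * (real n * \<rho>)" using RD by (simp add: D_def algebra_simps)
    define T where "T = {s. set s \<subseteq> E \<and> length s = N \<and>
      (\<forall>\<phi>\<in>\<Phi>. \<bar>sum_list (map \<phi> s) - real N * (\<Sum>a\<in>E. p a * \<phi> a)\<bar> \<le> real N * \<rho>)}"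
    have finT: "finite T"
      by (rule finite_subset[OF _ finite_lists_length_eq[OF E(1), of N]]) (auto simp: T_def)
    have T: "set s \<subseteq> E" "length s = N" if "s \<in> T" for s using that by (auto simp: T_def)
    have T\<Phi>: "\<bar>sum_list (map \<phi> s) - real N * (\<Sum>a\<in>E. p a * \<phi> a)\<bar> \<le> real N * \<rho>"
      if "s \<in> T" "\<phi> \<in> \<Phi>" for s \<phi> using that by (auto simp: T_def)
    have half: "1 / 2 \<le> (\<Sum>s\<in>T. prod_list (map p s))" using N0[OF NN0] by (simp add: T_def)
    have "\<exists>y. usim x y \<and> dist x y < min (\<epsilon> / 3) \<delta> \<and>
     (\<forall>j<length s. \<forall>i<m. dist ((f ^^ (j * L + M + i)) y) ((f ^^ i) (s ! j)) < min (\<epsilon> / 3) \<delta>)" for s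
      using M[OF m(1), of x s] by (simp add: L_def)
    then obtain Y where Y: "\<And>s. usim x (Y s)" "\<And>s. dist x (Y s) < \<delta>"
      "\<And>s j i. j < length s \<Longrightarrow> i < m \<Longrightarrow> dist ((f ^^ (j * L + M + i)) (Y s)) ((f ^^ i) (s ! j)) < \<epsilon> / 3"
      by (metis min_less_iff_conj)
    have YW: "Y s \<in> W" for s using Y(1,2) \<delta>(2) by (simp add: local_unstable_iff_usim)
    let ?B = "\<lambda>s. unstable_bowen_ball f x (Y s) n (\<epsilon> / 6)"
    have time: "j * L + M + i < n" if "j < N" "i < m" for i j
    proof -
      have "Suc j * L \<le> N * L" using that(1) by (intro mult_le_mono1) simp
      thus ?thesis using that(2) nNu(1) by (simp add: L_def)
    qed
    \<comment> \<open>Two shadowing errors below \<open>\<epsilon> / 3\<close> and two radii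
      \<open>\<epsilon> / 6\<close> add up to less than \<open>\<epsilon>\<close>, while different
      blocks from \<open>E\<close> are more than \<open>\<epsilon>\<close> apart at some
      time.\<close>
    have disj: "?B s \<inter> ?B s' = {}" if s: "s \<in> T" "s' \<in> T" "s \<noteq> s'" for s s'
    proof (rule ccontr)
      assume "\<not> ?thesis"
      then obtain z where z: "z \<in> ?B s" "z \<in> ?B s'" by blast
      obtain j where j: "j < N" "s ! j \<noteq> s' ! j"
        using s T(2)[OF s(1)] T(2)[OF s(2)] nth_equalityI[of s s'] by auto
      have "s ! j \<in> E" "s' ! j \<in> E"
        using j(1) T[OF s(1)] T[OF s(2)] by auto
      then obtain i where i: "i < m" "dist ((f ^^ i) (s ! j)) ((f ^^ i) (s' ! j)) > \<epsilon>"
        using E(2) j(2) unfolding separated_set_def by blast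
      let ?k = "j * L + M + i"
      have "dist ((f ^^ ?k) (Y s)) ((f ^^ i) (s ! j)) < \<epsilon> / 3" "dist ((f ^^ ?k) (Y s')) ((f ^^ i) (s' ! j)) < \<epsilon> / 3"
        using Y(3)[of j s i] Y(3)[of j s' i] j(1) i(1) T(2)[OF s(1)] T(2)[OF s(2)] by auto
      moreover have "dist ((f ^^ ?k) z) ((f ^^ ?k) (Y s)) < \<epsilon> / 6" "dist ((f ^^ ?k) z) ((f ^^ ?k) (Y s')) < \<epsilon> / 6"
        using z time[OF j(1) i(1)] by (auto simp: unstable_bowen_ball_def)
      ultimately show False using i(2) by metric
    qed
    \<comment> \<open>The direct estimate is \<open>3 * (n * \<rho>) + 2 * B * R\<close>. Rewriting
      it by \<open>RB\<close> with the term \<open>- h * R\<close> retained lets this term cancel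
      the entropy loss \<open>h * R\<close> in \<open>cardT\<close>.\<close>
    have sums: "\<bar>birkhoff_sum f g n z - real n * (\<integral>y. g y \<partial>\<nu>)\<bar> \<le> 5 * real n * \<rho> - h * R"
      if s: "s \<in> T" and g: "g \<in> \<Gamma>" and z: "\<And>k. k < n \<Longrightarrow> dist ((f ^^ k) z) ((f ^^ k) (Y s)) < \<epsilon> / 6" for s g z
    proof -
      have 1: "\<bar>birkhoff_sum f g (length s * (m + M)) z - sum_list (map (birkhoff_sum f g m) s)\<bar>
        \<le> real (length s) * (real m * \<rho> + real M * B)"
      proof (rule birkhoff_sum_blocks[OF B(2)[OF g]])
        fix j i assume j: "j < length s" and i: "i < m"
        let ?k = "j * L + M + i"
        have "dist ((f ^^ ?k) z) ((f ^^ ?k) (Y s)) < \<epsilon> / 6"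
          using j i T(2)[OF s] by (intro z time) auto
        moreover have "dist ((f ^^ ?k) (Y s)) ((f ^^ i) (s ! j)) < \<epsilon> / 3" by (rule Y(3)[OF j i])
        ultimately have "dist ((f ^^ ?k) z) ((f ^^ i) (s ! j)) < \<epsilon>2" using \<epsilon>(1,3) by metric
        from \<epsilon>2(2)[OF g this] show "\<bar>g ((f ^^ (j * (m + M) + M + i)) z) - g ((f ^^ i) (s ! j))\<bar> \<le> \<rho>"
          by (simp add: L_def)
      qed
      define S1 where "S1 = birkhoff_sum f g (N * L) z"
      define S2 where "S2 = sum_list (map (birkhoff_sum f g m) s)"
      define mn where "mn = (\<Sum>e\<in>E. p e * birkhoff_sum f g m e)"
      define I where "I = (\<integral>y. g y \<partial>\<nu>)"
      have a1: "\<bar>S1 - S2\<bar> \<le> real N * real m * \<rho> + real N * real M * B"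
        using 1 T(2)[OF s] by (simp add: S1_def S2_def L_def distrib_left)
      have a2: "\<bar>S2 - real N * mn\<bar> \<le> real N * \<rho>"
        unfolding S2_def mn_def by (rule T\<Phi>[OF s]) (use g in \<open>auto simp: \<Phi>_def\<close>)
      have "real N * \<bar>mn - real m * I\<bar> \<le> real N * (real m * \<rho>)"
        using mean[OF g] by (intro mult_left_mono) (auto simp: mn_def I_def)
      hence a3: "\<bar>real N * mn - real N * real m * I\<bar> \<le> real N * real m * \<rho>"
        by (simp add: abs_mult[of "real N", symmetric, simplified] right_diff_distrib mult.assoc flip: abs_mult)
      have "\<bar>I\<bar> \<le> B"
      proof -
        have "\<bar>I\<bar> \<le> (\<integral>y. \<bar>g y\<bar> \<partial>\<nu>)" unfolding I_def by (rule integral_abs_bound)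
        also have "\<dots> \<le> (\<integral>y. B \<partial>\<nu>)"
          using integrable_continuous_compact[OF compact_UNIV \<nu>.finite_measure_axioms \<nu>.sets_eq \<Gamma>(2)[OF g]] B(2)[OF g]
          by (intro integral_mono) auto
        finally show ?thesis using \<nu>.prob_space by simp
      qed
      hence "\<bar>R * I\<bar> \<le> R * B" using R0 by (simp add: abs_mult mult_left_mono)
      moreover have "real N * real m * I - real n * I = - (R * I)"
        unfolding nreal R_def by (simp add: algebra_simps)
      ultimately have a4: "\<bar>real N * real m * I - real n * I\<bar> \<le> R * B" by simp
      have "birkhoff_sum f g n z = S1 + birkhoff_sum f g u ((f ^^ (N * L)) z)"
        unfolding S1_def nNu(1) by (rule birkhoff_sum_add)
      hence a5: "\<bar>birkhoff_sum f g n z - S1\<bar> \<le> real u * B"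
        using birkhoff_sum_abs_le[where f=f and n=u and y="(f ^^ (N * L)) z", OF B(2)[OF g]] by simp
      have a6: "real N * real m * \<rho> \<le> real n * \<rho>" "real N * \<rho> \<le> real n * \<rho>"
        using Nm Nn \<rho>(1) by (auto intro: mult_right_mono)
      have "real N * real M * B + real u * B + R * B = 2 * B * R"
        by (simp add: R_def algebra_simps)
      hence "\<bar>birkhoff_sum f g n z - real n * I\<bar> \<le> 3 * (real n * \<rho>) + 2 * B * R"
        using a1 a2 a3 a4 a5 a6 by linarith
      thus ?thesis using RB unfolding I_def by linarith
    qed
    have hR: "0 \<le> h * R" using h0 R0 by simp
    have inJ: "?B s \<subseteq> {y. orbital_measure f n y \<in> J}" if s: "s \<in> T" for s
    proof
      fix z assume z: "z \<in> ?B s"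
      have "orbital_measure f n z \<in> J"
      proof (rule Gs(4)[OF orbital_measure_in[OF nn(3)]])
        fix g assume g: "g \<in> Gs"
        have eq: "(\<integral>y. g y \<partial>orbital_measure f n z) = birkhoff_sum f g n z / real n"
          by (rule integral_orbital_measure[OF nn(3) borel_measurable_continuous_onI[OF Gs(3)[OF g]]])
        have *: "\<bar>birkhoff_sum f g n z - real n * (\<integral>y. g y \<partial>\<nu>)\<bar> \<le> 5 * real n * \<rho> - h * R"
          using z g by (intro sums[OF s]) (auto simp: \<Gamma>_def unstable_bowen_ball_def)
        show "\<bar>(\<integral>y. g y \<partial>orbital_measure f n z) - (\<integral>y. g y \<partial>\<nu>)\<bar> < \<rho>0"
        proof -
          have "\<bar>birkhoff_sum f g n z - real n * (\<integral>y. g y \<partial>\<nu>)\<bar> \<le> real n * (5 * \<rho>)"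
            using * hR by simp
          moreover have "birkhoff_sum f g n z / real n - (\<integral>y. g y \<partial>\<nu>)
              = (birkhoff_sum f g n z - real n * (\<integral>y. g y \<partial>\<nu>)) / real n"
            using nn(3) by (simp add: diff_divide_distrib)
          ultimately have "\<bar>birkhoff_sum f g n z / real n - (\<integral>y. g y \<partial>\<nu>)\<bar> \<le> 5 * \<rho>"
            using nn(3) by (simp add: divide_le_eq mult.commute)
          thus ?thesis using eq \<rho>(2) by linarith
        qed
      qed
      thus "z \<in> {y. orbital_measure f n y \<in> J}" by simp
    qed
    have BS: "?B s \<in> sets \<mu>" for s using unstable_bowen_ball_borel by (simp add: sets_\<mu>)
    have JS: "{y. orbital_measure f n y \<in> J} \<in> sets \<mu>"
      using open_orbital_measure_vimage[OF f_cont nn(3) \<nu>(3)] by (simp add: sets_\<mu> borel_open)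
    \<comment> \<open>Typical sequences carry total weight at least one half, and each weighs at
      most the stated exponential.\<close>
    have cardT: "exp (real n * h - h * R - 2 * (real n * \<rho>)) / 2 \<le> real (card T)"
    proof -
      have "prod_list (map p s) \<le> exp (- (real n * h - h * R - 2 * (real n * \<rho>)))" if s: "s \<in> T" for s
      proof -
        have "\<bar>sum_list (map (\<lambda>e. - ln (p e)) s) - real N * H\<bar> \<le> real N * \<rho>"
          using T\<Phi>[OF s, of "\<lambda>e. - ln (p e)"] unfolding pH by (simp add: \<Phi>_def)
        moreover have "real N * (real m * (h - \<rho>)) \<le> real N * H"
          using H by (intro mult_left_mono) auto
        moreover have "real N * real m = real n - R" by (simp add: nreal R_def)
        hence "real N * (real m * (h - \<rho>)) = real n * h - h * R - real N * real m * \<rho>"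
          by (metis (no_types, opaque_lifting) left_diff_distrib mult.assoc mult.commute right_diff_distrib)
        moreover have "real N * real m * \<rho> \<le> real n * \<rho>" "real N * \<rho> \<le> real n * \<rho>"
          using Nm Nn \<rho>(1) by (auto intro: mult_right_mono)
        ultimately have "real n * h - h * R - 2 * (real n * \<rho>) \<le> sum_list (map (\<lambda>e. - ln (p e)) s)"
          by linarith
        thus ?thesis using prod_list_le_exp[of p s, OF p0] by (meson exp_le_cancel_iff le_imp_neg_le order_trans)
      qed
      hence "(\<Sum>s\<in>T. prod_list (map p s)) \<le> (\<Sum>s\<in>T. exp (- (real n * h - h * R - 2 * (real n * \<rho>))))"
        by (rule sum_mono)
      hence "1 / 2 \<le> real (card T) * exp (- (real n * h - h * R - 2 * (real n * \<rho>)))"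
        using half by simp
      thus ?thesis by (simp only: exp_minus) (simp add: field_simps)
    qed
    define I where "I = (\<integral>y. G y \<partial>\<nu>)"
    define v where "v = real n * I - 5 * real n * \<rho> + h * R - real n * ?P"
    have vB: "exp v \<le> K * measure \<mu> (?B s)" if s: "s \<in> T" for s
    proof -
      have "\<bar>birkhoff_sum f G n (Y s) - real n * (\<integral>y. G y \<partial>\<nu>)\<bar> \<le> 5 * real n * \<rho> - h * R"
        by (rule sums[OF s]) (use \<epsilon>(1) in \<open>auto simp: \<Gamma>_def\<close>)
      hence "v \<le> birkhoff_sum f G n (Y s) - real n * ?P"
        unfolding v_def I_def by linarith
      hence "exp v \<le> exp (birkhoff_sum f G n (Y s) - real n * ?P)" by simp
      also have "\<dots> \<le> K * measure \<mu> (?B s)" by (rule K(2)[OF YW nn(3)])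
      finally show ?thesis .
    qed
    have "(exp (real n * h - h * R - 2 * (real n * \<rho>)) / 2) * exp v \<le> real (card T) * exp v"
      using cardT by (intro mult_right_mono) auto
    also have "\<dots> = (\<Sum>s\<in>T. exp v)" by simp
    also have "\<dots> \<le> (\<Sum>s\<in>T. K * measure \<mu> (?B s))" by (intro sum_mono vB)
    also have "\<dots> = K * (\<Sum>s\<in>T. measure \<mu> (?B s))" by (simp add: sum_distrib_left)
    also have "(\<Sum>s\<in>T. measure \<mu> (?B s)) = measure \<mu> (\<Union>s\<in>T. ?B s)"
      using BS disj finT by (intro \<mu>.finite_measure_finite_Union[symmetric]) (auto simp: disjoint_family_on_def)
    also have "\<dots> \<le> measure \<mu> {y. orbital_measure f n y \<in> J}"
      using inJ JS by (intro \<mu>.finite_measure_mono) auto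
    finally have lower: "exp (real n * h - h * R - 2 * (real n * \<rho>)) / 2 * exp v
        \<le> K * measure \<mu> {y. orbital_measure f n y \<in> J}"
      using K(1) by simp
    have "2 * K \<le> exp (real n * \<rho>)"
    proof -
      have "real n2 \<le> real n" using nn(2) by simp
      hence "ln (2 * K) / \<rho> \<le> real n" using n2 by linarith
      hence "ln (2 * K) \<le> real n * \<rho>" using \<rho>(1) by (simp add: field_simps)
      thus ?thesis using K(1) by (metis exp_le_cancel_iff exp_ln mult_pos_pos zero_less_numeral)
    qed
    hence "2 * K * exp (real n * r) \<le> exp (real n * \<rho>) * exp (real n * r)"
      by (intro mult_right_mono) auto
    also have "\<dots> = exp (real n * \<rho> + real n * r)" by (simp add: exp_add)
    also have "\<dots> \<le> exp ((real n * h - h * R - 2 * (real n * \<rho>)) + v)"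
    proof -
      have "real n * (8 * \<rho>) \<le> real n * \<gamma>" using \<rho>(3) by (intro mult_left_mono) auto
      moreover have "real n * \<gamma> = real n * h + real n * I - real n * ?P - real n * r"
        by (simp add: \<gamma>_def I_def algebra_simps)
      ultimately show ?thesis unfolding exp_le_cancel_iff v_def by linarith
    qed
    also have "\<dots> = exp (real n * h - h * R - 2 * (real n * \<rho>)) * exp v" by (simp add: exp_add)
    finally have "K * exp (real n * r) \<le> exp (real n * h - h * R - 2 * (real n * \<rho>)) / 2 * exp v"
      by simp
    hence "K * exp (real n * r) \<le> K * measure \<mu> {y. orbital_measure f n y \<in> J}"
      using lower by linarith
    thus ?thesis using K(1) by simp
  qed
  thus ?thesis by blast
qed

text \<open>A measure in \<open>J\<close> with finite rate is invariant. Its entropy is a supremum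
  over partitions, so a strict inequality is already witnessed by one partition, that is by one
  label.\<close>

lemma lower_bound:
  assumes mix: "topologically_mixing f" and J: "openin weak_star J"
  shows "- (INF \<nu>\<in>J. rate_function f G \<nu>)
    \<le> liminf (\<lambda>n. elog (measure \<mu> {y. orbital_measure f n y \<in> J}) / ereal (real n))"
proof (rule dense_le)
  fix z assume z: "z < - (INF \<nu>\<in>J. rate_function f G \<nu>)"
  show "z \<le> liminf (\<lambda>n. elog (measure \<mu> {y. orbital_measure f n y \<in> J}) / ereal (real n))"
  proof (cases z)
    case (real r)
    have "(INF \<nu>\<in>J. rate_function f G \<nu>) < - ereal r"
      using z real ereal_less_uminus_reorder by blast
    then obtain \<nu> where \<nu>: "\<nu> \<in> J" "rate_function f G \<nu> < - ereal r"
      unfolding INF_less_iff by blast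
    have inv: "\<nu> \<in> invariant_measures f"
      using \<nu>(2) by (auto simp: rate_function_def split: if_splits)
    interpret \<nu>: invariant_measure \<nu> f by (rule invariant_measuresD[OF inv])
    have "ereal (r + topological_pressure f G - (\<integral>y. G y \<partial>\<nu>)) < ms_entropy f \<nu>"
      using \<nu>(2) inv by (cases "ms_entropy f \<nu>") (auto simp: rate_function_def)
    then obtain P where P: "finite_meas_partition \<nu> P"
      "ereal (r + topological_pressure f G - (\<integral>y. G y \<partial>\<nu>)) < ereal (entropy_wrt_partition f \<nu> P)"
      unfolding ms_entropy_def less_SUP_iff by blast
    obtain c :: "'a \<Rightarrow> 'a set" where c: "simple_function \<nu> c" "entropy_wrt_partition f \<nu> P = \<nu>.label_rate c"
      by (rule \<nu>.finite_meas_partition_label[OF P(1)])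
    have "r < \<nu>.label_rate c + (\<integral>y. G y \<partial>\<nu>) - topological_pressure f G"
      using P(2) c(2) by simp
    from lower_label[OF mix inv \<nu>(1) J c(1) this]
    obtain N where "\<And>n. n \<ge> N \<Longrightarrow> exp (real n * r) \<le> measure \<mu> {y. orbital_measure f n y \<in> J}" by blast
    hence "ereal r \<le> liminf (\<lambda>n. elog (measure \<mu> {y. orbital_measure f n y \<in> J}) / ereal (real n))"
      by (rule elog_liminf_ge)
    thus ?thesis by (simp add: real)
  qed (use z in auto)
qed

end

lemma holder_continuous_imp_continuous:
  assumes "holder_continuous G" shows "continuous_on UNIV G"
proof -
  obtain C \<alpha> where C: "0 < \<alpha>" "\<And>x y. \<bar>G x - G y\<bar> \<le> C * dist x y powr \<alpha>"
    using assms unfolding holder_continuous_def by blast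
  have "isCont G x" for x
  proof -
    have "((\<lambda>y. dist y x) \<longlongrightarrow> 0) (at x)"
      by (rule tendsto_dist_iff[THEN iffD1]) (rule tendsto_ident_at)
    hence "((\<lambda>y. dist y x powr \<alpha>) \<longlongrightarrow> 0 powr \<alpha>) (at x)"
      using C(1) by (intro tendsto_powr' tendsto_const) auto
    hence "((\<lambda>y. C * dist y x powr \<alpha>) \<longlongrightarrow> 0) (at x)"
      by (simp add: tendsto_mult_right_zero)
    hence "((\<lambda>y. G y - G x) \<longlongrightarrow> 0) (at x)"
      by (rule Lim_null_comparison[rotated]) (simp add: C(2))
    thus ?thesis by (simp add: isCont_def LIM_zero_iff)
  qed
  thus ?thesis by (simp add: continuous_at_imp_continuous_on)
qed

theorem theorem1:
  fixes f :: "'a::metric_space \<Rightarrow> 'a" and br :: "'a \<Rightarrow> 'a \<Rightarrow> 'a"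
    and G :: "'a \<Rightarrow> real" and \<mu>G :: "'a measure"
  assumes "smale_space f br" and "topologically_mixing f"
    and "holder_continuous G" and "equilibrium_state f G \<mu>G"
  shows "AE x in \<mu>G. \<exists>\<delta>0>0. \<forall>\<delta>. 0 < \<delta> \<and> \<delta> < \<delta>0 \<longrightarrow>
           (\<forall>\<mu>u. conditional_gibbs f br G \<delta> x \<mu>u \<longrightarrow>
              (\<forall>K. closedin weak_star K \<longrightarrow>
                 limsup (\<lambda>n. elog (measure \<mu>u {y. orbital_measure f n y \<in> K}) / ereal (real n))
                   \<le> - (INF \<nu>\<in>K. rate_function f G \<nu>)) \<and>
              (\<forall>J. openin weak_star J \<longrightarrow>
                 liminf (\<lambda>n. elog (measure \<mu>u {y. orbital_measure f n y \<in> J}) / ereal (real n))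
                   \<ge> - (INF \<nu>\<in>J. rate_function f G \<nu>)))"
proof -
  obtain \<kappa> lam where "smale f br \<kappa> lam"
    by (rule smale_space_smale[OF assms(1)])
  interpret smale f br \<kappa> lam by fact
  have G: "continuous_on UNIV G"
    by (rule holder_continuous_imp_continuous[OF assms(3)])
  have setting: "gibbs_setting f br \<kappa> lam G \<delta> x \<mu>u"
    if "0 < \<delta> \<and> \<delta> < \<kappa>" "conditional_gibbs f br G \<delta> x \<mu>u" for \<delta> x \<mu>u
    using that G by unfold_locales auto
  show ?thesis
    \<comment> \<open>The threshold for \<open>\<delta>\<close> is the bracket scale
      \<open>\<kappa>\<close>, uniformly in the base point.\<close>
    by (intro AE_I2 exI[of _ \<kappa>] conjI allI impI \<kappa>_pos)
      (blast intro: gibbs_setting.upper_bound setting, blast intro: gibbs_setting.lower_bound setting assms(2))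
qed

end
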